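(* Any irreducible highest weight module with finite-dimensional weight spaces over $\mathrm{Vir}\otimes\mathbb{C}[t^{\pm1}]$ is (isomorphic to) a tensor product of finitely many generalized evaluation highest weight modules.
   Context: The Virasoro algebra $\mathrm{Vir}$ is the complex Lie algebra with basis $\{c,d_i : i\in\mathbb{Z}\}$ and brackets $[d_m,d_n]=(n-m)d_{m+n}+\delta_{m,-n}\frac{m^3-m}{12}c$, $[d_m,c]=0$. The loop-Virasoro algebra is $\mathcal{L}=\mathrm{Vir}\otimes\mathbb{C}[t^{\pm1}]$ with brackets $[d_i\otimes t^j,d_k\otimes t^l]=(k-i)\,d_{i+k}\otimes t^{j+l}+\delta_{i+k,0}\frac{i^3-i}{12}\,c\otimes t^{j+l}$, and with $c\otimes t^l$ central. Let $\mathcal{L}_i=(\mathbb{C}d_i\oplus\delta_{i,0}\mathbb{C}c)\otimes\mathbb{C}[t^{\pm1}]$ and $\mathcal{L}_+=\bigoplus_{i>0}\mathcal{L}_i$. Weight spaces are the eigenspaces of $d_0=d_0\otimes1$. For a linear map $\varphi:\mathcal{L}_0\to\mathbb{C}$, let $\mathbb{C}v_0$ be the one-dimensional $(\mathcal{L}_0+\mathcal{L}_+)$-module with $\mathcal{L}_+v_0=0$ and $xv_0=\varphi(x)v_0$ for $x\in\mathcal{L}_0$; let $\bar V(\varphi)=U(\mathcal{L})\otimes_{U(\mathcal{L}_0+\mathcal{L}_+)}\mathbb{C}v_0$ and let $V(\varphi)$ be the quotient of $\bar V(\varphi)$ by its unique maximal proper submodule. The irreducible highest weight modules are the modules $V(\varphi)$.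 A generalized evaluation highest weight module over $\mathcal{L}$ is a module $V(\varphi)$ for which there exist $a\in\mathbb{C}\setminus\{0\}$ and $n\in\mathbb{N}$ such that, with $P(t)=(t-a)^n$, $\varphi(d_0\otimes t^kP(t))=0$ and $\varphi(c\otimes t^kP(t))=0$ for all $k\in\mathbb{Z}$. *)

theory Defs
  imports
    "HOL-Library.Poly_Mapping"
    "HOL-Computational_Algebra.Polynomial"
    "HOL-Algebra.AbelCoset"
    "Jordan_Normal_Form.VS_Connect"
begin

section \<open>The loop-Virasoro algebra\<close>

text \<open>Vector spaces with a given basis are finitely supported functions on that basis.\<close>

definition cscale :: "complex \<Rightarrow> ('k \<Rightarrow>\<^sub>0 complex) \<Rightarrow> ('k \<Rightarrow>\<^sub>0 complex)" where
  "cscale c = Poly_Mapping.map ((*) c)"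

datatype vir_gen = Dgen int | Cgen

text \<open>The basis vector \<^term>\<open>(g, j)\<close> stands for \<open>g \<otimes> t\<^sup>j\<close>.\<close>

type_synonym lv_gen = "vir_gen \<times> int"

type_synonym loop_vir = "lv_gen \<Rightarrow>\<^sub>0 complex"

fun lv_gen_bracket :: "lv_gen \<Rightarrow> lv_gen \<Rightarrow> loop_vir" where
  "lv_gen_bracket (Dgen i, j) (Dgen k, l) =
     Poly_Mapping.single (Dgen (i + k), j + l) (of_int (k - i))
     + (if i + k = 0 then Poly_Mapping.single (Cgen, j + l) (of_int (i ^ 3 - i) / 12) else 0)"
| "lv_gen_bracket (Cgen, j) _ = 0"
| "lv_gen_bracket _ (Cgen, l) = 0"

definition lv_bracket :: "loop_vir \<Rightarrow> loop_vir \<Rightarrow> loop_vir" where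
  "lv_bracket x y =
     (\<Sum>a\<in>Poly_Mapping.keys x. \<Sum>b\<in>Poly_Mapping.keys y.
        cscale (Poly_Mapping.lookup x a * Poly_Mapping.lookup y b) (lv_gen_bracket a b))"

fun gen_degree :: "lv_gen \<Rightarrow> int" where
  "gen_degree (Dgen i, j) = i"
| "gen_degree (Cgen, j) = 0"

definition lv_zero_part :: "loop_vir set" where
  "lv_zero_part = {x. \<forall>a\<in>Poly_Mapping.keys x. gen_degree a = 0}"

definition lv_plus_part :: "loop_vir set" where
  "lv_plus_part = {x. \<forall>a\<in>Poly_Mapping.keys x. gen_degree a > 0}"

definition lv_d0 :: loop_vir where
  "lv_d0 = Poly_Mapping.single (Dgen 0, 0) 1"

text \<open>The element \<open>g \<otimes> t\<^sup>k P(t)\<close>.\<close>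

definition lv_tensor_poly :: "vir_gen \<Rightarrow> int \<Rightarrow> complex poly \<Rightarrow> loop_vir" where
  "lv_tensor_poly g k P =
     (\<Sum>j\<le>degree P. Poly_Mapping.single (g, k + int j) (coeff P j))"

text \<open>A linear map from \<^const>\<open>lv_zero_part\<close> to the complex numbers is represented by a function on
  the whole algebra, of which only the restriction to \<^const>\<open>lv_zero_part\<close> is ever used.\<close>

definition zero_part_functional :: "(loop_vir \<Rightarrow> complex) \<Rightarrow> bool" where
  "zero_part_functional \<phi> \<longleftrightarrow>
     (\<forall>x\<in>lv_zero_part. \<forall>y\<in>lv_zero_part. \<phi> (x + y) = \<phi> x + \<phi> y) \<and>
     (\<forall>c. \<forall>x\<in>lv_zero_part. \<phi> (cscale c x) = c * \<phi> x)"


section \<open>The universal enveloping algebra\<close>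

text \<open>The tensor algebra of the loop-Virasoro algebra is the free associative algebra on its basis,
  i.e. the monoid algebra of the free monoid of words (convolution product of \<open>\<Rightarrow>\<^sub>0\<close>). The words are
  wrapped into a type of their own to carry the additively written concatenation monoid.\<close>

datatype gen_word = Gen_Word "lv_gen list"

instantiation gen_word :: monoid_add
begin

definition "0 = Gen_Word []"

fun plus_gen_word :: "gen_word \<Rightarrow> gen_word \<Rightarrow> gen_word" where
  "Gen_Word v + Gen_Word w = Gen_Word (v @ w)"

instance
proof
  fix a b c :: gen_word
  show "a + b + c = a + (b + c)" by (cases a; cases b; cases c) simp
  show "0 + a = a" by (cases a) (simp add: zero_gen_word_def)
  show "a + 0 = a" by (cases a) (simp add: zero_gen_word_def)
qed

end

type_synonym tensor_alg = "gen_word \<Rightarrow>\<^sub>0 complex"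

definition lv_letter :: "loop_vir \<Rightarrow> tensor_alg" where
  "lv_letter x =
     (\<Sum>a\<in>Poly_Mapping.keys x. Poly_Mapping.single (Gen_Word [a]) (Poly_Mapping.lookup x a))"

text \<open>The two-sided ideal generated by all \<open>x y - y x - [x, y]\<close>.\<close>

inductive_set uea_ideal :: "tensor_alg set" where
  zero: "0 \<in> uea_ideal"
| step: "p \<in> uea_ideal \<Longrightarrow>
    p + u * (lv_letter x * lv_letter y - lv_letter y * lv_letter x - lv_letter (lv_bracket x y)) * v
      \<in> uea_ideal"

lemma uea_ideal_add: "p \<in> uea_ideal \<Longrightarrow> q \<in> uea_ideal \<Longrightarrow> p + q \<in> uea_ideal"
proof (induction p rule: uea_ideal.induct)
  case zero
  then show ?case by simp
next
  case (step p u x y v)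
  then show ?case
    using uea_ideal.step[of "p + q" u x y v] by (simp only: add.assoc add.commute[of _ q])
qed

lemma uea_ideal_mult_left: "p \<in> uea_ideal \<Longrightarrow> w * p \<in> uea_ideal"
proof (induction p rule: uea_ideal.induct)
  case zero
  then show ?case by (simp add: uea_ideal.zero)
next
  case (step p u x y v)
  then show ?case
    using uea_ideal.step[of "w * p" "w * u" x y v]
    by (simp only: distrib_left mult.assoc)
qed

lemma uea_ideal_mult_right: "p \<in> uea_ideal \<Longrightarrow> p * w \<in> uea_ideal"
proof (induction p rule: uea_ideal.induct)
  case zero
  then show ?case by (simp add: uea_ideal.zero)
next
  case (step p u x y v)
  then show ?case
    using uea_ideal.step[of "p * w" u x y "v * w"]
    by (simp only: distrib_right mult.assoc)
qed

lemma uea_ideal_uminus: "p \<in> uea_ideal \<Longrightarrow> - p \<in> uea_ideal"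
  using uea_ideal_mult_left[of p "- 1"] by simp

lemma uea_ideal_diff: "p \<in> uea_ideal \<Longrightarrow> q \<in> uea_ideal \<Longrightarrow> p - q \<in> uea_ideal"
  using uea_ideal_add[of p "- q"] uea_ideal_uminus[of q] by simp

lemma gen_word_add_eq_0: "a + b = (0 :: gen_word) \<longleftrightarrow> a = 0 \<and> b = 0"
  by (cases a; cases b) (simp add: zero_gen_word_def)

lemma zero_notin_keys_mult:
  fixes p q :: tensor_alg
  assumes "0 \<notin> Poly_Mapping.keys p \<or> 0 \<notin> Poly_Mapping.keys q"
  shows "0 \<notin> Poly_Mapping.keys (p * q)"
proof
  assume "0 \<in> Poly_Mapping.keys (p * q)"
  then obtain a b where "a \<in> Poly_Mapping.keys p" "b \<in> Poly_Mapping.keys q" "a + b = 0"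
    using keys_mult[of p q] by force
  then show False using assms by (simp add: gen_word_add_eq_0)
qed

lemma zero_notin_keys_lv_letter: "0 \<notin> Poly_Mapping.keys (lv_letter x)"
  by (auto simp: lv_letter_def in_keys_iff lookup_sum lookup_single zero_gen_word_def when_def)

lemma one_notin_uea_ideal: "1 \<notin> uea_ideal"
proof -
  have "0 \<notin> Poly_Mapping.keys p" if "p \<in> uea_ideal" for p
    using that
  proof (induction p rule: uea_ideal.induct)
    case zero
    then show ?case by simp
  next
    case (step p u x y v)
    have "0 \<notin> Poly_Mapping.keys
        (lv_letter x * lv_letter y - lv_letter y * lv_letter x - lv_letter (lv_bracket x y))"
      using zero_notin_keys_mult[of "lv_letter x" "lv_letter y"]
        zero_notin_keys_mult[of "lv_letter y" "lv_letter x"] zero_notin_keys_lv_letter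
      by (simp add: in_keys_iff lookup_minus)
    then have "0 \<notin> Poly_Mapping.keys
        (u * (lv_letter x * lv_letter y - lv_letter y * lv_letter x - lv_letter (lv_bracket x y)) * v)"
      using zero_notin_keys_mult[OF disjI2] zero_notin_keys_mult[OF disjI1] by simp
    with step.IH show ?case by (simp add: in_keys_iff lookup_add)
  qed
  moreover have "0 \<in> Poly_Mapping.keys (1 :: tensor_alg)"
    by (simp add: in_keys_iff lookup_one)
  ultimately show ?thesis by blast
qed

quotient_type uea = tensor_alg / "\<lambda>p q. p - q \<in> uea_ideal"
proof (rule equivpI)
  show "reflp (\<lambda>p q. p - q \<in> uea_ideal)"
    by (rule reflpI) (simp add: uea_ideal.zero)
  show "symp (\<lambda>p q. p - q \<in> uea_ideal)"
    by (rule sympI, drule uea_ideal_uminus) simp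
  show "transp (\<lambda>p q. p - q \<in> uea_ideal)"
    by (rule transpI, drule (1) uea_ideal_add) simp
qed

instantiation uea :: ring_1
begin

lift_definition zero_uea :: uea is 0 .
lift_definition one_uea :: uea is 1 .
lift_definition plus_uea :: "uea \<Rightarrow> uea \<Rightarrow> uea" is "(+)"
  by (drule (1) uea_ideal_add) (simp only: add_diff_add)
lift_definition uminus_uea :: "uea \<Rightarrow> uea" is uminus
  by (drule uea_ideal_uminus) simp
lift_definition minus_uea :: "uea \<Rightarrow> uea \<Rightarrow> uea" is "(-)"
proof -
  fix p p' q q' :: tensor_alg
  assume "p - p' \<in> uea_ideal" "q - q' \<in> uea_ideal"
  then have "(p - p') - (q - q') \<in> uea_ideal" by (rule uea_ideal_diff)
  then show "p - q - (p' - q') \<in> uea_ideal" by (simp add: algebra_simps)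
qed
lift_definition times_uea :: "uea \<Rightarrow> uea \<Rightarrow> uea" is "(*)"
proof -
  fix p p' q q' :: tensor_alg
  assume "p - p' \<in> uea_ideal" "q - q' \<in> uea_ideal"
  then have "(p - p') * q + p' * (q - q') \<in> uea_ideal"
    by (intro uea_ideal_add uea_ideal_mult_left uea_ideal_mult_right)
  then show "p * q - p' * q' \<in> uea_ideal" by (simp add: algebra_simps)
qed

instance
proof
  fix a b c :: uea
  show "a + b + c = a + (b + c)" by transfer (simp add: add.assoc uea_ideal.zero)
  show "a + b = b + a" by transfer (simp add: add.commute uea_ideal.zero)
  show "0 + a = a" by transfer (simp add: uea_ideal.zero)
  show "- a + a = 0" by transfer (simp add: uea_ideal.zero)
  show "a - b = a + - b" by transfer (simp add: uea_ideal.zero)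
  show "a * b * c = a * (b * c)" by transfer (simp add: mult.assoc uea_ideal.zero)
  show "(a + b) * c = a * c + b * c" by transfer (simp add: distrib_right uea_ideal.zero)
  show "a * (b + c) = a * b + a * c" by transfer (simp add: distrib_left uea_ideal.zero)
  show "1 * a = a" by transfer (simp add: uea_ideal.zero)
  show "a * 1 = a" by transfer (simp add: uea_ideal.zero)
  show "(0 :: uea) \<noteq> 1"
    by transfer (use one_notin_uea_ideal uea_ideal_uminus[of "- 1"] in auto)
qed

end

text \<open>The scalar action of \<open>c\<close> is multiplication by \<open>c 1\<close>.\<close>

lift_definition uea_scale :: "complex \<Rightarrow> uea \<Rightarrow> uea" is
  "\<lambda>c p. Poly_Mapping.single 0 c * p"
  by (drule uea_ideal_mult_left) (simp only: right_diff_distrib)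

lift_definition uea_of :: "loop_vir \<Rightarrow> uea" is lv_letter .


section \<open>Modules over the loop-Virasoro algebra\<close>

text \<open>A module is a vector space over the complex numbers (in the sense of HOL-Algebra) with an
  action of the algebra. The record fields \<^const>\<open>mult\<close> and \<^const>\<open>one\<close>, which records of modules
  inherit from those of rings, play no role.\<close>

abbreviation complex_field :: "complex ring" where
  "complex_field \<equiv> class_ring"

record 'v lv_module = "(complex, 'v) module" +
  act :: "loop_vir \<Rightarrow> 'v \<Rightarrow> 'v"

definition lv_submodule :: "'v lv_module \<Rightarrow> 'v set \<Rightarrow> bool" where
  "lv_submodule M N \<longleftrightarrow> subspace complex_field N M \<and> (\<forall>x. \<forall>v\<in>N. act M x v \<in> N)"

definition lv_quotient :: "'v lv_module \<Rightarrow> 'v set \<Rightarrow> 'v set lv_module" where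
  "lv_quotient M N =
     \<lparr>carrier = a_rcosets\<^bsub>M\<^esub> N, mult = undefined, one = undefined,
      zero = N, add = set_add M,
      smult = (\<lambda>c A. \<Union>v\<in>A. N +>\<^bsub>M\<^esub> (c \<odot>\<^bsub>M\<^esub> v)),
      act = (\<lambda>x A. \<Union>v\<in>A. N +>\<^bsub>M\<^esub> act M x v)\<rparr>"

definition lv_isomorphic :: "'v lv_module \<Rightarrow> 'w lv_module \<Rightarrow> bool" where
  "lv_isomorphic M N \<longleftrightarrow>
     (\<exists>f. f \<in> LinearCombinations.module_hom complex_field M N \<and> bij_betw f (carrier M) (carrier N) \<and>
        (\<forall>x. \<forall>v\<in>carrier M. f (act M x v) = act N x (f v)))"

definition weight_space :: "'v lv_module \<Rightarrow> complex \<Rightarrow> 'v set" where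
  "weight_space M \<mu> = {v \<in> carrier M. act M lv_d0 v = \<mu> \<odot>\<^bsub>M\<^esub> v}"

definition finite_dim_weight_spaces :: "'v lv_module \<Rightarrow> bool" where
  "finite_dim_weight_spaces M \<longleftrightarrow>
     (\<forall>\<mu>. vectorspace.fin_dim complex_field (M\<lparr>carrier := weight_space M \<mu>\<rparr>))"


section \<open>Irreducible highest weight modules\<close>

definition uea_module :: "uea lv_module" where
  "uea_module =
     \<lparr>carrier = UNIV, mult = (*), one = 1, zero = 0, add = (+), smult = uea_scale,
      act = (\<lambda>x u. uea_of x * u)\<rparr>"

text \<open>As a vector space, the tensor product of the enveloping algebra with the line spanned by \<open>v\<^sub>0\<close>
  is the enveloping algebra itself, \<open>u\<close> standing for \<open>u \<otimes> v\<^sub>0\<close>. The tensor product over the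
  enveloping algebra of the nonnegative part is its quotient by the span of all
  \<open>u b \<otimes> v\<^sub>0 - u \<otimes> b v\<^sub>0\<close>; it suffices to let \<open>b\<close> range over Lie algebra elements of degree
  zero (where \<open>b v\<^sub>0 = \<phi>(b) v\<^sub>0\<close>) and of positive degree (where \<open>b v\<^sub>0 = 0\<close>), as these generate the
  subalgebra.\<close>

inductive_set verma_relations :: "(loop_vir \<Rightarrow> complex) \<Rightarrow> uea set" for \<phi> where
  zero: "0 \<in> verma_relations \<phi>"
| degree_zero: "p \<in> verma_relations \<phi> \<Longrightarrow> x \<in> lv_zero_part \<Longrightarrow>
    p + (u * uea_of x - uea_scale (\<phi> x) u) \<in> verma_relations \<phi>"
| degree_pos: "p \<in> verma_relations \<phi> \<Longrightarrow> x \<in> lv_plus_part \<Longrightarrow>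
    p + u * uea_of x \<in> verma_relations \<phi>"

definition verma_module :: "(loop_vir \<Rightarrow> complex) \<Rightarrow> uea set lv_module" where
  "verma_module \<phi> = lv_quotient uea_module (verma_relations \<phi>)"

definition maximal_proper_submodule :: "'v lv_module \<Rightarrow> 'v set \<Rightarrow> bool" where
  "maximal_proper_submodule M N \<longleftrightarrow>
     lv_submodule M N \<and> N \<noteq> carrier M \<and>
     (\<forall>N'. lv_submodule M N' \<and> N' \<noteq> carrier M \<and> N \<subseteq> N' \<longrightarrow> N' = N)"

definition highest_weight_module :: "(loop_vir \<Rightarrow> complex) \<Rightarrow> uea set set lv_module" where
  "highest_weight_module \<phi> =
     lv_quotient (verma_module \<phi>) (THE N. maximal_proper_submodule (verma_module \<phi>) N)"

definition irreducible_highest_weight_module :: "uea set set lv_module \<Rightarrow> bool" where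
  "irreducible_highest_weight_module M \<longleftrightarrow>
     (\<exists>\<phi>. zero_part_functional \<phi> \<and> M = highest_weight_module \<phi>)"

definition generalized_evaluation_module :: "uea set set lv_module \<Rightarrow> bool" where
  "generalized_evaluation_module M \<longleftrightarrow>
     (\<exists>\<phi>. zero_part_functional \<phi> \<and> M = highest_weight_module \<phi> \<and>
       (\<exists>a n. a \<noteq> 0 \<and>
         (\<forall>k. \<phi> (lv_tensor_poly (Dgen 0) k ([:- a, 1:] ^ n)) = 0 \<and>
              \<phi> (lv_tensor_poly Cgen k ([:- a, 1:] ^ n)) = 0)))"


section \<open>Tensor products of finitely many modules\<close>

text \<open>The tensor product of a list of modules is the free vector space on the lists \<open>vs\<close> of
  carrier elements (standing for \<open>vs ! 0 \<otimes> vs ! 1 \<otimes> \<dots>\<close>) modulo the multilinearity relations.\<close>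

definition pure_tensors :: "'v lv_module list \<Rightarrow> 'v list set" where
  "pure_tensors Ms = {vs. list_all2 (\<lambda>v M. v \<in> carrier M) vs Ms}"

text \<open>An element \<open>x\<close> acts by the Leibniz rule, \<open>vs \<mapsto> \<Sum>\<^sub>i vs[i := x (vs ! i)]\<close>. On the free vector
  space this is not yet a Lie algebra action; it becomes one on the quotient.\<close>

definition free_tensor_module :: "'v lv_module list \<Rightarrow> ('v list \<Rightarrow>\<^sub>0 complex) lv_module" where
  "free_tensor_module Ms =
     \<lparr>carrier = {p. Poly_Mapping.keys p \<subseteq> pure_tensors Ms}, mult = undefined, one = undefined,
      zero = 0, add = (+), smult = cscale,
      act = (\<lambda>x p. \<Sum>vs\<in>Poly_Mapping.keys p. \<Sum>i<length Ms.
        Poly_Mapping.single (vs[i := act (Ms ! i) x (vs ! i)]) (Poly_Mapping.lookup p vs))\<rparr>"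

inductive_set tensor_relations :: "'v lv_module list \<Rightarrow> ('v list \<Rightarrow>\<^sub>0 complex) set" for Ms where
  zero: "0 \<in> tensor_relations Ms"
| additive: "p \<in> tensor_relations Ms \<Longrightarrow> vs \<in> pure_tensors Ms \<Longrightarrow> i < length Ms \<Longrightarrow>
    v \<in> carrier (Ms ! i) \<Longrightarrow> w \<in> carrier (Ms ! i) \<Longrightarrow>
    p + cscale a (Poly_Mapping.single (vs[i := v \<oplus>\<^bsub>Ms ! i\<^esub> w]) 1
      - Poly_Mapping.single (vs[i := v]) 1 - Poly_Mapping.single (vs[i := w]) 1)
      \<in> tensor_relations Ms"
| homogeneous: "p \<in> tensor_relations Ms \<Longrightarrow> vs \<in> pure_tensors Ms \<Longrightarrow> i < length Ms \<Longrightarrow>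
    v \<in> carrier (Ms ! i) \<Longrightarrow>
    p + cscale a (Poly_Mapping.single (vs[i := c \<odot>\<^bsub>Ms ! i\<^esub> v]) 1
      - cscale c (Poly_Mapping.single (vs[i := v]) 1))
      \<in> tensor_relations Ms"

definition tensor_product :: "'v lv_module list \<Rightarrow> ('v list \<Rightarrow>\<^sub>0 complex) set lv_module" where
  "tensor_product Ms = lv_quotient (free_tensor_module Ms) (tensor_relations Ms)"

end

theory Submission
  imports "HOL-Computational_Algebra.Fundamental_Theorem_Algebra" Defs
begin

text \<open>Let \<open>F u\<close> be the coefficient of \<open>v\<^sub>0\<close> in \<open>u v\<^sub>0\<close>, a functional on the enveloping algebra that can be
  computed by commuting nonnegative elements to the right. Then \<open>V(\<phi>)\<close> is the quotient of the
  enveloping algebra by \<open>{u. \<forall>w. F (w u) = 0}\<close>.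

  If the weight spaces of \<open>V(\<phi>)\<close> are finite-dimensional, then the vectors \<open>(d\<^sub>-\<^sub>i \<otimes> t\<^sup>k) v\<^sub>0\<close> are linearly
  dependent; applying \<open>d\<^sub>i \<otimes> t\<^sup>j\<close> for \<open>i = 1, 2\<close> to a relation gives a polynomial \<open>P \<noteq> 0\<close> such that
  \<open>\<phi>\<close> vanishes on \<open>\<L>\<^sub>0 P\<close>. Splitting \<open>P\<close> into powers of linear factors, the idempotents \<open>e i\<close> of the
  Chinese remainder theorem split \<open>\<phi>\<close> into the sum of the \<open>\<phi>\<^sub>i(x) = \<phi>(e i x)\<close>. Since \<open>e i x\<close> acts as \<open>x\<close>
  on \<open>V(\<phi>\<^sub>i)\<close> and as zero on the other factors, the tensor product of the \<open>V(\<phi>\<^sub>i)\<close> is generated by the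
  tensor product of the highest weight vectors, and a tensor is zero as soon as its images under the
  enveloping algebra all have vanishing coefficient at that vector. Hence it is \<open>V(\<phi>)\<close>.\<close>

section \<open>Linear extension\<close>

text \<open>Working with the radical of F instead of a basis of the enveloping algebra avoids the
  PBW theorem. The price is well-definedness: F is a recursive function \<open>vev\<close> on lists
  of Lie algebra elements, and the main point is that it respects the commutation relation in every
  position (\<open>vev_commutator\<close>). That the Verma module is nonzero then follows from F 1 =
  1.

  The maximal submodule is given by a definite description and has to be identified. A proper
  submodule lies in the radical because a product of shifted copies of d_0 extracts from any vector
  its highest weight component, up to a nonzero factor.

  The isomorphism is not built as a map: the free space under the tensor product is not a Lie
  algebra module before passing to the quotient. Elements of the two sides are related if all words
  in the algebra give them equal coefficients at the highest weight vectors.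

  The factors may be infinite-dimensional; finite dual systems show that a tensor with vanishing
  coordinates is a consequence of multilinearity.

  P is arranged to avoid the root 0, as t is invertible, and to have the root 1, so that the list of
  factors is never empty.\<close>

lemma lookup_cscale [simp]: "Poly_Mapping.lookup (cscale c x) a = c * Poly_Mapping.lookup x a"
  unfolding cscale_def by (simp add: map.rep_eq when_def)

lemma keys_cscale: "Poly_Mapping.keys (cscale c x) \<subseteq> Poly_Mapping.keys x"
  by (auto simp: in_keys_iff)

lemma cscale_single [simp]: "cscale c (Poly_Mapping.single a d) = Poly_Mapping.single a (c * d)"
  by (rule poly_mapping_eqI) (simp add: lookup_single when_def)

lemma cscale_eq_mult: "cscale c p = Poly_Mapping.single 0 c * p"
  unfolding cscale_def by (rule mult_map_scale_conv_mult)

interpretation cscale: vector_space cscale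
  by unfold_locales (auto intro!: poly_mapping_eqI simp: lookup_add algebra_simps)

lemma vector_space_complex: "vector_space ((*) :: complex \<Rightarrow> complex \<Rightarrow> complex)"
  by unfold_locales (auto simp: algebra_simps)

lemma poly_mapping_linear_induct [case_names add scale single]:
  fixes x :: "'k \<Rightarrow>\<^sub>0 complex"
  assumes add: "\<And>x y. P x \<Longrightarrow> P y \<Longrightarrow> P (x + y)"
    and scale: "\<And>c x. P x \<Longrightarrow> P (cscale c x)"
    and single: "\<And>a. P (Poly_Mapping.single a 1)"
  shows "P x"
proof -
  \<comment> \<open>The zero vector is 0 times a basis vector, and \<open>undefined\<close> merely
    names one.\<close>
  have zero: "P 0"
    using scale[OF single, of 0 undefined] by simp
  have sum: "P (\<Sum>a\<in>A. cscale (Poly_Mapping.lookup x a) (Poly_Mapping.single a 1))" if "finite A" for A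
    using that by (induction A rule: finite_induct) (auto intro!: zero add scale single simp del: cscale_single)
  have "x = (\<Sum>a\<in>Poly_Mapping.keys x. cscale (Poly_Mapping.lookup x a) (Poly_Mapping.single a 1))"
    by (rule poly_mapping_eqI) (auto simp: lookup_sum lookup_single when_def in_keys_iff)
  then show ?thesis using sum[of "Poly_Mapping.keys x"] by simp
qed

text \<open>The scalar multiplication is a parameter, so that maps into free spaces and functionals
  into the complex numbers are instances of the same construction.\<close>

definition linear_ext :: "(complex \<Rightarrow> 'b \<Rightarrow> 'b) \<Rightarrow> ('k \<Rightarrow> 'b) \<Rightarrow> ('k \<Rightarrow>\<^sub>0 complex) \<Rightarrow> 'b::ab_group_add" where
  "linear_ext s f x = (\<Sum>a\<in>Poly_Mapping.keys x. s (Poly_Mapping.lookup x a) (f a))"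

context
  fixes s :: "complex \<Rightarrow> 'b \<Rightarrow> 'b::ab_group_add"
  assumes s: "vector_space s"
begin

interpretation vector_space s by (rule s)

text \<open>The supports of \<open>x\<close>, \<open>y\<close> and \<open>x + y\<close> differ;
  additivity compares the three sums over one common index set.\<close>

lemma linear_ext_superset:
  "finite A \<Longrightarrow> Poly_Mapping.keys x \<subseteq> A \<Longrightarrow>
    linear_ext s f x = (\<Sum>a\<in>A. s (Poly_Mapping.lookup x a) (f a))"
  unfolding linear_ext_def by (rule sum.mono_neutral_left) (auto simp: in_keys_iff)

lemma linear_ext_add: "linear_ext s f (x + y) = linear_ext s f x + linear_ext s f y"
  using linear_ext_superset[of "Poly_Mapping.keys x \<union> Poly_Mapping.keys y" "x + y"]
    linear_ext_superset[of "Poly_Mapping.keys x \<union> Poly_Mapping.keys y" x]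
    linear_ext_superset[of "Poly_Mapping.keys x \<union> Poly_Mapping.keys y" y]
    Poly_Mapping.keys_add[of x y]
  by (simp add: lookup_add scale_left_distrib sum.distrib)

lemma linear_ext_cscale: "linear_ext s f (cscale c x) = s c (linear_ext s f x)"
  using linear_ext_superset[of "Poly_Mapping.keys x" "cscale c x"] keys_cscale[of c x]
  by (simp add: linear_ext_def scale_sum_right)

lemma linear_ext_single: "linear_ext s f (Poly_Mapping.single a c) = s c (f a)"
  using linear_ext_superset[of "{a}" "Poly_Mapping.single a c"] by simp

lemma linear_ext_zero: "linear_ext s f 0 = 0"
  by (simp add: linear_ext_def)

end

section \<open>The Lie algebra\<close>

lemmas cscale_ext_simps = linear_ext_add[OF cscale.vector_space_axioms]
  linear_ext_cscale[OF cscale.vector_space_axioms] linear_ext_single[OF cscale.vector_space_axioms]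
  linear_ext_zero[OF cscale.vector_space_axioms]

lemma lv_bracket_eq_linear_ext:
  "lv_bracket x y = linear_ext cscale (\<lambda>a. linear_ext cscale (lv_gen_bracket a) y) x"
  by (simp add: lv_bracket_def linear_ext_def cscale.scale_sum_right)

lemma lv_bracket_add_left: "lv_bracket (x + x') y = lv_bracket x y + lv_bracket x' y"
  by (simp add: lv_bracket_eq_linear_ext cscale_ext_simps)

lemma lv_bracket_scale_left: "lv_bracket (cscale c x) y = cscale c (lv_bracket x y)"
  by (simp add: lv_bracket_eq_linear_ext cscale_ext_simps)

lemma lv_bracket_add_right: "lv_bracket x (y + y') = lv_bracket x y + lv_bracket x y'"
  by (simp add: lv_bracket_eq_linear_ext cscale_ext_simps)
    (simp add: linear_ext_def cscale.scale_right_distrib sum.distrib)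

lemma lv_bracket_scale_right: "lv_bracket x (cscale c y) = cscale c (lv_bracket x y)"
  by (simp add: lv_bracket_eq_linear_ext cscale_ext_simps)
    (simp add: linear_ext_def cscale.scale_sum_right cscale.scale_left_commute[of _ c] del: cscale.scale_scale)

lemmas lv_bracket_linear = lv_bracket_add_left lv_bracket_scale_left lv_bracket_add_right
  lv_bracket_scale_right

lemma lv_bracket_zero [simp]: "lv_bracket 0 y = 0" "lv_bracket x 0 = 0"
  using lv_bracket_scale_left[of 0 0 y] lv_bracket_scale_right[of x 0 0] by simp_all

lemma lv_bracket_single:
  "lv_bracket (Poly_Mapping.single a 1) (Poly_Mapping.single b 1) = lv_gen_bracket a b"
  by (simp add: lv_bracket_eq_linear_ext cscale_ext_simps)

lemma lv_bracket_single':
  "lv_bracket (Poly_Mapping.single a c) (Poly_Mapping.single b d) = cscale (c * d) (lv_gen_bracket a b)"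
  by (simp add: lv_bracket_eq_linear_ext cscale_ext_simps)

lemma lv_bracket_Cgen_left [simp]: "lv_bracket (Poly_Mapping.single (Cgen, j) c) x = 0"
proof (induction x rule: poly_mapping_linear_induct)
  case (single a)
  then show ?case by (cases a) (simp add: lv_bracket_single')
qed (simp_all add: lv_bracket_linear)

lemma lv_bracket_Cgen_right [simp]: "lv_bracket x (Poly_Mapping.single (Cgen, j) c) = 0"
proof (induction x rule: poly_mapping_linear_induct)
  case (single a)
  then show ?case by (cases a; cases "fst a") (simp_all add: lv_bracket_single')
qed (simp_all add: lv_bracket_linear)

lemma lv_gen_bracket_anti: "lv_gen_bracket a b = - lv_gen_bracket b a"
proof -
  obtain g j where a: "a = (g, j)" by (cases a)
  obtain h l where b: "b = (h, l)" by (cases b)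
  show ?thesis
  proof (cases g; cases h)
    fix i k assume gh: "g = Dgen i" "h = Dgen k"
    have neg: "- (Poly_Mapping.single p x + Poly_Mapping.single q y)
        = Poly_Mapping.single p (- x) + Poly_Mapping.single q (- y)" for p q :: lv_gen and x y :: complex
      by (simp add: single_uminus)
    \<comment> \<open>The cocycle coefficient i^3 - i is odd in i, which is antisymmetry of the
      central part.\<close>
    have cube: "(- x) ^ 3 = - (x ^ 3)" for x :: complex
      by (simp add: power3_eq_cube)
    show ?thesis
    proof (cases "i + k = 0")
      case True
      then have k: "k = - i" by simp
      have "of_int (i - - i) = - (of_int (- i - i) :: complex)"
        "of_int ((- i) ^ 3 - - i) / 12 = - (of_int (i ^ 3 - i) / 12 :: complex)"
        unfolding minus_divide_left by (simp_all add: cube)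
      then show ?thesis
        unfolding a b gh k by (simp only: lv_gen_bracket.simps right_minus left_minus simp_thms if_True
            neg minus_minus add.commute[of l j])
    next
      case False
      then show ?thesis
        by (simp add: a b gh add.commute single_uminus[symmetric])
    qed
  qed (simp_all add: a b)
qed

lemma lv_bracket_anti: "lv_bracket x y = - lv_bracket y x"
proof (induction x rule: poly_mapping_linear_induct)
  case (single a)
  show ?case
  proof (induction y rule: poly_mapping_linear_induct)
    case (single b)
    show ?case using lv_gen_bracket_anti[of a b] by (simp add: lv_bracket_single)
  qed (simp_all add: lv_bracket_linear cscale.scale_minus_right)
qed (simp_all add: lv_bracket_linear cscale.scale_minus_right)

lemma lv_bracket_Dgen:
  "lv_bracket (Poly_Mapping.single (Dgen i, j) c) (Poly_Mapping.single (Dgen k, l) d) =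
     Poly_Mapping.single (Dgen (i + k), j + l) (c * d * of_int (k - i))
     + Poly_Mapping.single (Cgen, j + l) (if i + k = 0 then c * d * (of_int (i ^ 3 - i) / 12) else 0)"
  by (simp add: lv_bracket_single' cscale.scale_right_distrib)

text \<open>The inner central term dies under the outer bracket, so only two coefficients remain.
  Apart from the denominator 12 both are images of integers, which turns the Jacobi identity into
  integer arithmetic.\<close>

lemma lv_bracket_Dgen3:
  "lv_bracket (Poly_Mapping.single (Dgen i, j) 1)
      (lv_bracket (Poly_Mapping.single (Dgen k, l) 1) (Poly_Mapping.single (Dgen m, n) 1)) =
     Poly_Mapping.single (Dgen (i + k + m), j + l + n) (of_int ((m - k) * (k + m - i)))
     + Poly_Mapping.single (Cgen, j + l + n)
         (of_int (if i + k + m = 0 then (m - k) * (i ^ 3 - i) else 0) / 12)"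
  by (simp add: lv_bracket_Dgen lv_bracket_add_right add.assoc)

lemma lv_bracket_jacobi:
  "lv_bracket x (lv_bracket y z) = lv_bracket (lv_bracket x y) z + lv_bracket y (lv_bracket x z)"
proof (induction x rule: poly_mapping_linear_induct)
  case (single a)
  show ?case
  proof (induction y rule: poly_mapping_linear_induct)
    case (single b)
    show ?case
    proof (induction z rule: poly_mapping_linear_induct)
      case (single c)
      obtain g j h l f n where abc: "a = (g, j)" "b = (h, l)" "c = (f, n)"
        by (metis surj_pair)
      show ?case
      proof (cases g; cases h; cases f)
        fix i k m assume D: "g = Dgen i" "h = Dgen k" "f = Dgen m"
        \<comment> \<open>The 2-cocycle identity of the cubic, valid only on the plane i + k + m =
          0, where the central terms occur.\<close>
        have central: "(m - k) * (i ^ 3 - i) + (k - i) * (m ^ 3 - m) - (m - i) * (k ^ 3 - k) = 0"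
          if "i + k + m = 0"
        proof -
          have m: "m = - i - k" using that by simp
          show ?thesis unfolding m by (simp add: power3_eq_cube algebra_simps)
        qed
        have "(m - k) * (k + m - i) + (k - i) * (i + k - m) - (m - i) * (i + m - k) = 0"
          by (simp add: algebra_simps)
        then have "complex_of_int ((m - k) * (k + m - i) + (k - i) * (i + k - m) - (m - i) * (i + m - k)) = 0"
          by (simp only: of_int_0)
        then have D_part: "complex_of_int ((m - k) * (k + m - i)) + of_int ((k - i) * (i + k - m))
           - of_int ((m - i) * (i + m - k)) = 0"
          by (simp only: of_int_add of_int_diff)
        have C_part: "complex_of_int (if i + k + m = 0 then (m - k) * (i ^ 3 - i) else 0) / 12
            + of_int (if i + k + m = 0 then (k - i) * (m ^ 3 - m) else 0) / 12
            - of_int (if i + k + m = 0 then (m - i) * (k ^ 3 - k) else 0) / 12 = 0"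
          using arg_cong[OF central, of complex_of_int]
          by (simp only: of_int_add of_int_diff of_int_0 split: if_split)
            (simp only: add_divide_distrib[symmetric] diff_divide_distrib[symmetric] of_int_0 div_0, simp)
        let ?x = "Poly_Mapping.single a 1 :: loop_vir" and ?y = "Poly_Mapping.single b 1 :: loop_vir"
          and ?z = "Poly_Mapping.single c 1 :: loop_vir"
        have perm: "m + i + k = i + k + m" "n + j + l = j + l + n" "k + i + m = i + k + m" "l + j + n = j + l + n"
          by simp_all
        have regroup: "(p + q) + (r + s) - (t + u) = (p + r - t) + (q + s - u)" for p q r s t u :: loop_vir
          by simp
        \<comment> \<open>All three brackets are nested to the right here, so that
          \<open>lv_bracket_Dgen3\<close> applies to each; antisymmetry of the second one gives the
          required form.\<close>
        have "lv_bracket ?x (lv_bracket ?y ?z) + lv_bracket ?z (lv_bracket ?x ?y)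
            - lv_bracket ?y (lv_bracket ?x ?z)
          = Poly_Mapping.single (Dgen (i + k + m), j + l + n)
              (complex_of_int ((m - k) * (k + m - i)) + of_int ((k - i) * (i + k - m))
                - of_int ((m - i) * (i + m - k)))
            + Poly_Mapping.single (Cgen, j + l + n)
              (complex_of_int (if i + k + m = 0 then (m - k) * (i ^ 3 - i) else 0) / 12
                + of_int (if i + k + m = 0 then (k - i) * (m ^ 3 - m) else 0) / 12
                - of_int (if i + k + m = 0 then (m - i) * (k ^ 3 - k) else 0) / 12)"
          unfolding abc D lv_bracket_Dgen3 single_add single_diff perm by (rule regroup)
        also have "\<dots> = 0"
          unfolding D_part C_part by simp
        finally show ?thesis
          using lv_bracket_anti[of ?z "lv_bracket ?x ?y"] by (simp add: algebra_simps)
      qed (simp_all add: abc lv_bracket_linear)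
    qed (simp_all add: lv_bracket_linear cscale.scale_right_distrib add_ac)
  qed (simp_all add: lv_bracket_linear cscale.scale_right_distrib add_ac)
qed (simp_all add: lv_bracket_linear cscale.scale_right_distrib add_ac)

section \<open>Degrees and multiplication by polynomials\<close>

definition lv_part :: "int set \<Rightarrow> loop_vir set" where
  "lv_part Q = {x. \<forall>a\<in>Poly_Mapping.keys x. gen_degree a \<in> Q}"

lemma lv_zero_part_eq: "lv_zero_part = lv_part {0}"
  and lv_plus_part_eq: "lv_plus_part = lv_part {0<..}"
  by (auto simp: lv_zero_part_def lv_plus_part_def lv_part_def)

lemma lv_part_mono: "x \<in> lv_part Q \<Longrightarrow> Q \<subseteq> R \<Longrightarrow> x \<in> lv_part R"
  by (auto simp: lv_part_def)

lemma lv_part_zero [simp]: "0 \<in> lv_part Q"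
  by (simp add: lv_part_def)

lemma lv_part_single [simp]: "Poly_Mapping.single a c \<in> lv_part Q \<longleftrightarrow> c = 0 \<or> gen_degree a \<in> Q"
  by (auto simp: lv_part_def)

lemma lv_part_add: "x \<in> lv_part Q \<Longrightarrow> y \<in> lv_part Q \<Longrightarrow> x + y \<in> lv_part Q"
  using Poly_Mapping.keys_add[of x y] by (auto simp: lv_part_def)

lemma lv_part_cscale: "x \<in> lv_part Q \<Longrightarrow> cscale c x \<in> lv_part Q"
  using keys_cscale[of c x] by (auto simp: lv_part_def)

lemma lv_part_sum: "(\<And>a. a \<in> A \<Longrightarrow> f a \<in> lv_part Q) \<Longrightarrow> sum f A \<in> lv_part Q"
  by (induction A rule: infinite_finite_induct) (auto intro: lv_part_add)

lemma lv_gen_bracket_part: "lv_gen_bracket a b \<in> lv_part {gen_degree a + gen_degree b}"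
proof -
  obtain g j h l where ab: "a = (g, j)" "b = (h, l)" by (metis surj_pair)
  show ?thesis
    unfolding ab by (cases g; cases h) (auto intro!: lv_part_add)
qed

lemma lv_bracket_part:
  assumes "x \<in> lv_part Q" "y \<in> lv_part R" "\<And>q r. q \<in> Q \<Longrightarrow> r \<in> R \<Longrightarrow> q + r \<in> T"
  shows "lv_bracket x y \<in> lv_part T"
proof -
  have "lv_gen_bracket a b \<in> lv_part T" if "a \<in> Poly_Mapping.keys x" "b \<in> Poly_Mapping.keys y" for a b
    using assms that by (intro lv_part_mono[OF lv_gen_bracket_part]) (auto simp: lv_part_def)
  then show ?thesis
    unfolding lv_bracket_def by (intro lv_part_sum lv_part_cscale)
qed

definition lv_proj :: "int set \<Rightarrow> loop_vir \<Rightarrow> loop_vir" where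
  "lv_proj Q = linear_ext cscale (\<lambda>a. if gen_degree a \<in> Q then Poly_Mapping.single a 1 else 0)"

lemma lv_proj_add: "lv_proj Q (x + y) = lv_proj Q x + lv_proj Q y"
  and lv_proj_cscale: "lv_proj Q (cscale c x) = cscale c (lv_proj Q x)"
  by (simp_all add: lv_proj_def cscale_ext_simps)

lemma lookup_lv_proj:
  "Poly_Mapping.lookup (lv_proj Q x) a = (if gen_degree a \<in> Q then Poly_Mapping.lookup x a else 0)"
proof (induction x rule: poly_mapping_linear_induct)
  case (single b)
  then show ?case by (auto simp: lv_proj_def cscale_ext_simps lookup_single when_def)
qed (simp_all add: lv_proj_add lv_proj_cscale lookup_add)

lemma lv_proj_in_part: "lv_proj Q x \<in> lv_part Q"
  by (auto simp: lv_part_def in_keys_iff lookup_lv_proj split: if_splits)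

lemma lv_proj_part: "x \<in> lv_part R \<Longrightarrow> R \<subseteq> Q \<Longrightarrow> lv_proj Q x = x"
  by (rule poly_mapping_eqI) (auto simp: lookup_lv_proj lv_part_def in_keys_iff)

lemma lv_proj_eq_0: "x \<in> lv_part R \<Longrightarrow> R \<inter> Q = {} \<Longrightarrow> lv_proj Q x = 0"
  by (rule poly_mapping_eqI) (auto simp: lookup_lv_proj lv_part_def in_keys_iff)

lemma lv_proj_split: "x = lv_proj {..<0} x + lv_proj {0..} x"
  by (rule poly_mapping_eqI) (auto simp: lookup_lv_proj lookup_add)

section \<open>Multiplication by powers of t and by polynomials in t\<close>

definition tmul :: "int \<Rightarrow> loop_vir \<Rightarrow> loop_vir" where
  "tmul j = linear_ext cscale (\<lambda>(g, l). Poly_Mapping.single (g, l + j) 1)"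

lemma tmul_add: "tmul j (x + y) = tmul j x + tmul j y"
  and tmul_cscale: "tmul j (cscale c x) = cscale c (tmul j x)"
  and tmul_single [simp]: "tmul j (Poly_Mapping.single (g, l) c) = Poly_Mapping.single (g, l + j) c"
  and tmul_0 [simp]: "tmul j 0 = 0"
  by (simp_all add: tmul_def cscale_ext_simps)

lemma tmul_sum: "tmul j (sum f A) = (\<Sum>a\<in>A. tmul j (f a))"
  by (induction A rule: infinite_finite_induct) (simp_all add: tmul_add)

lemma tmul_tmul: "tmul j (tmul k x) = tmul (j + k) x"
proof (induction x rule: poly_mapping_linear_induct)
  case (single a)
  then show ?case by (cases a) (simp add: ac_simps)
qed (simp_all add: tmul_add tmul_cscale)

lemma tmul_zero [simp]: "tmul 0 x = x"
proof (induction x rule: poly_mapping_linear_induct)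
  case (single a)
  then show ?case by (cases a) simp
qed (simp_all add: tmul_add tmul_cscale)

lemma lv_proj_tmul: "lv_proj Q (tmul j x) = tmul j (lv_proj Q x)"
proof (induction x rule: poly_mapping_linear_induct)
  case (single a)
  obtain g l where a: "a = (g, l)" by (cases a)
  have "gen_degree (g, l + j) = gen_degree (g, l)" by (cases g) simp_all
  then show ?case by (simp add: a lv_proj_def cscale_ext_simps)
qed (simp_all add: tmul_add tmul_cscale lv_proj_add lv_proj_cscale)

lemma lv_bracket_tmul_right: "lv_bracket x (tmul j y) = tmul j (lv_bracket x y)"
proof (induction x rule: poly_mapping_linear_induct)
  case (single a)
  show ?case
  proof (induction y rule: poly_mapping_linear_induct)
    case (single b)
    obtain g n h l where "a = (g, n)" "b = (h, l)" by (metis surj_pair)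
    then show ?case by (cases g; cases h) (simp_all add: lv_bracket_Dgen tmul_add add.assoc)
  qed (simp_all add: lv_bracket_linear tmul_add tmul_cscale)
qed (simp_all add: lv_bracket_linear tmul_add tmul_cscale)

text \<open>Makes the loop algebra a module over the polynomials in t. The bracket is bilinear for
  it (\<open>lv_bracket_pmul_left\<close>, \<open>lv_bracket_pmul_right\<close>), so the multiples
  of a fixed polynomial form an ideal.\<close>

definition pmul :: "complex poly \<Rightarrow> loop_vir \<Rightarrow> loop_vir" where
  "pmul P x = (\<Sum>i\<le>degree P. cscale (coeff P i) (tmul (int i) x))"

lemma pmul_superset: "degree P \<le> n \<Longrightarrow> pmul P x = (\<Sum>i\<le>n. cscale (coeff P i) (tmul (int i) x))"
  unfolding pmul_def by (rule sum.mono_neutral_left) (auto simp: coeff_eq_0)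

lemma pmul_add_right: "pmul P (x + y) = pmul P x + pmul P y"
  by (simp add: pmul_def tmul_add cscale.scale_right_distrib sum.distrib)

lemma pmul_cscale_right: "pmul P (cscale c x) = cscale c (pmul P x)"
  by (simp add: pmul_def tmul_cscale cscale.scale_sum_right mult.commute)

lemma pmul_0_right [simp]: "pmul P 0 = 0"
  by (simp add: pmul_def)

lemma pmul_sum_right: "pmul P (sum f A) = (\<Sum>a\<in>A. pmul P (f a))"
  by (induction A rule: infinite_finite_induct) (simp_all add: pmul_add_right)

lemma pmul_add_left: "pmul (P + Q) x = pmul P x + pmul Q x"
  using pmul_superset[of P "max (degree P) (degree Q)" x] pmul_superset[of Q "max (degree P) (degree Q)" x]
    pmul_superset[of "P + Q" "max (degree P) (degree Q)" x] degree_add_le_max[of P Q]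
  by (simp add: cscale.scale_left_distrib sum.distrib)

lemma pmul_smult: "pmul (Polynomial.smult c P) x = cscale c (pmul P x)"
  using pmul_superset[of "Polynomial.smult c P" "degree P" x] degree_smult_le[of c P]
  by (simp add: pmul_def cscale.scale_sum_right)

lemma pmul_0_left [simp]: "pmul 0 x = 0"
  by (simp add: pmul_def)

text \<open>Horner's rule, which makes \<open>pmul_mult\<close> an induction over
  coefficients.\<close>

lemma pmul_pCons: "pmul (pCons a P) x = cscale a x + tmul 1 (pmul P x)"
proof -
  have "pmul (pCons a P) x = (\<Sum>i\<le>Suc (degree P). cscale (coeff (pCons a P) i) (tmul (int i) x))"
    by (rule pmul_superset) (simp add: degree_pCons_le)
  also have "\<dots> = cscale a x + tmul 1 (pmul P x)"
    by (simp only: sum.atMost_Suc_shift) (simp add: pmul_def tmul_sum tmul_cscale tmul_tmul add.commute)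
  finally show ?thesis .
qed

lemma pmul_1 [simp]: "pmul 1 x = x"
  by (simp add: pmul_def)

lemma pmul_tmul: "pmul P (tmul j x) = tmul j (pmul P x)"
  by (simp add: pmul_def tmul_sum tmul_cscale tmul_tmul add.commute)

lemma pmul_mult: "pmul (P * Q) x = pmul P (pmul Q x)"
  by (induction P) (simp_all add: pmul_add_left pmul_smult pmul_pCons)

lemma pmul_monom: "pmul (monom 1 n) x = tmul (int n) x"
  by (induction n) (simp_all add: monom_Suc pmul_pCons tmul_tmul monom_0)

lemma pmul_sum_left: "pmul (sum f A) x = (\<Sum>a\<in>A. pmul (f a) x)"
  by (induction A rule: infinite_finite_induct) (simp_all add: pmul_add_left)

lemma lv_proj_sum: "lv_proj Q (sum f A) = (\<Sum>a\<in>A. lv_proj Q (f a))"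
  using lv_proj_cscale[of Q 0 0]
  by (induction A rule: infinite_finite_induct) (simp_all add: lv_proj_add)

lemma lv_proj_pmul: "lv_proj Q (pmul P x) = pmul P (lv_proj Q x)"
  by (simp add: pmul_def lv_proj_sum lv_proj_cscale lv_proj_tmul)

lemma lv_bracket_sum_right: "lv_bracket x (sum f A) = (\<Sum>a\<in>A. lv_bracket x (f a))"
  by (induction A rule: infinite_finite_induct) (simp_all add: lv_bracket_add_right)

lemma lv_bracket_pmul_right: "lv_bracket x (pmul P y) = pmul P (lv_bracket x y)"
  by (simp add: pmul_def lv_bracket_sum_right lv_bracket_scale_right lv_bracket_tmul_right)

lemma lv_bracket_pmul_left: "lv_bracket (pmul P x) y = pmul P (lv_bracket x y)"
  using lv_bracket_pmul_right[of y P x] pmul_cscale_right[of P "- 1" "lv_bracket y x"]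
  by (simp add: lv_bracket_anti[of _ y])

lemma lv_part_pmul: "x \<in> lv_part Q \<Longrightarrow> pmul P x \<in> lv_part Q"
  by (metis lv_proj_in_part lv_proj_part lv_proj_pmul order_refl)

lemma lv_tensor_poly_eq_pmul: "lv_tensor_poly g k P = pmul P (Poly_Mapping.single (g, k) 1)"
  by (simp add: lv_tensor_poly_def pmul_def)

section \<open>Multilinear functions on lists\<close>

text \<open>The Leibniz extension of \<open>A\<close> to tensors, transposed to functionals
  \<open>g\<close> of lists. It serves both for commuting an element through a word and for the
  action on tensor products.\<close>

primrec slot_sum :: "('a list \<Rightarrow> 'b::comm_monoid_add) \<Rightarrow> ('a \<Rightarrow> 'a) \<Rightarrow> 'a list \<Rightarrow> 'b" where
  "slot_sum g A [] = 0"
| "slot_sum g A (x # w) = g (A x # w) + slot_sum (\<lambda>v. g (x # v)) A w"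

lemma slot_sum_eq: "slot_sum g A w = (\<Sum>i<length w. g (w[i := A (w ! i)]))"
  by (induction w arbitrary: g) (simp_all add: sum.lessThan_Suc_shift del: sum.lessThan_Suc)

lemma slot_sum_append:
  "slot_sum g A (us @ z # vs) =
     slot_sum (\<lambda>u. g (u @ z # vs)) A us + g (us @ A z # vs) + slot_sum (\<lambda>v. g (us @ z # v)) A vs"
  by (induction us arbitrary: g) (simp_all add: ac_simps)

lemma slot_sum_cong:
  "(\<And>v. length v = length w \<Longrightarrow> g v = h v) \<Longrightarrow> slot_sum g A w = slot_sum h A w"
  by (simp add: slot_sum_eq)

lemma slot_sum_0: "slot_sum (\<lambda>v. 0) A w = 0"
  by (simp add: slot_sum_eq)

lemma slot_sum_add: "slot_sum (\<lambda>v. g v + h v) A w = slot_sum g A w + slot_sum h A w"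
  by (simp add: slot_sum_eq sum.distrib)

lemma slot_sum_mult: "slot_sum (\<lambda>v. c * g v) A w = c * (slot_sum g A w :: 'b::comm_ring)"
  by (simp add: slot_sum_eq sum_distrib_left)

text \<open>Terms with \<open>A\<close> and \<open>B\<close> in different slots occur on both sides;
  what remains says that the commutator of two Leibniz extensions is the Leibniz extension of the
  commutator. The form without subtraction suits values in a monoid.\<close>

lemma slot_sum_commutator:
  "slot_sum (slot_sum g B) A w + slot_sum g (\<lambda>x. A (B x)) w
   = slot_sum (slot_sum g A) B w + slot_sum g (\<lambda>x. B (A x)) w"
proof (induction w arbitrary: g)
  case (Cons x w)
  show ?case
    using Cons.IH[of "\<lambda>v. g (x # v)"] by (simp add: slot_sum_add ac_simps)
qed simp

definition multilinear :: "(complex \<Rightarrow> 'a \<Rightarrow> 'a) \<Rightarrow> nat \<Rightarrow> ('a::ab_group_add list \<Rightarrow> complex) \<Rightarrow> bool" where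
  "multilinear s n g \<longleftrightarrow>
     (\<forall>us vs x y c. length us + length vs + 1 = n \<longrightarrow>
        g (us @ (x + y) # vs) = g (us @ x # vs) + g (us @ y # vs) \<and>
        g (us @ s c x # vs) = c * g (us @ x # vs))"

lemma multilinear_add:
  assumes "multilinear s n g" "i < n" "length w = n"
  shows "g (w[i := x + y]) = g (w[i := x]) + g (w[i := y])"
  using assms(1)[unfolded multilinear_def, rule_format, of "take i w" "drop (Suc i) w"] assms(2,3)
  by (simp add: upd_conv_take_nth_drop)

lemma multilinear_scale:
  assumes "multilinear s n g" "i < n" "length w = n"
  shows "g (w[i := s c x]) = c * g (w[i := x])"
  using assms(1)[unfolded multilinear_def, rule_format, of "take i w" "drop (Suc i) w"] assms(2,3)
  by (simp add: upd_conv_take_nth_drop)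

lemma multilinearI:
  assumes "\<And>w i x y. i < n \<Longrightarrow> length w = n \<Longrightarrow> g (w[i := x + y]) = g (w[i := x]) + g (w[i := y])"
    and "\<And>w i c x. i < n \<Longrightarrow> length w = n \<Longrightarrow> g (w[i := s c x]) = c * g (w[i := x])"
  shows "multilinear s n g"
  unfolding multilinear_def
proof (intro allI impI)
  fix us vs :: "'a list" and x y c
  assume "length us + length vs + 1 = n"
  then show "g (us @ (x + y) # vs) = g (us @ x # vs) + g (us @ y # vs) \<and>
      g (us @ s c x # vs) = c * g (us @ x # vs)"
    using assms(1)[of "length us" "us @ x # vs" x y] assms(2)[of "length us" "us @ x # vs" c x]
    by simp
qed

lemma slot_sum_add_map:
  "multilinear s (length w) g \<Longrightarrow> slot_sum g (\<lambda>z. A z + B z) w = slot_sum g A w + slot_sum g B w"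
  by (simp add: slot_sum_eq multilinear_add sum.distrib)

lemma slot_sum_scale_map:
  "multilinear s (length w) g \<Longrightarrow> slot_sum g (\<lambda>z. s c (A z)) w = c * slot_sum g A w"
  by (simp add: slot_sum_eq multilinear_scale sum_distrib_left)


section \<open>The vacuum expectation functional\<close>

text \<open>In degree zero both structure constants, k - i and i^3 - i, vanish.\<close>

lemma lv_zero_part_abelian:
  assumes "x \<in> lv_part {0}" "y \<in> lv_part {0}"
  shows "lv_bracket x y = 0"
proof -
  have "lv_gen_bracket a b = 0" if "gen_degree a = 0" "gen_degree b = 0" for a b
    using that by (cases "(a, b)" rule: lv_gen_bracket.cases) auto
  with assms show ?thesis
    by (auto simp: lv_bracket_def lv_part_def intro!: sum.neutral)
qed

text \<open>The weight is a functional on the whole algebra, extended by zero outside degree zero,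
  so that linearity carries no membership conditions.\<close>

locale highest_weight =
  fixes wt :: "loop_vir \<Rightarrow> complex"
  assumes wt_add: "wt (x + y) = wt x + wt y"
    and wt_cscale: "wt (cscale c x) = c * wt x"
    and wt_nonzero_degree: "x \<in> lv_part (- {0}) \<Longrightarrow> wt x = 0"
begin

lemma wt_0: "wt 0 = 0"
  using wt_cscale[of 0 0] by simp

text \<open>This is why the nonnegative part acts on a line through the weight: brackets within
  degree zero vanish, and all others here have positive degree.\<close>

lemma wt_bracket:
  assumes "x \<in> lv_part {0..}" "y \<in> lv_part {0..}"
  shows "wt (lv_bracket x y) = 0"
proof -
  have split: "z = lv_proj {0} z + lv_proj {0<..} z" if "z \<in> lv_part {0..}" for z
    using that by (intro poly_mapping_eqI) (force simp: lookup_lv_proj lookup_add lv_part_def in_keys_iff)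
  have "lv_bracket x y = lv_bracket (lv_proj {0} x) (lv_proj {0} y) + lv_bracket (lv_proj {0} x) (lv_proj {0<..} y)
      + lv_bracket (lv_proj {0<..} x) y"
    by (metis split assms lv_bracket_add_left lv_bracket_add_right)
  also have "lv_bracket (lv_proj {0} x) (lv_proj {0} y) = 0"
    by (intro lv_zero_part_abelian lv_proj_in_part)
  finally show ?thesis
    using assms lv_bracket_part[OF lv_proj_in_part[of "{0}" x] lv_proj_in_part[of "{0<..}" y], of "- {0}"]
      lv_bracket_part[OF lv_proj_in_part[of "{0<..}" x] assms(2), of "- {0}"]
    by (simp add: wt_add wt_nonzero_degree)
qed

text \<open>The value on \<open>x\<^sub>1 \<dots> x\<^sub>n\<close> is the coefficient of the highest weight vector \<open>v\<^sub>0\<close> in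
  \<open>x\<^sub>1 \<dots> x\<^sub>n v\<^sub>0\<close>: the negative part of \<open>x\<^sub>1\<close> does not contribute, and its nonnegative part is commuted to
  the right until it meets \<open>v\<^sub>0\<close>.\<close>

fun vev :: "loop_vir list \<Rightarrow> complex" where
  "vev [] = 1"
| "vev (x # w) = (\<Sum>i<length w. vev (w[i := lv_bracket (lv_proj {0..} x) (w ! i)])) + wt x * vev w"

declare vev.simps(2) [simp del]

lemma vev_Cons: "vev (x # w) = slot_sum vev (lv_bracket (lv_proj {0..} x)) w + wt x * vev w"
  by (simp add: slot_sum_eq vev.simps(2))

text \<open>Linearity in the head already requires linearity in the later slots, into which the head
  is bracketed. Hence the induction on the total length, for all slots at once.\<close>

lemma vev_multilinear_append:
  "length us + length vs + 1 = n \<Longrightarrow> 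
   vev (us @ (x + y) # vs) = vev (us @ x # vs) + vev (us @ y # vs) \<and>
   vev (us @ cscale c x # vs) = c * vev (us @ x # vs)"
proof (induction n arbitrary: us vs x y c rule: less_induct)
  case (less n)
  show ?case
  proof (cases us)
    case Nil
    have ml: "multilinear cscale (length vs) vev"
      unfolding multilinear_def
    proof (intro allI impI)
      fix p q :: "loop_vir list" and a b c
      assume "length p + length q + 1 = length vs"
      then show "vev (p @ (a + b) # q) = vev (p @ a # q) + vev (p @ b # q) \<and>
          vev (p @ cscale c a # q) = c * vev (p @ a # q)"
        using less.prems Nil by (intro less.IH[of "length vs"]) auto
    qed
    have "slot_sum vev (\<lambda>z. lv_bracket (lv_proj {0..} (x + y)) z) vs
        = slot_sum vev (lv_bracket (lv_proj {0..} x)) vs + slot_sum vev (lv_bracket (lv_proj {0..} y)) vs"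
      unfolding lv_proj_add lv_bracket_add_left by (rule slot_sum_add_map[OF ml])
    moreover have "slot_sum vev (\<lambda>z. lv_bracket (lv_proj {0..} (cscale c x)) z) vs
        = c * slot_sum vev (lv_bracket (lv_proj {0..} x)) vs"
      unfolding lv_proj_cscale lv_bracket_scale_left by (rule slot_sum_scale_map[OF ml])
    ultimately show ?thesis
      by (simp add: Nil vev_Cons wt_add wt_cscale algebra_simps)
  next
    case (Cons u us')
    have IH: "vev (p @ (a + b) # q) = vev (p @ a # q) + vev (p @ b # q)"
        "vev (p @ cscale c a # q) = c * vev (p @ a # q)"
      if "length p = length us'" "length q = length vs" for p q a b c
      using less.IH[of "n - 1" p q a b c] that less.prems Cons by auto
    let ?A = "lv_bracket (lv_proj {0..} u)"
    have "slot_sum (\<lambda>p. vev (p @ (x + y) # vs)) ?A us'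
        = slot_sum (\<lambda>p. vev (p @ x # vs) + vev (p @ y # vs)) ?A us'"
      "slot_sum (\<lambda>p. vev (p @ cscale c x # vs)) ?A us' = slot_sum (\<lambda>p. c * vev (p @ x # vs)) ?A us'"
      "slot_sum (\<lambda>q. vev (us' @ (x + y) # q)) ?A vs
        = slot_sum (\<lambda>q. vev (us' @ x # q) + vev (us' @ y # q)) ?A vs"
      "slot_sum (\<lambda>q. vev (us' @ cscale c x # q)) ?A vs = slot_sum (\<lambda>q. c * vev (us' @ x # q)) ?A vs"
      by (rule slot_sum_cong, rule IH, simp_all)+
    then show ?thesis
      by (simp add: Cons vev_Cons slot_sum_append slot_sum_add slot_sum_mult lv_bracket_linear IH algebra_simps)
  qed
qed

lemma vev_multilinear: "multilinear cscale n vev"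
  unfolding multilinear_def using vev_multilinear_append by blast

lemma vev_add: "vev (us @ (x + y) # vs) = vev (us @ x # vs) + vev (us @ y # vs)"
  and vev_cscale: "vev (us @ cscale c x # vs) = c * vev (us @ x # vs)"
  using vev_multilinear_append[of us vs] by blast+

lemma vev_uminus: "vev (us @ (- x) # vs) = - vev (us @ x # vs)"
  using vev_cscale[of us "- 1" x vs] by simp

lemma vev_zero: "vev (us @ 0 # vs) = 0"
  using vev_cscale[of us 0 0 vs] by simp

lemma vev_negative:
  assumes "x \<in> lv_part {..<0}"
  shows "vev (x # w) = 0"
proof -
  have "wt x = 0" using assms by (auto intro!: wt_nonzero_degree intro: lv_part_mono)
  moreover have "lv_proj {0..} x = 0" using assms by (rule lv_proj_eq_0) auto
  moreover have "slot_sum vev (lv_bracket 0) w = 0"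
    unfolding slot_sum_eq by (intro sum.neutral) (auto simp: upd_conv_take_nth_drop vev_zero)
  ultimately show ?thesis by (simp add: vev_Cons)
qed

lemma vev_nonneg: "x \<in> lv_part {0..} \<Longrightarrow> vev (x # w) = slot_sum vev (lv_bracket x) w + wt x * vev w"
  by (simp add: vev_Cons lv_proj_part)

text \<open>Commuting the head past the last slot leaves there a bracket of two nonnegative
  elements, and its weight is zero by \<open>wt_bracket\<close>. So the last entry meets the highest
  weight vector unchanged.\<close>

lemma vev_snoc_nonneg:
  assumes "x \<in> lv_part {0..}"
  shows "vev (us @ [x]) = wt x * vev us"
  using assms
proof (induction "length us" arbitrary: us x rule: less_induct)
  case less
  show ?case
  proof (cases us)
    case Nil
    then show ?thesis by (simp add: vev_Cons)
  next
    case (Cons u us')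
    let ?u = "lv_proj {0..} u"
    have IH: "vev (p @ [y]) = wt y * vev p" if "length p = length us'" "y \<in> lv_part {0..}" for p y
      using less that by (simp add: Cons)
    have "lv_bracket ?u x \<in> lv_part {0..}"
      by (rule lv_bracket_part[OF lv_proj_in_part less.prems]) auto
    then have "vev (us' @ [lv_bracket ?u x]) = 0"
      by (simp add: IH wt_bracket lv_proj_in_part less.prems)
    moreover have "slot_sum (\<lambda>p. vev (p @ [x])) (lv_bracket ?u) us' = wt x * slot_sum vev (lv_bracket ?u) us'"
      unfolding slot_sum_mult[symmetric] by (rule slot_sum_cong) (simp add: IH less.prems)
    ultimately show ?thesis
      by (simp add: Cons vev_Cons slot_sum_append IH less.prems algebra_simps)
  qed
qed

end

section \<open>Behaviour of the expectation functional under commutators, degrees and polynomial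
  ideals\<close>

context highest_weight
begin

text \<open>By bilinearity each element may be taken negative or nonnegative. As soon as one is
  negative the claim can be read off the recursion; for two nonnegative elements it is the Jacobi
  identity together with \<open>slot_sum_commutator\<close>.\<close>

lemma vev_commutator_Nil:
  "vev (x # y # vs) = vev (y # x # vs) + vev (lv_bracket x y # vs)"
proof -
  have mixed: "vev (a # b # vs) = vev (b # a # vs) + vev (lv_bracket a b # vs)"
    if "a \<in> lv_part {0..}" "b \<in> lv_part {..<0}" for a b
    using that by (simp add: vev_nonneg vev_negative slot_sum_0)
  have mixed': "vev (b # a # vs) = vev (a # b # vs) + vev (lv_bracket b a # vs)"
    if "a \<in> lv_part {0..}" "b \<in> lv_part {..<0}" for a b
    using mixed[OF that] vev_uminus[of "[]" "lv_bracket a b" vs] by (simp add: lv_bracket_anti[of b a])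
  have negative: "vev (a # b # vs) = vev (b # a # vs) + vev (lv_bracket a b # vs)"
    if "a \<in> lv_part {..<0}" "b \<in> lv_part {..<0}" for a b
    using that lv_bracket_part[OF that, of "{..<0}"] by (simp add: vev_negative)
  have nonneg: "vev (a # b # vs) = vev (b # a # vs) + vev (lv_bracket a b # vs)"
    if a: "a \<in> lv_part {0..}" and b: "b \<in> lv_part {0..}" for a b
  proof -
    let ?A = "lv_bracket a" and ?B = "lv_bracket b" and ?C = "lv_bracket (lv_bracket a b)"
    have ab: "vev (lv_bracket a b # vs) = slot_sum vev ?C vs"
      using lv_bracket_part[OF a b, of "{0..}"] by (simp add: vev_nonneg wt_bracket a b)
    \<comment> \<open>The Jacobi identity: bracketing with [a, b] is the commutator of bracketing
      with a and with b.\<close>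
    have "slot_sum vev (\<lambda>z. ?A (?B z)) vs = slot_sum vev ?C vs + slot_sum vev (\<lambda>z. ?B (?A z)) vs"
      unfolding lv_bracket_jacobi[of a b] by (rule slot_sum_add_map[OF vev_multilinear])
    with slot_sum_commutator[of vev ?B ?A vs]
    have comm: "slot_sum (slot_sum vev ?B) ?A vs + slot_sum vev ?C vs = slot_sum (slot_sum vev ?A) ?B vs"
      by simp
    have "vev (lv_bracket b a # vs) = - vev (lv_bracket a b # vs)"
      using vev_uminus[of "[]" "lv_bracket a b" vs] by (simp add: lv_bracket_anti[of b a])
    with comm[symmetric] show ?thesis
      by (simp add: vev_nonneg[OF a] vev_nonneg[OF b] slot_sum_add slot_sum_mult ab algebra_simps)
  qed
  have add_left: "vev ((a + a') # b # vs) = vev (b # (a + a') # vs) + vev (lv_bracket (a + a') b # vs)"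
    if "vev (a # b # vs) = vev (b # a # vs) + vev (lv_bracket a b # vs)"
      "vev (a' # b # vs) = vev (b # a' # vs) + vev (lv_bracket a' b # vs)" for a a' b
    using that vev_add[of "[]" a a' "b # vs"] vev_add[of "[b]" a a' vs]
      vev_add[of "[]" "lv_bracket a b" "lv_bracket a' b" vs] by (simp add: lv_bracket_add_left)
  have add_right: "vev (b # (a + a') # vs) = vev ((a + a') # b # vs) + vev (lv_bracket b (a + a') # vs)"
    if "vev (b # a # vs) = vev (a # b # vs) + vev (lv_bracket b a # vs)"
      "vev (b # a' # vs) = vev (a' # b # vs) + vev (lv_bracket b a' # vs)" for a a' b
    using that vev_add[of "[]" a a' "b # vs"] vev_add[of "[b]" a a' vs]
      vev_add[of "[]" "lv_bracket b a" "lv_bracket b a'" vs] by (simp add: lv_bracket_add_right)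
  define Q where "Q a b \<longleftrightarrow> vev (a # b # vs) = vev (b # a # vs) + vev (lv_bracket a b # vs)" for a b
  have sign: "Q a b" if "a \<in> lv_part {..<0} \<union> lv_part {0..}" "b \<in> lv_part {..<0} \<union> lv_part {0..}" for a b
    unfolding Q_def using that mixed mixed' negative nonneg by blast
  \<comment> \<open>Only the second argument is split here, the first still has one sign; the next
    step splits the first.\<close>
  have "Q a y" if "a \<in> lv_part {..<0} \<union> lv_part {0..}" for a
    by (subst lv_proj_split[of y], unfold Q_def, rule add_right, fold Q_def)
      (use that lv_proj_in_part[of _ y] in \<open>auto intro!: sign\<close>)
  then have "Q x y"
    by (subst lv_proj_split[of x], unfold Q_def, intro add_left, fold Q_def) (use lv_proj_in_part[of _ x] in auto)
  then show ?thesis by (simp add: Q_def)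
qed

text \<open>The head of the list acts on the rest as a derivation, also of the bracket by the Jacobi
  identity, so the relation passes from shorter lists to longer ones.\<close>

lemma vev_commutator:
  "vev (us @ x # y # vs) = vev (us @ y # x # vs) + vev (us @ lv_bracket x y # vs)"
proof (induction "length us + length vs" arbitrary: us vs x y rule: less_induct)
  case less
  show ?case
  proof (cases us)
    case Nil
    then show ?thesis by (simp only: append_Nil) (rule vev_commutator_Nil)
  next
    case (Cons u us')
    let ?U = "lv_bracket (lv_proj {0..} u)"
    have IH: "vev (p @ a # b # q) = vev (p @ b # a # q) + vev (p @ lv_bracket a b # q)"
      if "length p = length us'" "length q = length vs" for p q a b
      using less[of p q a b] that Cons by simp
    have 1: "slot_sum (\<lambda>p. vev (p @ x # y # vs)) ?U us'
        = slot_sum (\<lambda>p. vev (p @ y # x # vs) + vev (p @ lv_bracket x y # vs)) ?U us'"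
      by (rule slot_sum_cong, rule IH) simp_all
    have 2: "slot_sum (\<lambda>q. vev (us' @ x # y # q)) ?U vs
        = slot_sum (\<lambda>q. vev (us' @ y # x # q) + vev (us' @ lv_bracket x y # q)) ?U vs"
      by (rule slot_sum_cong, rule IH) simp_all
    have 3: "vev (us' @ ?U (lv_bracket x y) # vs)
        = vev (us' @ lv_bracket (?U x) y # vs) + vev (us' @ lv_bracket x (?U y) # vs)"
      by (simp only: lv_bracket_jacobi[of _ x y] vev_add)
    have Cons_eq: "vev (u # us' @ a # b # vs) = slot_sum (\<lambda>p. vev (p @ a # b # vs)) ?U us'
        + vev (us' @ ?U a # b # vs) + vev (us' @ a # ?U b # vs) + slot_sum (\<lambda>q. vev (us' @ a # b # q)) ?U vs
        + wt u * vev (us' @ a # b # vs)" for a b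
      by (simp add: vev_Cons slot_sum_append)
    have "vev (u # us' @ x # y # vs) - vev (u # us' @ y # x # vs)
        = slot_sum (\<lambda>p. vev (p @ lv_bracket x y # vs)) ?U us' + vev (us' @ ?U (lv_bracket x y) # vs)
          + slot_sum (\<lambda>q. vev (us' @ lv_bracket x y # q)) ?U vs + wt u * vev (us' @ lv_bracket x y # vs)"
      unfolding Cons_eq 1 2 3 slot_sum_add IH[OF refl refl, of "?U x" y] IH[OF refl refl, of x "?U y"]
        IH[OF refl refl, of x y]
      by (simp add: distrib_left)
    also have "\<dots> = vev (u # us' @ lv_bracket x y # vs)"
      by (simp add: vev_Cons slot_sum_append)
    finally show ?thesis
      by (simp add: Cons diff_eq_eq add.commute)
  qed
qed

text \<open>Bracketing the head into a later slot keeps the total degree, and dropping the head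
  costs its weight, which is zero unless its degree is.\<close>

lemma vev_degree:
  "list_all2 (\<lambda>d x. x \<in> lv_part {d}) ds w \<Longrightarrow> sum_list ds \<noteq> 0 \<Longrightarrow> vev w = 0"
proof (induction "length w" arbitrary: w ds rule: less_induct)
  case less
  show ?case
  proof (cases w)
    case Nil
    then show ?thesis using less.prems by simp
  next
    case (Cons x w')
    then obtain d ds' where ds: "ds = d # ds'" and x: "x \<in> lv_part {d}"
        and w': "list_all2 (\<lambda>d x. x \<in> lv_part {d}) ds' w'"
      using less.prems by (auto simp: list_all2_Cons2)
    show ?thesis
    proof (cases "d < 0")
      case True
      then have "x \<in> lv_part {..<0}" using x by (auto intro: lv_part_mono)
      then show ?thesis by (simp add: Cons vev_negative)
    next
      case False
      then have nonneg: "x \<in> lv_part {0..}" using x by (auto intro: lv_part_mono)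
      have "vev (w'[i := lv_bracket x (w' ! i)]) = 0" if "i < length w'" for i
      proof (rule less.hyps)
        have len: "length ds' = length w'" using w' by (rule list_all2_lengthD)
        have br: "lv_bracket x (w' ! i) \<in> lv_part {d + ds' ! i}"
          by (rule lv_bracket_part[OF x list_all2_nthD2[OF w' that]]) simp
        then show "list_all2 (\<lambda>d x. x \<in> lv_part {d}) (ds'[i := d + ds' ! i]) (w'[i := lv_bracket x (w' ! i)])"
          using w' by (intro list_all2_update_cong) simp_all
        have "sum_list (ds'[i := d + ds' ! i]) = sum_list ds"
          using that len id_take_nth_drop[of i ds', THEN arg_cong[where f = sum_list]]
          by (simp add: ds upd_conv_take_nth_drop)
        then show "sum_list (ds'[i := d + ds' ! i]) \<noteq> 0" using less.prems by simp
      qed (simp add: Cons)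
      moreover have "wt x * vev w' = 0"
      proof (cases "d = 0")
        case True
        then show ?thesis using less.hyps[of w' ds'] w' less.prems ds Cons by simp
      next
        case False
        then have "x \<in> lv_part (- {0})" using x by (auto intro: lv_part_mono)
        then show ?thesis by (simp add: wt_nonzero_degree)
      qed
      ultimately show ?thesis by (simp add: Cons vev_nonneg[OF nonneg] slot_sum_eq)
    qed
  qed
qed

text \<open>The ideal of all \<open>P x\<close> acts by zero on the irreducible quotient as soon as it does so on
  \<open>v\<^sub>0\<close>.\<close>

lemma vev_pmul:
  assumes "\<And>x. wt (pmul P x) = 0"
  shows "vev (us @ pmul P z # vs) = 0"
proof (induction "length us + length vs" arbitrary: us vs z rule: less_induct)
  case less
  show ?case
  proof (cases us)
    case Nil
    have "vev (vs[i := pmul P (lv_bracket (lv_proj {0..} z) (vs ! i))]) = 0" if "i < length vs" for i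
      using that less[of "take i vs" "drop (Suc i) vs"] by (simp add: upd_conv_take_nth_drop Nil)
    then show ?thesis
      by (simp add: Nil vev_Cons assms lv_proj_pmul lv_bracket_pmul_left slot_sum_eq)
  next
    case (Cons u us')
    have IH: "vev (p @ pmul P a # q) = 0" if "length p = length us'" "length q = length vs" for p q a
      using less[of p q a] that Cons by simp
    have "slot_sum (\<lambda>p. vev (p @ pmul P z # vs)) A us' = 0"
      "slot_sum (\<lambda>q. vev (us' @ pmul P z # q)) A vs = 0" for A
      by (simp_all add: slot_sum_eq IH)
    then show ?thesis
      by (simp add: Cons vev_Cons slot_sum_append lv_bracket_pmul_right IH)
  qed
qed

end

section \<open>The universal enveloping algebra\<close>

lemma uea_ideal_eq: "p = q \<Longrightarrow> p - q \<in> uea_ideal"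
  by (simp add: uea_ideal.zero)

lemma lv_letter_eq: "lv_letter = linear_ext cscale (\<lambda>a. Poly_Mapping.single (Gen_Word [a]) 1)"
  by (rule ext) (simp add: lv_letter_def linear_ext_def)

lemma lv_letter_add: "lv_letter (x + y) = lv_letter x + lv_letter y"
  and lv_letter_cscale: "lv_letter (cscale c x) = cscale c (lv_letter x)"
  and lv_letter_single: "lv_letter (Poly_Mapping.single a 1) = Poly_Mapping.single (Gen_Word [a]) 1"
  by (simp_all add: lv_letter_eq cscale_ext_simps)

lemma cscale_mult_left: "cscale c p * q = cscale c (p * q)"
  for p q :: tensor_alg
  by (simp add: cscale_eq_mult mult.assoc)

lemma single_0_commute: "p * Poly_Mapping.single 0 c = Poly_Mapping.single 0 c * p"
  for p :: tensor_alg
proof (induction p rule: poly_mapping_linear_induct)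
  case (single a)
  then show ?case by (simp add: mult_single)
next
  case (add x y)
  then show ?case by (simp add: distrib_left distrib_right)
next
  case (scale d x)
  then show ?case
    by (simp add: cscale_eq_mult mult.assoc) (simp add: mult_single mult.commute flip: mult.assoc)
qed

lemma cscale_mult_right: "p * cscale c q = cscale c (p * q)"
  for p q :: tensor_alg
  by (simp add: cscale_eq_mult single_0_commute[of p] flip: mult.assoc)

interpretation uea_scale: vector_space uea_scale
proof
  show "uea_scale a (x + y) = uea_scale a x + uea_scale a y" for a x y
    by transfer (rule uea_ideal_eq, simp add: distrib_left)
  show "uea_scale (a + b) x = uea_scale a x + uea_scale b x" for a b x
    by transfer (rule uea_ideal_eq, simp add: single_add distrib_right)
  show "uea_scale a (uea_scale b x) = uea_scale (a * b) x" for a b x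
    by transfer (rule uea_ideal_eq, simp add: mult_single flip: mult.assoc)
  show "uea_scale 1 x = x" for x
    by transfer (rule uea_ideal_eq, simp)
qed

lemma uea_scale_mult_left: "uea_scale c u * v = uea_scale c (u * v)"
  by transfer (rule uea_ideal_eq, simp add: mult.assoc)

lemma uea_scale_mult_right: "u * uea_scale c v = uea_scale c (u * v)"
  by transfer (rule uea_ideal_eq, simp add: single_0_commute flip: mult.assoc)

lemma uea_of_add: "uea_of (x + y) = uea_of x + uea_of y"
  by transfer (rule uea_ideal_eq, simp add: lv_letter_add)

lemma uea_of_cscale: "uea_of (cscale c x) = uea_scale c (uea_of x)"
  by transfer (rule uea_ideal_eq, simp add: lv_letter_cscale cscale_eq_mult)

lemma uea_of_commutator: "uea_of x * uea_of y = uea_of y * uea_of x + uea_of (lv_bracket x y)"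
  by transfer (use uea_ideal.step[OF uea_ideal.zero, of 1 _ _ 1] in \<open>simp add: diff_diff_add\<close>)

definition uea_word :: "loop_vir list \<Rightarrow> uea" where
  "uea_word ws = prod_list (map uea_of ws)"

lemma uea_word_Nil [simp]: "uea_word [] = 1"
  and uea_word_Cons [simp]: "uea_word (x # ws) = uea_of x * uea_word ws"
  and uea_word_append [simp]: "uea_word (ws @ ws') = uea_word ws * uea_word ws'"
  by (simp_all add: uea_word_def)

definition gen_words :: "lv_gen list \<Rightarrow> loop_vir list" where
  "gen_words = map (\<lambda>a. Poly_Mapping.single a 1)"

lemma abs_uea_word: "abs_uea (Poly_Mapping.single (Gen_Word l) 1) = uea_word (gen_words l)"
proof (induction l)
  case Nil
  have "Poly_Mapping.single (Gen_Word []) 1 = (1 :: tensor_alg)"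
    by (simp flip: zero_gen_word_def)
  then show ?case by (simp add: gen_words_def one_uea.abs_eq)
next
  case (Cons a l)
  have "Poly_Mapping.single (Gen_Word (a # l)) 1
      = lv_letter (Poly_Mapping.single a 1) * Poly_Mapping.single (Gen_Word l) 1"
    by (simp add: lv_letter_single mult_single)
  then show ?case
    using Cons by (simp add: gen_words_def uea_of.abs_eq times_uea.abs_eq[symmetric])
qed

text \<open>Words in basis elements are homogeneous, which general words are not; the weight
  arguments in the Verma module depend on this.\<close>

lemma uea_gen_word_induct [case_names add scale word]:
  assumes add: "\<And>u v. P u \<Longrightarrow> P v \<Longrightarrow> P (u + v)"
    and scale: "\<And>c u. P u \<Longrightarrow> P (uea_scale c u)"
    and word: "\<And>l. P (uea_word (gen_words l))"
  shows "P u"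
proof -
  have "P (abs_uea p)" for p
  proof (induction p rule: poly_mapping_linear_induct)
    case (add p q)
    then show ?case using assms(1) by (simp add: plus_uea.abs_eq[symmetric])
  next
    case (scale c p)
    then show ?case using assms(2) by (simp add: cscale_eq_mult uea_scale.abs_eq[symmetric])
  next
    case (single a)
    then show ?case using word by (cases a) (simp add: abs_uea_word)
  qed
  then show ?thesis by (metis Quotient3_abs_rep Quotient3_uea)
qed

lemma uea_word_induct [case_names add scale word]:
  assumes "\<And>u v. P u \<Longrightarrow> P v \<Longrightarrow> P (u + v)"
    and "\<And>c u. P u \<Longrightarrow> P (uea_scale c u)"
    and "\<And>ws. P (uea_word ws)"
  shows "P u"
  using assms by (rule uea_gen_word_induct)

text \<open>Suited to vectors, on which the algebra acts by left multiplication. The mirrored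
  principle below suits functionals, whose arguments are multiplied on the right.\<close>

lemma uea_left_induct [case_names add scale one letter]:
  assumes "\<And>u v. P u \<Longrightarrow> P v \<Longrightarrow> P (u + v)"
    and "\<And>c u. P u \<Longrightarrow> P (uea_scale c u)"
    and "P 1" and "\<And>x u. P u \<Longrightarrow> P (uea_of x * u)"
  shows "P u"
proof (induction u rule: uea_word_induct)
  case (word ws)
  show ?case by (induction ws) (simp_all add: assms(3,4))
qed (use assms in auto)

lemma uea_right_induct [case_names add scale one letter]:
  assumes "\<And>u v. P u \<Longrightarrow> P v \<Longrightarrow> P (u + v)"
    and "\<And>c u. P u \<Longrightarrow> P (uea_scale c u)"
    and "P 1" and "\<And>u x. P u \<Longrightarrow> P (u * uea_of x)"
  shows "P u"
proof (induction u rule: uea_word_induct)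
  case (word ws)
  show ?case by (induction ws rule: rev_induct) (simp_all add: assms(3,4))
qed (use assms in auto)

lemma prod_list_lv_letter:
  "prod_list (map lv_letter (gen_words l)) = Poly_Mapping.single (Gen_Word l) 1"
proof (induction l)
  case Nil
  then show ?case by (simp add: gen_words_def flip: zero_gen_word_def)
next
  case (Cons a l)
  then show ?case by (simp add: gen_words_def lv_letter_single mult_single)
qed

section \<open>Descent of the functional to the enveloping algebra\<close>

context highest_weight
begin

definition tensor_vev :: "tensor_alg \<Rightarrow> complex" where
  "tensor_vev = linear_ext (*) (\<lambda>w. case w of Gen_Word l \<Rightarrow> vev (gen_words l))"

lemma tensor_vev_add: "tensor_vev (p + q) = tensor_vev p + tensor_vev q"
  and tensor_vev_cscale: "tensor_vev (cscale c p) = c * tensor_vev p"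
  and tensor_vev_single: "tensor_vev (Poly_Mapping.single (Gen_Word l) 1) = vev (gen_words l)"
  by (simp_all add: tensor_vev_def linear_ext_add[OF vector_space_complex]
      linear_ext_cscale[OF vector_space_complex] linear_ext_single[OF vector_space_complex])

lemma tensor_vev_0: "tensor_vev 0 = 0"
  using tensor_vev_cscale[of 0 0] by simp

lemma tensor_vev_diff: "tensor_vev (p - q) = tensor_vev p - tensor_vev q"
  using tensor_vev_add[of p "cscale (- 1) q"] tensor_vev_cscale[of "- 1" q] by simp

text \<open>By definition this holds for words in basis elements. The statement is generalised by a
  prefix of such elements, into which the remaining entries move one by one after linear
  expansion.\<close>

lemma tensor_vev_letters: "tensor_vev (prod_list (map lv_letter xs)) = vev xs"
proof -
  have "tensor_vev (prod_list (map lv_letter (gen_words l @ xs))) = vev (gen_words l @ xs)" for l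
  proof (induction xs arbitrary: l)
    case Nil
    then show ?case by (simp add: prod_list_lv_letter tensor_vev_single)
  next
    case (Cons x xs)
    show ?case
    proof (induction x rule: poly_mapping_linear_induct)
      case (add x y)
      then show ?case
        by (simp add: lv_letter_add vev_add tensor_vev_add distrib_left distrib_right)
    next
      case (scale c x)
      then show ?case
        by (simp add: lv_letter_cscale vev_cscale tensor_vev_cscale cscale_mult_left cscale_mult_right)
    next
      case (single a)
      then show ?case using Cons.IH[of "l @ [a]"] by (simp add: gen_words_def mult.assoc)
    qed
  qed
  from this[of "[]"] show ?thesis by (simp add: gen_words_def)
qed

text \<open>Linearity reduces \<open>u\<close> and \<open>v\<close> to single words, and then the
  claim is \<open>vev_commutator\<close>. This is what makes the functional well defined on the
  enveloping algebra.\<close>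

lemma tensor_vev_relation:
  "tensor_vev (u * (lv_letter x * lv_letter y - lv_letter y * lv_letter x - lv_letter (lv_bracket x y)) * v) = 0"
proof (induction u rule: poly_mapping_linear_induct)
  case (single a)
  obtain l where a: "a = Gen_Word l" by (cases a)
  show ?case
  proof (induction v rule: poly_mapping_linear_induct)
    case (single b)
    obtain l' where b: "b = Gen_Word l'" by (cases b)
    show ?case
      using tensor_vev_letters[of "gen_words l @ x # y # gen_words l'"]
        tensor_vev_letters[of "gen_words l @ y # x # gen_words l'"]
        tensor_vev_letters[of "gen_words l @ lv_bracket x y # gen_words l'"]
        vev_commutator[of "gen_words l" x y "gen_words l'"]
      unfolding a b prod_list_lv_letter[symmetric]
      by (simp add: left_diff_distrib right_diff_distrib tensor_vev_diff mult.assoc)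
  qed (simp_all add: distrib_left cscale_mult_right tensor_vev_add tensor_vev_cscale)
qed (simp_all add: distrib_right cscale_mult_left tensor_vev_add tensor_vev_cscale)

lemma tensor_vev_ideal: "p \<in> uea_ideal \<Longrightarrow> tensor_vev p = 0"
  by (induction p rule: uea_ideal.induct) (simp_all add: tensor_vev_0 tensor_vev_add tensor_vev_relation)

lift_definition uea_vev :: "uea \<Rightarrow> complex" is tensor_vev
  using tensor_vev_ideal tensor_vev_diff by fastforce

lemma uea_vev_add: "uea_vev (u + v) = uea_vev u + uea_vev v"
  by transfer (rule tensor_vev_add)

lemma uea_vev_scale: "uea_vev (uea_scale c u) = c * uea_vev u"
  by transfer (simp add: tensor_vev_cscale flip: cscale_eq_mult)

lemma uea_vev_0 [simp]: "uea_vev 0 = 0"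
  using uea_vev_scale[of 0 0] by simp

lemma uea_vev_diff: "uea_vev (u - v) = uea_vev u - uea_vev v"
  using uea_vev_add[of "u - v" v] by simp

lemma uea_vev_word: "uea_vev (uea_word ws) = vev ws"
proof -
  have "uea_word ws = abs_uea (prod_list (map lv_letter ws))"
    by (induction ws) (simp_all add: one_uea.abs_eq times_uea.abs_eq[symmetric] uea_of.abs_eq)
  then show ?thesis by (simp add: uea_vev.abs_eq tensor_vev_letters)
qed

lemma uea_vev_1 [simp]: "uea_vev 1 = 1"
  using uea_vev_word[of "[]"] by simp

lemma uea_vev_nonneg:
  assumes "x \<in> lv_part {0..}"
  shows "uea_vev (u * uea_of x) = wt x * uea_vev u"
proof (induction u rule: uea_word_induct)
  case (word ws)
  then show ?case
    using uea_vev_word[of "ws @ [x]"] by (simp add: uea_vev_word vev_snoc_nonneg[OF assms])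
qed (simp_all add: distrib_right uea_vev_add uea_scale_mult_left uea_vev_scale algebra_simps)

lemma uea_vev_negative:
  assumes "x \<in> lv_part {..<0}"
  shows "uea_vev (uea_of x * u) = 0"
proof (induction u rule: uea_word_induct)
  case (word ws)
  then show ?case
    using uea_vev_word[of "x # ws"] by (simp add: vev_negative[OF assms])
qed (simp_all add: distrib_left uea_vev_add uea_scale_mult_right uea_vev_scale)

lemma uea_vev_pmul:
  assumes "\<And>x. wt (pmul P x) = 0"
  shows "uea_vev (u * uea_of (pmul P x) * v) = 0"
proof (induction u rule: uea_word_induct)
  case (word ws)
  show ?case
  proof (induction v rule: uea_word_induct)
    case (word ws')
    then show ?case
      using uea_vev_word[of "ws @ pmul P x # ws'"] by (simp add: vev_pmul[OF assms] mult.assoc)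
  qed (simp_all add: distrib_left uea_vev_add uea_scale_mult_right uea_vev_scale)
qed (simp_all add: distrib_right uea_vev_add uea_scale_mult_left uea_vev_scale)

text \<open>The annihilator of the highest weight vector of the irreducible quotient.\<close>

definition radical :: "uea set" where
  "radical = {u. \<forall>w. uea_vev (w * u) = 0}"

end

section \<open>Presentations of modules\<close>

definition closed_subspace :: "(complex \<Rightarrow> 'a \<Rightarrow> 'a) \<Rightarrow> 'a::ab_group_add set \<Rightarrow> bool" where
  "closed_subspace s S \<longleftrightarrow> 0 \<in> S \<and> (\<forall>x\<in>S. \<forall>y\<in>S. x + y \<in> S) \<and> (\<forall>c. \<forall>x\<in>S. s c x \<in> S)"

text \<open>A presentation identifies a module with a quotient \<open>S / K\<close> of a space \<open>S\<close> with operators, whose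
  addition is the one of the type. The carrier sets of iterated quotients by \<^const>\<open>lv_quotient\<close> are
  only ever accessed through presentations.\<close>

locale lv_presentation =
  fixes s :: "complex \<Rightarrow> 'a \<Rightarrow> 'a::ab_group_add"
    and ac :: "loop_vir \<Rightarrow> 'a \<Rightarrow> 'a"
    and S K :: "'a set"
    and m :: "'a \<Rightarrow> 'v"
    and M :: "'v lv_module"
  assumes vector_space: "vector_space s"
    and S: "closed_subspace s S" and K: "closed_subspace s K" and K_subset: "K \<subseteq> S"
    and ac_S: "u \<in> S \<Longrightarrow> ac x u \<in> S" and ac_K: "u \<in> K \<Longrightarrow> ac x u \<in> K"
    and ac_add: "u \<in> S \<Longrightarrow> v \<in> S \<Longrightarrow> ac x (u + v) = ac x u + ac x v"
    and carrier: "carrier M = m ` S"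
    and m_eq: "u \<in> S \<Longrightarrow> v \<in> S \<Longrightarrow> m u = m v \<longleftrightarrow> u - v \<in> K"
    and m_add: "u \<in> S \<Longrightarrow> v \<in> S \<Longrightarrow> m (u + v) = m u \<oplus>\<^bsub>M\<^esub> m v"
    and m_zero: "m 0 = \<zero>\<^bsub>M\<^esub>"
    and m_scale: "u \<in> S \<Longrightarrow> m (s c u) = c \<odot>\<^bsub>M\<^esub> m u"
    and m_act: "u \<in> S \<Longrightarrow> m (ac x u) = act M x (m u)"
begin

interpretation vector_space s by (rule vector_space)

lemma S_zero: "0 \<in> S"
  and S_add: "u \<in> S \<Longrightarrow> v \<in> S \<Longrightarrow> u + v \<in> S"
  and S_scale: "u \<in> S \<Longrightarrow> s c u \<in> S"
  using S by (auto simp: closed_subspace_def)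

lemma S_uminus: "u \<in> S \<Longrightarrow> - u \<in> S"
  using S_scale[of u "- 1"] by simp

lemma S_diff: "u \<in> S \<Longrightarrow> v \<in> S \<Longrightarrow> u - v \<in> S"
  using S_add[of u "- v"] S_uminus[of v] by simp

text \<open>Stated for a subspace \<open>T\<close>, as weight spaces are treated in the same way as
  the whole module.\<close>

lemma vectorspace_image:
  assumes T: "closed_subspace s T" "T \<subseteq> S"
  shows "vectorspace complex_field (M\<lparr>carrier := m ` T\<rparr>)"
proof -
  have T_closed: "0 \<in> T" "u \<in> T \<Longrightarrow> v \<in> T \<Longrightarrow> u + v \<in> T" "u \<in> T \<Longrightarrow> s c u \<in> T" for u v c
    using T by (auto simp: closed_subspace_def)
  have S': "u \<in> T \<Longrightarrow> u \<in> S" for u using T by blast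
  have neg: "u \<in> T \<Longrightarrow> - u \<in> T" for u using T_closed(3)[of u "- 1"] by simp
  note hom = m_add[symmetric] m_scale[symmetric] m_zero[symmetric]
  have group: "abelian_group (M\<lparr>carrier := m ` T\<rparr>)"
  proof (rule abelian_groupI)
    fix x assume "x \<in> carrier (M\<lparr>carrier := m ` T\<rparr>)"
    then obtain u where u: "u \<in> T" "x = m u" by auto
    then show "\<exists>y\<in>carrier (M\<lparr>carrier := m ` T\<rparr>). y \<oplus>\<^bsub>M\<lparr>carrier := m ` T\<rparr>\<^esub> x = \<zero>\<^bsub>M\<lparr>carrier := m ` T\<rparr>\<^esub>"
      using neg by (intro bexI[of _ "m (- u)"]) (auto simp: hom S')
  qed (auto simp: hom S' T_closed add_ac)
  have "module complex_field (M\<lparr>carrier := m ` T\<rparr>)"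
  proof (rule moduleI)
    show "cring complex_field" by unfold_locales
  qed (use group in \<open>auto simp: hom S' T_closed scale_left_distrib scale_right_distrib\<close>)
  then show ?thesis
    by (intro vectorspace.intro class_field)
qed

lemma vectorspace: "vectorspace complex_field M"
  using vectorspace_image[OF S] by (simp flip: carrier)

lemma lv_submodule_image:
  assumes T: "closed_subspace s T" "T \<subseteq> S" "\<And>x u. u \<in> T \<Longrightarrow> ac x u \<in> T"
  shows "lv_submodule M (m ` T)"
proof -
  have S': "u \<in> T \<Longrightarrow> u \<in> S" for u using T by blast
  have "submodule complex_field (m ` T) M"
  proof (rule submodule.intro)
    show "module complex_field M" using vectorspace by (simp add: vectorspace_def)
  qed (use T in \<open>auto simp: carrier closed_subspace_def S' m_zero[symmetric] m_add[symmetric] m_scale[symmetric]\<close>)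
  then show ?thesis
    using T vectorspace by (auto simp: lv_submodule_def VectorSpace.subspace_def S' m_act[symmetric])
qed

text \<open>With \<open>lv_submodule_image\<close> this is the correspondence between submodules of
  the quotient and invariant subspaces containing the kernel.\<close>

lemma lv_submodule_preimage:
  assumes N: "lv_submodule M N"
  defines "T \<equiv> {u \<in> S. m u \<in> N}"
  shows "closed_subspace s T" "K \<subseteq> T" "\<And>x u. u \<in> T \<Longrightarrow> ac x u \<in> T" "N = m ` T"
proof -
  have sub: "submodule complex_field N M" and act: "\<And>x v. v \<in> N \<Longrightarrow> act M x v \<in> N"
    using N by (auto simp: lv_submodule_def VectorSpace.subspace_def)
  note N_closed = submodule.m_closed[OF sub] submodule.zero_closed[OF sub] submodule.smult_closed[OF sub]
  show "closed_subspace s T"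
    using N_closed by (auto simp: T_def closed_subspace_def S_zero S_add S_scale m_zero m_add m_scale)
  show "K \<subseteq> T"
  proof
    fix u assume u: "u \<in> K"
    then have "m u = m 0" using K_subset S_zero by (subst m_eq) auto
    then show "u \<in> T" using u K_subset N_closed by (auto simp: T_def m_zero)
  qed
  show "ac x u \<in> T" if "u \<in> T" for x u
    using that act by (auto simp: T_def ac_S m_act)
  show "N = m ` T"
    using submodule.subset[OF sub] by (auto simp: T_def carrier)
qed

text \<open>The third isomorphism theorem: a quotient of a presented module is presented by the same
  space with a larger kernel, so that iterated cosets collapse.\<close>

lemma quotient:
  assumes K': "closed_subspace s K'" "K \<subseteq> K'" "K' \<subseteq> S" "\<And>x u. u \<in> K' \<Longrightarrow> ac x u \<in> K'"
  shows "lv_presentation s ac S K' (\<lambda>u. m ` K' +>\<^bsub>M\<^esub> m u) (lv_quotient M (m ` K'))"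
proof -
  let ?m = "\<lambda>u. m ` K' +>\<^bsub>M\<^esub> m u"
  have K'_closed: "0 \<in> K'" "u \<in> K' \<Longrightarrow> v \<in> K' \<Longrightarrow> u + v \<in> K'" "u \<in> K' \<Longrightarrow> s c u \<in> K'" for u v c
    using K' by (auto simp: closed_subspace_def)
  have K'_diff: "u - v \<in> K'" if "u \<in> K'" "v \<in> K'" for u v
    using K'_closed(2)[of u "s (- 1) v"] K'_closed(3)[of v "- 1"] that by simp
  have S': "u \<in> K' \<Longrightarrow> u \<in> S" for u using K' by blast
  have coset: "?m u = (\<lambda>k. m (k + u)) ` K'" if "u \<in> S" for u
    using that by (auto simp: a_r_coset_def r_coset_def m_add S')
  have eqI: "?m u = ?m v" if "u \<in> S" "v \<in> S" "u - v \<in> K'" for u v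
  proof -
    have sub: "(\<lambda>k. m (k + a)) ` K' \<subseteq> (\<lambda>k. m (k + b)) ` K'" if "a - b \<in> K'" for a b
    proof
      fix x assume "x \<in> (\<lambda>k. m (k + a)) ` K'"
      then obtain k where k: "k \<in> K'" "x = m (k + a)" by auto
      then show "x \<in> (\<lambda>k. m (k + b)) ` K'"
        using that K'_closed(2)[OF k(1) that] by (intro image_eqI[of _ _ "k + (a - b)"]) auto
    qed
    have "v - u \<in> K'" using K'_diff[OF K'_closed(1) that(3)] by simp
    then show ?thesis unfolding coset[OF that(1)] coset[OF that(2)]
      by (intro subset_antisym sub that(3))
  qed
  have eq: "?m u = ?m v \<longleftrightarrow> u - v \<in> K'" if uv: "u \<in> S" "v \<in> S" for u v
  proof
    assume "?m u = ?m v"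
    moreover have "m u \<in> (\<lambda>k. m (k + u)) ` K'"
      using K'_closed(1) by (intro image_eqI[of _ _ 0]) simp_all
    ultimately have "m u \<in> (\<lambda>k. m (k + v)) ` K'" using uv by (simp add: coset)
    then obtain k where k: "k \<in> K'" "m u = m (k + v)" by auto
    then have "u - (k + v) \<in> K'" using uv S' K'(2) by (auto simp: m_eq S_add)
    then show "u - v \<in> K'" using K'_closed(2)[OF k(1)] by (metis add_diff_cancel_left' add_diff_eq diff_diff_add)
  qed (rule eqI[OF uv])
  \<comment> \<open>Operations on cosets are unions over representatives; all members of the union
    coincide when \<open>f\<close> respects the kernel.\<close>
  have union: "(\<Union>w\<in>?m u. m ` K' +>\<^bsub>M\<^esub> h w) = ?m (f u)"
    if u: "u \<in> S" and f: "\<And>v. v \<in> S \<Longrightarrow> f v \<in> S" "\<And>k. k \<in> K' \<Longrightarrow> f (k + u) - f u \<in> K'"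
      and h: "\<And>v. v \<in> S \<Longrightarrow> h (m v) = m (f v)" for h f u
  proof -
    have "m ` K' +>\<^bsub>M\<^esub> h (m (k + u)) = ?m (f u)" if "k \<in> K'" for k
      using that u f(2)[OF that] by (subst h, simp add: S_add S', intro eqI f(1)) (simp_all add: S_add S')
    then show ?thesis using K'_closed(1) unfolding coset[OF u] by auto
  qed
  show ?thesis
  proof (rule lv_presentation.intro)
    show "vector_space s" by (rule vector_space)
    show "closed_subspace s S" by (rule S)
    show "closed_subspace s K'" by (rule K')
    show "K' \<subseteq> S" by (rule K')
    show "carrier (lv_quotient M (m ` K')) = ?m ` S"
      by (auto simp: lv_quotient_def A_RCOSETS_def RCOSETS_def carrier a_r_coset_def)
    show "?m 0 = \<zero>\<^bsub>lv_quotient M (m ` K')\<^esub>"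
      by (simp add: coset S_zero) (simp add: lv_quotient_def)
    fix u assume u: "u \<in> S"
    show "?m (s c u) = c \<odot>\<^bsub>lv_quotient M (m ` K')\<^esub> ?m u" for c
      using u by (simp add: lv_quotient_def, intro union[symmetric])
        (auto simp: S_scale m_scale scale_right_distrib K'_closed)
    show "?m (ac x u) = act (lv_quotient M (m ` K')) x (?m u)" for x
      using u K'(4) by (simp add: lv_quotient_def, intro union[symmetric])
        (auto simp: ac_S m_act ac_add S')
    fix v assume v: "v \<in> S"
    have sum: "m (k + u) \<oplus>\<^bsub>M\<^esub> m (k' + v) = m ((k + k') + (u + v))" if "k \<in> K'" "k' \<in> K'" for k k'
    proof -
      have "(k + u) + (k' + v) = (k + k') + (u + v)" by (simp add: add_ac)
      then show ?thesis using that u v by (metis m_add S_add S')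
    qed
    have "?m u <+>\<^bsub>M\<^esub> ?m v = (\<lambda>k. m (k + (u + v))) ` K'"
    proof (intro equalityI subsetI)
      fix x assume "x \<in> ?m u <+>\<^bsub>M\<^esub> ?m v"
      then obtain k k' where "k \<in> K'" "k' \<in> K'" "x = m (k + u) \<oplus>\<^bsub>M\<^esub> m (k' + v)"
        unfolding coset[OF u] coset[OF v] by (auto simp: set_add_def set_mult_def)
      then show "x \<in> (\<lambda>k. m (k + (u + v))) ` K'"
        using K'_closed(2) by (intro image_eqI[of _ _ "k + k'"]) (simp_all add: sum)
    next
      fix x assume "x \<in> (\<lambda>k. m (k + (u + v))) ` K'"
      then obtain k where "k \<in> K'" "x = m (k + (u + v))" by blast
      then have "x = m (k + u) \<oplus>\<^bsub>M\<^esub> m (0 + v)" "k \<in> K'" using sum[of k 0] K'_closed(1) by simp_all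
      then show "x \<in> ?m u <+>\<^bsub>M\<^esub> ?m v"
        unfolding coset[OF u] coset[OF v] using K'_closed(1)
        by (simp add: set_add_def set_mult_def) (rule bexI[of _ k], rule bexI[of _ 0], simp_all)
    qed
    then have "?m (u + v) = ?m u <+>\<^bsub>M\<^esub> ?m v"
      using u v by (simp add: coset S_add)
    then show "?m (u + v) = ?m u \<oplus>\<^bsub>lv_quotient M (m ` K')\<^esub> ?m v"
      by (simp add: lv_quotient_def)
  qed (use K' ac_S ac_add eq in auto)
qed

end

text \<open>The relation \<open>R\<close> between representatives need not be functional. Linearity
  and agreement of the kernels make it well defined and injective on classes, totality on both sides
  makes it a bijection.\<close>

lemma lv_isomorphicI:
  assumes "lv_presentation s\<^sub>1 ac\<^sub>1 S\<^sub>1 K\<^sub>1 m\<^sub>1 M\<^sub>1" "lv_presentation s\<^sub>2 ac\<^sub>2 S\<^sub>2 K\<^sub>2 m\<^sub>2 M\<^sub>2"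
    and total1: "\<And>u. u \<in> S\<^sub>1 \<Longrightarrow> \<exists>p\<in>S\<^sub>2. R u p" and total2: "\<And>p. p \<in> S\<^sub>2 \<Longrightarrow> \<exists>u\<in>S\<^sub>1. R u p"
    and R_add: "\<And>u p v q. u \<in> S\<^sub>1 \<Longrightarrow> p \<in> S\<^sub>2 \<Longrightarrow> v \<in> S\<^sub>1 \<Longrightarrow> q \<in> S\<^sub>2 \<Longrightarrow> R u p \<Longrightarrow> R v q \<Longrightarrow> R (u + v) (p + q)"
    and R_scale: "\<And>u p c. u \<in> S\<^sub>1 \<Longrightarrow> p \<in> S\<^sub>2 \<Longrightarrow> R u p \<Longrightarrow> R (s\<^sub>1 c u) (s\<^sub>2 c p)"
    and R_act: "\<And>u p x. u \<in> S\<^sub>1 \<Longrightarrow> p \<in> S\<^sub>2 \<Longrightarrow> R u p \<Longrightarrow> R (ac\<^sub>1 x u) (ac\<^sub>2 x p)"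
    and R_kernel: "\<And>u p. u \<in> S\<^sub>1 \<Longrightarrow> p \<in> S\<^sub>2 \<Longrightarrow> R u p \<Longrightarrow> u \<in> K\<^sub>1 \<longleftrightarrow> p \<in> K\<^sub>2"
  shows "lv_isomorphic M\<^sub>1 M\<^sub>2"
proof -
  interpret A: lv_presentation s\<^sub>1 ac\<^sub>1 S\<^sub>1 K\<^sub>1 m\<^sub>1 M\<^sub>1 by (rule assms)
  interpret B: lv_presentation s\<^sub>2 ac\<^sub>2 S\<^sub>2 K\<^sub>2 m\<^sub>2 M\<^sub>2 by (rule assms)
  interpret A: vector_space s\<^sub>1 by (rule A.vector_space)
  interpret B: vector_space s\<^sub>2 by (rule B.vector_space)
  have R_eq: "m\<^sub>1 u = m\<^sub>1 v \<longleftrightarrow> m\<^sub>2 p = m\<^sub>2 q"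
    if "u \<in> S\<^sub>1" "p \<in> S\<^sub>2" "v \<in> S\<^sub>1" "q \<in> S\<^sub>2" "R u p" "R v q" for u v p q
  proof -
    have "R (u + s\<^sub>1 (- 1) v) (p + s\<^sub>2 (- 1) q)"
      using that by (intro R_add R_scale A.S_scale B.S_scale)
    then have "R (u - v) (p - q)"
      by simp
    then show ?thesis
      using that by (simp add: A.m_eq B.m_eq R_kernel A.S_diff B.S_diff)
  qed
  define f where "f a = (SOME b. \<exists>u\<in>S\<^sub>1. \<exists>p\<in>S\<^sub>2. a = m\<^sub>1 u \<and> b = m\<^sub>2 p \<and> R u p)" for a
  have f: "f (m\<^sub>1 u) = m\<^sub>2 p" if up: "u \<in> S\<^sub>1" "p \<in> S\<^sub>2" "R u p" for u p
  proof -
    have "\<exists>b. \<exists>v\<in>S\<^sub>1. \<exists>q\<in>S\<^sub>2. m\<^sub>1 u = m\<^sub>1 v \<and> b = m\<^sub>2 q \<and> R v q" using up by blast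
    then have "\<exists>v\<in>S\<^sub>1. \<exists>q\<in>S\<^sub>2. m\<^sub>1 u = m\<^sub>1 v \<and> f (m\<^sub>1 u) = m\<^sub>2 q \<and> R v q"
      unfolding f_def by (rule someI_ex)
    then show ?thesis using R_eq up by metis
  qed
  have cases1: "\<exists>u p. u \<in> S\<^sub>1 \<and> p \<in> S\<^sub>2 \<and> R u p \<and> a = m\<^sub>1 u \<and> f a = m\<^sub>2 p" if "a \<in> carrier M\<^sub>1" for a
    using that total1 f unfolding A.carrier by blast
  have "f \<in> LinearCombinations.module_hom complex_field M\<^sub>1 M\<^sub>2"
    unfolding LinearCombinations.module_hom_def
  proof (intro CollectI conjI allI impI)
    show "f \<in> carrier M\<^sub>1 \<rightarrow> carrier M\<^sub>2" using cases1 by (fastforce simp: B.carrier)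
    show "f (a \<oplus>\<^bsub>M\<^sub>1\<^esub> b) = f a \<oplus>\<^bsub>M\<^sub>2\<^esub> f b" if "a \<in> carrier M\<^sub>1 \<and> b \<in> carrier M\<^sub>1" for a b
      using cases1[of a] cases1[of b] that
      by (auto simp: A.m_add[symmetric] B.m_add[symmetric] intro!: f A.S_add B.S_add R_add)
    show "f (c \<odot>\<^bsub>M\<^sub>1\<^esub> a) = c \<odot>\<^bsub>M\<^sub>2\<^esub> f a" if "c \<in> carrier complex_field \<and> a \<in> carrier M\<^sub>1" for c a
      using cases1[of a] that
      by (auto simp: A.m_scale[symmetric] B.m_scale[symmetric] intro!: f A.S_scale B.S_scale R_scale)
  qed
  moreover have "bij_betw f (carrier M\<^sub>1) (carrier M\<^sub>2)"
  proof (rule bij_betw_imageI)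
    show "inj_on f (carrier M\<^sub>1)"
      using cases1 R_eq by (intro inj_onI) metis
    show "f ` carrier M\<^sub>1 = carrier M\<^sub>2"
    proof
      show "f ` carrier M\<^sub>1 \<subseteq> carrier M\<^sub>2" using cases1 by (fastforce simp: B.carrier)
      show "carrier M\<^sub>2 \<subseteq> f ` carrier M\<^sub>1"
      proof
        fix b assume "b \<in> carrier M\<^sub>2"
        then obtain p u where "p \<in> S\<^sub>2" "b = m\<^sub>2 p" "u \<in> S\<^sub>1" "R u p"
          unfolding B.carrier using total2 by blast
        then show "b \<in> f ` carrier M\<^sub>1"
          using f by (auto simp: A.carrier intro!: image_eqI[of _ _ "m\<^sub>1 u"])
      qed
    qed
  qed
  moreover have "f (act M\<^sub>1 x a) = act M\<^sub>2 x (f a)" if "a \<in> carrier M\<^sub>1" for x a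
    using cases1[OF that] by (auto simp: A.m_act[symmetric] B.m_act[symmetric] intro!: f A.ac_S B.ac_S R_act)
  ultimately show ?thesis unfolding lv_isomorphic_def by blast
qed

section \<open>Irreducible highest weight modules\<close>

lemma zero_part_functional_highest_weight:
  assumes "zero_part_functional \<phi>"
  shows "highest_weight (\<lambda>x. \<phi> (lv_proj {0} x))"
proof -
  have scale: "\<phi> (cscale c x) = c * \<phi> x" if "x \<in> lv_part {0}" for c x
    using assms that by (simp add: zero_part_functional_def lv_zero_part_eq)
  have "\<phi> 0 = 0" using scale[of 0 0] by simp
  moreover have "lv_proj {0} x = 0" if "x \<in> lv_part (- {0})" for x
    using that by (rule lv_proj_eq_0) auto
  ultimately show ?thesis
    using assms by unfold_locales
      (simp_all add: zero_part_functional_def lv_zero_part_eq lv_proj_add lv_proj_cscale lv_proj_in_part)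
qed

lemma lv_presentation_uea: "lv_presentation uea_scale (\<lambda>x u. uea_of x * u) UNIV {0} (\<lambda>u. u) uea_module"
  by unfold_locales (auto simp: closed_subspace_def uea_module_def distrib_left)

lemma verma_relations_mult_left: "p \<in> verma_relations \<phi> \<Longrightarrow> w * p \<in> verma_relations \<phi>"
proof (induction p rule: verma_relations.induct)
  case zero
  show ?case by (simp add: verma_relations.zero)
next
  case (degree_zero p x u)
  then show ?case using verma_relations.degree_zero[of "w * p" \<phi> x "w * u"]
    by (simp add: distrib_left right_diff_distrib uea_scale_mult_right mult.assoc)
next
  case (degree_pos p x u)
  then show ?case using verma_relations.degree_pos[of "w * p" \<phi> x "w * u"]
    by (simp add: distrib_left mult.assoc)
qed

lemma verma_relations_add: "p \<in> verma_relations \<phi> \<Longrightarrow> q \<in> verma_relations \<phi> \<Longrightarrow> p + q \<in> verma_relations \<phi>"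
proof (induction p rule: verma_relations.induct)
  case zero
  then show ?case by simp
next
  case (degree_zero p x u)
  then show ?case using verma_relations.degree_zero[of "p + q" \<phi> x u] by (simp add: add_ac)
next
  case (degree_pos p x u)
  then show ?case using verma_relations.degree_pos[of "p + q" \<phi> x u] by (simp add: add_ac)
qed

lemma verma_relations_scale: "p \<in> verma_relations \<phi> \<Longrightarrow> uea_scale c p \<in> verma_relations \<phi>"
  using verma_relations_mult_left[of p \<phi> "uea_scale c 1"] by (simp add: uea_scale_mult_left)

lemma closed_verma_relations: "closed_subspace uea_scale (verma_relations \<phi>)"
  by (auto simp: closed_subspace_def verma_relations.zero verma_relations_add verma_relations_scale)

lemma verma_degree_zero: "x \<in> lv_zero_part \<Longrightarrow> u * uea_of x - uea_scale (\<phi> x) u \<in> verma_relations \<phi>"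
  using verma_relations.degree_zero[OF verma_relations.zero] by simp

lemma verma_degree_pos: "x \<in> lv_plus_part \<Longrightarrow> u * uea_of x \<in> verma_relations \<phi>"
  using verma_relations.degree_pos[OF verma_relations.zero] by simp

lemma lv_presentation_verma:
  "lv_presentation uea_scale (\<lambda>x u. uea_of x * u) UNIV (verma_relations \<phi>)
     (\<lambda>u. verma_relations \<phi> +>\<^bsub>uea_module\<^esub> u) (verma_module \<phi>)"
  using lv_presentation.quotient[OF lv_presentation_uea closed_verma_relations[of \<phi>]]
  by (simp add: verma_module_def verma_relations.zero verma_relations_mult_left)

lemma closed_subspace_mult_left:
  assumes T: "closed_subspace uea_scale T" "\<And>x u. u \<in> T \<Longrightarrow> uea_of x * u \<in> T" and u: "u \<in> T"
  shows "w * u \<in> T"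
  by (induction w rule: uea_left_induct)
    (use assms in \<open>auto simp: closed_subspace_def distrib_right uea_scale_mult_left mult.assoc\<close>)

lemma lv_bracket_d0: "x \<in> lv_part {d} \<Longrightarrow> lv_bracket lv_d0 x = cscale (of_int d) x"
proof -
  assume x: "x \<in> lv_part {d}"
  have "lv_gen_bracket (Dgen 0, 0) = (\<lambda>a. cscale (of_int (gen_degree a)) (Poly_Mapping.single a 1))"
    by (rule ext, rename_tac a, case_tac a, case_tac "fst a") auto
  then have eq: "lv_bracket lv_d0 x = linear_ext cscale (\<lambda>a. cscale (of_int (gen_degree a)) (Poly_Mapping.single a 1)) x" for x
    by (simp add: lv_bracket_eq_linear_ext lv_d0_def cscale_ext_simps)
  have "Poly_Mapping.lookup (lv_bracket lv_d0 y) a = of_int (gen_degree a) * Poly_Mapping.lookup y a" for y a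
    unfolding eq
    by (induction y rule: poly_mapping_linear_induct)
      (auto simp: cscale_ext_simps lookup_add lookup_single when_def algebra_simps)
  then show ?thesis
    using x by (intro poly_mapping_eqI) (auto simp: lv_part_def in_keys_iff)
qed

section \<open>The Verma module and its highest weight component\<close>

locale highest_weight_functional =
  fixes \<phi> :: "loop_vir \<Rightarrow> complex"
  assumes functional: "zero_part_functional \<phi>"
begin

sublocale highest_weight "\<lambda>x. \<phi> (lv_proj {0} x)"
  by (rule zero_part_functional_highest_weight[OF functional])

abbreviation rel :: "uea set" where
  "rel \<equiv> verma_relations \<phi>"

lemma uea_vev_relations: "p \<in> rel \<Longrightarrow> uea_vev p = 0"
proof (induction p rule: verma_relations.induct)
  case (degree_zero p x u)
  then have "x \<in> lv_part {0..}" "lv_proj {0} x = x"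
    by (auto simp: lv_zero_part_eq intro: lv_part_mono lv_proj_part)
  then show ?case
    using degree_zero uea_vev_nonneg[of x u] by (simp add: uea_vev_add uea_vev_diff uea_vev_scale)
next
  case (degree_pos p x u)
  then have "x \<in> lv_part {0..}" "x \<in> lv_part (- {0})"
    by (auto simp: lv_plus_part_eq intro: lv_part_mono)
  then show ?case
    using degree_pos uea_vev_nonneg[of x u] wt_nonzero_degree[of x] by (simp add: uea_vev_add)
qed simp

lemma relations_subset_radical: "rel \<subseteq> radical"
  using verma_relations_mult_left uea_vev_relations by (auto simp: radical_def)

lemma closed_radical: "closed_subspace uea_scale radical"
  by (auto simp: closed_subspace_def radical_def distrib_left uea_scale_mult_right uea_vev_add uea_vev_scale)

lemma radical_mult_left: "u \<in> radical \<Longrightarrow> w * u \<in> radical"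
  by (simp add: radical_def flip: mult.assoc)

lemma one_notin_radical: "1 \<notin> radical"
  by (auto simp: radical_def intro!: exI[of _ 1])

text \<open>The Verma module has no weights above the highest one, and the highest weight space is
  spanned by the generating vector. The recursion of \<open>vev\<close> is repeated in the
  enveloping algebra, modulo the Verma relations.\<close>

lemma word_reduction:
  "list_all2 (\<lambda>d x. x \<in> lv_part {d}) ds w \<Longrightarrow> sum_list ds \<ge> 0 \<Longrightarrow>
    uea_word w - uea_scale (vev w) 1 \<in> rel"
proof (induction "length w" arbitrary: w ds rule: less_induct)
  case less
  show ?case
  proof (cases w)
    case Nil
    then show ?thesis by (simp add: verma_relations.zero)
  next
    case (Cons x w')
    then obtain d ds' where ds: "ds = d # ds'" and x: "x \<in> lv_part {d}"
        and w': "list_all2 (\<lambda>d x. x \<in> lv_part {d}) ds' w'"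
      using less.prems by (auto simp: list_all2_Cons2)
    have len: "length ds' = length w'" using w' by (rule list_all2_lengthD)
    show ?thesis
    proof (cases "d < 0")
      case True
      then have neg: "x \<in> lv_part {..<0}" using x by (auto intro: lv_part_mono)
      \<comment> \<open>Without its negative head the word has positive degree, so by induction it
        already kills the generating vector.\<close>
      have "vev w' = 0" using True less.prems ds by (intro vev_degree[OF w']) simp
      then have "uea_word w' \<in> rel"
        using less.hyps[of w' ds'] w' True less.prems ds Cons by simp
      then show ?thesis
        by (simp add: Cons vev_negative[OF neg] verma_relations_mult_left)
    next
      case False
      then have nonneg: "x \<in> lv_part {0..}" using x by (auto intro: lv_part_mono)
      \<comment> \<open>The counterpart of \<open>vev_Cons\<close>: \<open>x\<close> is moved to the
        right end, leaving one bracket per slot.\<close>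
      have commute: "uea_of x * uea_word v = slot_sum uea_word (lv_bracket x) v + uea_word v * uea_of x" for v
      proof (induction v)
        case (Cons y v)
        have "uea_of x * uea_word (y # v) = uea_of y * (uea_of x * uea_word v) + uea_of (lv_bracket x y) * uea_word v"
          using uea_of_commutator[of x y] by (simp add: distrib_right flip: mult.assoc)
        moreover have "slot_sum (\<lambda>v. uea_word (y # v)) (lv_bracket x) v = uea_of y * slot_sum uea_word (lv_bracket x) v"
          by (simp add: slot_sum_eq sum_distrib_left)
        ultimately show ?case using Cons by (simp add: distrib_left mult.assoc)
      qed simp
      have 1: "uea_word (w'[i := lv_bracket x (w' ! i)]) - uea_scale (vev (w'[i := lv_bracket x (w' ! i)])) 1 \<in> rel"
        if "i < length w'" for i
      proof (rule less.hyps)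
        have br: "lv_bracket x (w' ! i) \<in> lv_part {d + ds' ! i}"
          by (rule lv_bracket_part[OF x list_all2_nthD2[OF w' that]]) simp
        then show "list_all2 (\<lambda>d x. x \<in> lv_part {d}) (ds'[i := d + ds' ! i]) (w'[i := lv_bracket x (w' ! i)])"
          using w' by (intro list_all2_update_cong) simp_all
        have "sum_list (ds'[i := d + ds' ! i]) = sum_list ds"
          using that len id_take_nth_drop[of i ds', THEN arg_cong[where f = sum_list]]
          by (simp add: ds upd_conv_take_nth_drop)
        then show "sum_list (ds'[i := d + ds' ! i]) \<ge> 0" using less.prems by simp
      qed (simp add: Cons)
      have "(\<Sum>i\<in>I. uea_word (w'[i := lv_bracket x (w' ! i)]) - uea_scale (vev (w'[i := lv_bracket x (w' ! i)])) 1) \<in> rel"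
        if "I \<subseteq> {..<length w'}" for I
        using finite_subset[OF that finite_lessThan] that
        by (induction I rule: finite_induct) (auto intro: verma_relations.zero verma_relations_add 1)
      then have A: "slot_sum uea_word (lv_bracket x) w' - uea_scale (slot_sum vev (lv_bracket x) w') 1 \<in> rel"
        by (simp add: slot_sum_eq sum_subtractf uea_scale.scale_sum_left)
      \<comment> \<open>At the right end \<open>x\<close> acts by its weight if its degree is zero,
        and by zero if it is positive.\<close>
      have B: "uea_word w' * uea_of x - uea_scale (\<phi> (lv_proj {0} x) * vev w') 1 \<in> rel"
      proof (cases "d = 0")
        case True
        have "uea_word w' * uea_of x - uea_scale (\<phi> x) (uea_word w') \<in> rel"
          using x True by (intro verma_degree_zero) (simp add: lv_zero_part_eq)
        moreover have "uea_scale (\<phi> x) (uea_word w' - uea_scale (vev w') 1) \<in> rel"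
          using less.hyps[of w' ds'] w' less.prems ds Cons True by (simp add: verma_relations_scale)
        ultimately show ?thesis
          using verma_relations_add x True by (fastforce simp: uea_scale.scale_right_diff_distrib lv_proj_part)
      next
        case d: False
        then have "x \<in> lv_part (- {0})" "x \<in> lv_part {0<..}" using x False by (auto intro: lv_part_mono)
        then show ?thesis
          using wt_nonzero_degree[of x] by (simp add: verma_degree_pos lv_plus_part_eq)
      qed
      show ?thesis
        using verma_relations_add[OF A B]
        by (simp add: Cons commute vev_nonneg[OF nonneg] uea_scale.scale_left_distrib algebra_simps)
    qed
  qed
qed

text \<open>A polynomial in d_0 whose roots are the weights \<open>\<phi> lv_d0 - k\<close> for k =
  1, ..., n. On the highest weight it takes the value n!, so it replaces the projection onto that
  weight space without decomposing vectors.\<close>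

primrec lowering_product :: "nat \<Rightarrow> uea" where
  "lowering_product 0 = 1"
| "lowering_product (Suc n) =
     (uea_of lv_d0 + uea_scale (of_nat (Suc n) - \<phi> lv_d0) 1) * lowering_product n"

lemma d0_word:
  assumes "list_all2 (\<lambda>d x. x \<in> lv_part {d}) ds w"
  shows "uea_of lv_d0 * uea_word w - uea_scale (\<phi> lv_d0 + of_int (sum_list ds)) (uea_word w) \<in> rel"
proof -
  have "uea_of lv_d0 * uea_word w = uea_scale (of_int (sum_list ds)) (uea_word w) + uea_word w * uea_of lv_d0"
    using assms
  proof (induction rule: list_all2_induct)
    case (Cons d ds x w)
    have "uea_of lv_d0 * uea_word (x # w) = uea_of x * (uea_of lv_d0 * uea_word w) + uea_scale (of_int d) (uea_of x * uea_word w)"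
      using uea_of_commutator[of lv_d0 x]
      by (simp add: distrib_right lv_bracket_d0[OF Cons(1)] uea_of_cscale uea_scale_mult_left flip: mult.assoc)
    then show ?case
      by (simp add: Cons.IH distrib_left uea_scale_mult_right uea_scale.scale_left_distrib mult.assoc)
  qed simp
  moreover have "lv_d0 \<in> lv_zero_part" by (simp add: lv_d0_def lv_zero_part_eq)
  ultimately show ?thesis
    using verma_degree_zero[of lv_d0 "uea_word w" \<phi>] by (simp add: uea_scale.scale_left_distrib algebra_simps)
qed

lemma lowering_product_word:
  assumes "list_all2 (\<lambda>d x. x \<in> lv_part {d}) ds w"
  shows "lowering_product n * uea_word w
    - uea_scale (\<Prod>k=1..n. of_int (sum_list ds) + of_nat k) (uea_word w) \<in> rel"
proof (induction n)
  case (Suc n)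
  let ?c = "\<Prod>k=1..n. of_int (sum_list ds) + of_nat k :: complex"
  let ?z = "uea_of lv_d0 + uea_scale (of_nat (Suc n) - \<phi> lv_d0) 1"
  have "?z * (lowering_product n * uea_word w - uea_scale ?c (uea_word w)) \<in> rel"
    by (rule verma_relations_mult_left) (rule Suc)
  moreover have "uea_scale ?c (uea_of lv_d0 * uea_word w - uea_scale (\<phi> lv_d0 + of_int (sum_list ds)) (uea_word w)) \<in> rel"
    by (rule verma_relations_scale) (rule d0_word[OF assms])
  ultimately have "?z * (lowering_product n * uea_word w - uea_scale ?c (uea_word w))
      + uea_scale ?c (uea_of lv_d0 * uea_word w - uea_scale (\<phi> lv_d0 + of_int (sum_list ds)) (uea_word w)) \<in> rel"
    by (rule verma_relations_add)
  also have "?z * (lowering_product n * uea_word w - uea_scale ?c (uea_word w))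
      + uea_scale ?c (uea_of lv_d0 * uea_word w - uea_scale (\<phi> lv_d0 + of_int (sum_list ds)) (uea_word w))
    = lowering_product (Suc n) * uea_word w
      - uea_scale (?c * (of_int (sum_list ds) + of_nat (Suc n))) (uea_word w)"
    by (simp add: algebra_simps uea_scale_mult_left uea_scale_mult_right uea_scale.scale_right_diff_distrib
        uea_scale.scale_left_distrib uea_scale.scale_left_diff_distrib uea_scale.scale_right_distrib)
  finally show ?case by (simp add: prod.nat_ivl_Suc' mult.commute)
qed (simp add: verma_relations.zero)

lemma gen_words_degrees: "list_all2 (\<lambda>d x. x \<in> lv_part {d}) (map gen_degree l) (gen_words l)"
  by (induction l) (simp_all add: gen_words_def)

text \<open>For large \<open>n\<close> this product annihilates all weights of the Verma module below the highest one.\<close>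

lemma lowering_product_reduction:
  "\<exists>n\<^sub>0. \<forall>n\<ge>n\<^sub>0. lowering_product n * u - uea_scale (fact n * uea_vev u) 1 \<in> rel"
proof (induction u rule: uea_gen_word_induct)
  case (add u v)
  then obtain n m where "\<forall>k\<ge>n. lowering_product k * u - uea_scale (fact k * uea_vev u) 1 \<in> rel"
    "\<forall>k\<ge>m. lowering_product k * v - uea_scale (fact k * uea_vev v) 1 \<in> rel" by blast
  then have "\<forall>k\<ge>max n m. (lowering_product k * u - uea_scale (fact k * uea_vev u) 1)
      + (lowering_product k * v - uea_scale (fact k * uea_vev v) 1) \<in> rel"
    by (auto intro: verma_relations_add)
  then show ?case
    by (intro exI[of _ "max n m"]) (simp add: uea_vev_add algebra_simps uea_scale.scale_left_distrib)
next
  case (scale c u)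
  then obtain n where "\<forall>k\<ge>n. lowering_product k * u - uea_scale (fact k * uea_vev u) 1 \<in> rel" by blast
  then have "\<forall>k\<ge>n. uea_scale c (lowering_product k * u - uea_scale (fact k * uea_vev u) 1) \<in> rel"
    by (auto intro: verma_relations_scale)
  then show ?case
    by (intro exI[of _ n])
      (simp add: uea_vev_scale uea_scale_mult_right uea_scale.scale_right_diff_distrib mult.left_commute)
next
  case (word l)
  let ?w = "gen_words l" and ?s = "sum_list (map gen_degree l)"
  note deg = gen_words_degrees[of l]
  show ?case
  \<comment> \<open>If the word has negative degree s, the factor with k = -s vanishes as soon as n
    is at least -s.\<close>
  proof (intro exI[of _ "nat (- ?s)"] allI impI)
    fix n assume n: "nat (- ?s) \<le> n"
    let ?c = "\<Prod>k=1..n. of_int ?s + of_nat k :: complex"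
    have "uea_scale ?c (uea_word ?w) - uea_scale (fact n * vev ?w) 1 \<in> rel"
    proof (cases "?s \<ge> 0")
      case True
      \<comment> \<open>For degree zero the product is n!. For positive degree it is a different
        number, but then \<open>vev\<close> is zero.\<close>
      have eq: "?c * vev ?w = fact n * vev ?w"
      proof (cases "?s = 0")
        case True
        then show ?thesis by (simp add: fact_prod)
      next
        case False
        then show ?thesis using vev_degree[OF deg] by simp
      qed
      show ?thesis
        using verma_relations_scale[OF word_reduction[OF deg True], of ?c]
        unfolding uea_scale.scale_right_diff_distrib uea_scale.scale_scale eq .
    next
      case False
      then have c: "?c = 0"
        using n by (intro prod_zero) (auto intro!: bexI[of _ "nat (- ?s)"])
      show ?thesis using vev_degree[OF deg] False unfolding c by (simp add: verma_relations.zero)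
    qed
    then show "lowering_product n * uea_word ?w - uea_scale (fact n * uea_vev (uea_word ?w)) 1 \<in> rel"
      using verma_relations_add[OF lowering_product_word[OF deg, of n]] by (fastforce simp: uea_vev_word)
  qed
qed

text \<open>If some translate of \<open>u\<close> has a component at the highest weight vector,
  \<open>lowering_product\<close> turns that translate into a nonzero multiple of the vector, which
  generates everything.\<close>

lemma proper_submodule_subset_radical:
  assumes T: "closed_subspace uea_scale T" "\<And>x u. u \<in> T \<Longrightarrow> uea_of x * u \<in> T" "rel \<subseteq> T" "T \<noteq> UNIV"
  shows "T \<subseteq> radical"
proof
  have left: "w * v \<in> T" if "v \<in> T" for w v
    using closed_subspace_mult_left[OF T(1) _ that] T(2) by blast
  have T_closed: "u + v \<in> T" "uea_scale c u \<in> T" if "u \<in> T" "v \<in> T" for u v c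
    using T(1) that by (auto simp: closed_subspace_def)
  fix u assume u: "u \<in> T"
  show "u \<in> radical"
  proof (rule ccontr)
    assume "u \<notin> radical"
    then obtain w where w: "uea_vev (w * u) \<noteq> 0" by (auto simp: radical_def)
    obtain n where n: "lowering_product n * (w * u) - uea_scale (fact n * uea_vev (w * u)) 1 \<in> rel"
      using lowering_product_reduction[of "w * u"] by blast
    define c where "c = fact n * uea_vev (w * u)"
    have c: "c \<noteq> 0" using w by (simp add: c_def)
    have "lowering_product n * (w * u) + uea_scale (- 1) (lowering_product n * (w * u) - uea_scale c 1) \<in> T"
      using n T(3) u by (intro T_closed left) (auto simp: c_def)
    then have "uea_scale c 1 \<in> T" by simp
    then have "uea_scale (inverse c) (uea_scale c 1) \<in> T"
      using T_closed(2)[of "uea_scale c 1" "uea_scale c 1"] by blast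
    then have one: "1 \<in> T" using c by simp
    have "v \<in> T" for v using left[OF one, of v] by simp
    then show False using T(4) by blast
  qed
qed

section \<open>The unique maximal submodule and the irreducible quotient\<close>

abbreviation verma_map :: "uea \<Rightarrow> uea set" where
  "verma_map u \<equiv> rel +>\<^bsub>uea_module\<^esub> u"

interpretation verma: lv_presentation uea_scale "\<lambda>x u. uea_of x * u" UNIV rel verma_map "verma_module \<phi>"
  by (rule lv_presentation_verma)

text \<open>The radical is the greatest proper submodule, not just a maximal one: it contains every
  proper submodule and misses 1. This settles existence and uniqueness together.\<close>

lemma maximal_submodule_unique: "(THE N. maximal_proper_submodule (verma_module \<phi>) N) = verma_map ` radical"
proof (rule the_equality)
  have sub: "lv_submodule (verma_module \<phi>) (verma_map ` radical)"
    by (intro verma.lv_submodule_image closed_radical radical_mult_left) auto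
  have proper: "verma_map ` radical \<noteq> carrier (verma_module \<phi>)"
  proof
    assume "verma_map ` radical = carrier (verma_module \<phi>)"
    then have "verma_map 1 \<in> verma_map ` radical" by (simp add: verma.carrier)
    then obtain r where r: "r \<in> radical" "1 - r \<in> rel" using verma.m_eq by auto
    then have "1 - r \<in> radical" using relations_subset_radical by blast
    then have "(1 - r) + r \<in> radical" using r(1) closed_radical unfolding closed_subspace_def by blast
    then show False using one_notin_radical by simp
  qed
  have max: "N \<subseteq> verma_map ` radical" if N: "lv_submodule (verma_module \<phi>) N" "N \<noteq> carrier (verma_module \<phi>)" for N
  proof -
    let ?T = "{u \<in> UNIV. verma_map u \<in> N}"
    note pre = verma.lv_submodule_preimage[OF N(1)]
    have "?T \<noteq> UNIV" using pre(4) N(2) verma.carrier by metis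
    then have "?T \<subseteq> radical" using pre by (intro proper_submodule_subset_radical) blast+
    then show ?thesis using pre(4) by blast
  qed
  show "maximal_proper_submodule (verma_module \<phi>) (verma_map ` radical)"
    unfolding maximal_proper_submodule_def using sub proper max by blast
  show "N = verma_map ` radical" if "maximal_proper_submodule (verma_module \<phi>) N" for N
    using that sub proper max unfolding maximal_proper_submodule_def by blast
qed

definition hw_map :: "uea \<Rightarrow> uea set set" where
  "hw_map u = verma_map ` radical +>\<^bsub>verma_module \<phi>\<^esub> verma_map u"

lemma lv_presentation_hw:
  "lv_presentation uea_scale (\<lambda>x u. uea_of x * u) UNIV radical hw_map (highest_weight_module \<phi>)"
  unfolding highest_weight_module_def maximal_submodule_unique hw_map_def
  by (intro verma.quotient closed_radical relations_subset_radical radical_mult_left) auto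

end

section \<open>Finite-dimensional weight spaces\<close>

context lv_presentation
begin

text \<open>The vectors come as a sequence, which may repeat modulo \<open>K\<close>; a repetition
  is itself a relation. Otherwise the sequence is an infinite set in a finite-dimensional
  space.\<close>

lemma fin_dim_dependence:
  assumes T: "closed_subspace s T" "T \<subseteq> S"
    and fd: "vectorspace.fin_dim complex_field (M\<lparr>carrier := m ` T\<rparr>)"
    and z: "\<And>k::nat. z k \<in> T"
  shows "\<exists>c n. (\<exists>k\<le>n. c k \<noteq> 0) \<and> (\<Sum>k\<le>n. s (c k) (z k)) \<in> K"
proof -
  interpret vs: vector_space s by (rule vector_space)
  interpret V: vectorspace complex_field "M\<lparr>carrier := m ` T\<rparr>" by (rule vectorspace_image[OF T])
  have T_closed: "0 \<in> T" "u \<in> T \<Longrightarrow> v \<in> T \<Longrightarrow> u + v \<in> T" "u \<in> T \<Longrightarrow> s c u \<in> T" for u v c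
    using T by (auto simp: closed_subspace_def)
  have S': "u \<in> T \<Longrightarrow> u \<in> S" for u using T by blast
  have sum_T: "(\<Sum>k\<in>I. g k) \<in> T" if "\<And>k. k \<in> I \<Longrightarrow> g k \<in> T" for g and I :: "nat set"
    using that by (induction I rule: infinite_finite_induct) (auto intro: T_closed)
  \<comment> \<open>Coefficients on an index set are padded with zeros to an initial segment, the
    shape of the coefficients of a polynomial.\<close>
  have single: "(\<Sum>k\<le>n. s (if k \<in> I then c k else 0) (z k)) = (\<Sum>k\<in>I. s (c k) (z k))"
    if "I \<subseteq> {..n}" for c n and I :: "nat set"
    using that by (simp add: if_distrib[of "\<lambda>a. s a _"] sum.If_cases Int_absorb1 cong: if_cong)
  show ?thesis
  proof (cases "inj (\<lambda>k. m (z k))")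
    case False
    then obtain i j where ij: "m (z i) = m (z j)" "i \<noteq> j" by (auto simp: inj_on_def)
    then have "z i - z j \<in> K" using z S' m_eq by blast
    moreover have "(\<Sum>k\<le>max i j. s (if k \<in> {i, j} then if k = i then 1 else - 1 else 0) (z k)) = z i - z j"
      using ij(2) by (subst single) auto
    ultimately show ?thesis
      by (intro exI[of _ "\<lambda>k. if k \<in> {i, j} then if k = i then 1 else - 1 else 0"] exI[of _ "max i j"])
        (auto intro!: exI[of _ i])
  next
    case True
    then have "infinite (range (\<lambda>k. m (z k)))" by (rule range_inj_infinite)
    then have "V.lin_dep (range (\<lambda>k. m (z k)))"
      using V.fin_dim_li_fin[OF fd] z by (auto simp: image_iff)
    then obtain A a v where A: "finite A" "A \<subseteq> range (\<lambda>k. m (z k))" "v \<in> A" "a v \<noteq> 0"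
        and zero: "V.lincomb a A = \<zero>\<^bsub>M\<^esub>"
      unfolding V.lin_dep_def by auto
    obtain I where I: "finite I" "A = (\<lambda>k. m (z k)) ` I"
      using finite_subset_image[OF A(1,2)] by auto
    let ?g = "\<lambda>k. s (a (m (z k))) (z k)"
    have inj: "inj_on (\<lambda>k. m (z k)) I" using True by (rule inj_on_subset) simp
    have finsum: "finsum (M\<lparr>carrier := m ` T\<rparr>) (\<lambda>k. m (?g k)) J = m (\<Sum>k\<in>J. ?g k)" if "finite J" for J
      using that
    proof (induction J rule: finite_induct)
      case empty
      then show ?case by (simp add: m_zero)
    next
      case (insert k J)
      have "?g i \<in> T" for i using z T_closed by blast
      moreover from this have "(\<Sum>k\<in>J. ?g k) \<in> T" by (intro sum_T)
      ultimately show ?case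
        using insert V.M.finsum_insert[of J k "\<lambda>k. m (?g k)"] by (simp add: m_add S' Pi_iff)
    qed
    have "V.lincomb a A = finsum (M\<lparr>carrier := m ` T\<rparr>) (\<lambda>k. a (m (z k)) \<odot>\<^bsub>M\<^esub> m (z k)) I"
      using V.M.finsum_reindex[OF _ inj, of "\<lambda>v. a v \<odot>\<^bsub>M\<^esub> v"] z
      by (simp add: V.lincomb_def I(2) Pi_iff m_scale[symmetric] S' T_closed)
    also have "\<dots> = finsum (M\<lparr>carrier := m ` T\<rparr>) (\<lambda>k. m (?g k)) I"
      using z by (simp add: m_scale S')
    finally have "m (\<Sum>k\<in>I. ?g k) = m 0"
      using zero by (simp add: finsum[OF I(1)] m_zero)
    moreover have "(\<Sum>k\<in>I. ?g k) \<in> S" using z T_closed by (intro S' sum_T) blast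
    ultimately have "(\<Sum>k\<in>I. ?g k) \<in> K" using m_eq[of "\<Sum>k\<in>I. ?g k" 0] S_zero by simp
    moreover obtain i where "i \<in> I" "a (m (z i)) \<noteq> 0" using A I by auto
    moreover have "I \<subseteq> {..Max I}" using I(1) by auto
    ultimately show ?thesis
      using single[of I "Max I" "\<lambda>k. a (m (z k))"]
      by (intro exI[of _ "\<lambda>k. if k \<in> I then a (m (z k)) else 0"] exI[of _ "Max I"]) auto
  qed
qed

end

lemma uea_of_sum: "uea_of (sum f A) = (\<Sum>a\<in>A. uea_of (f a))"
  using uea_of_cscale[of 0 0]
  by (induction A rule: infinite_finite_induct) (simp_all add: uea_of_add)

context highest_weight
begin

lemma wt_sum: "wt (sum f A) = (\<Sum>a\<in>A. wt (f a))"
  by (induction A rule: infinite_finite_induct) (simp_all add: wt_add wt_0)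

text \<open>The hypothesis concerns shifts of a single \<open>x\<close>, because different elements
  are first annihilated by different polynomials.\<close>

lemma wt_pmul_pmul:
  assumes "\<And>j. wt (pmul P (tmul j x)) = 0"
  shows "wt (pmul (P * Q) x) = 0"
proof -
  have "wt (pmul P (pmul Q x)) = (\<Sum>i\<le>degree Q. coeff Q i * wt (pmul P (tmul (int i) x)))"
    by (simp add: pmul_def[of Q] pmul_sum_right pmul_cscale_right wt_sum wt_cscale)
  then show ?thesis by (simp add: pmul_mult assms)
qed

lemma wt_pmul_tmul_cancel:
  assumes "\<And>x. wt (pmul (monom 1 n * Q) x) = 0"
  shows "wt (pmul Q x) = 0"
  using assms[of "tmul (- int n) x"] by (simp add: pmul_mult pmul_monom pmul_tmul tmul_tmul)

lemma wt_pmul_dvd: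
  assumes "\<And>x. wt (pmul P x) = 0" "P dvd Q"
  shows "wt (pmul Q x) = 0"
  using assms by (auto simp: dvd_def pmul_mult)

end

section \<open>The annihilating polynomial\<close>

context highest_weight_functional
begin

text \<open>The numbers -2i and (i^3 - i)/12 are the structure constants of the bracket of d_i and
  d_(-i).\<close>

lemma weight_space_dependence:
  fixes i :: int
  assumes fin: "finite_dim_weight_spaces (highest_weight_module \<phi>)" and i: "i > 0"
  shows "\<exists>P. P \<noteq> 0 \<and> (\<forall>j. \<phi> (lv_proj {0} (pmul P (Poly_Mapping.single (Dgen 0, j) (of_int (- 2 * i))
    + Poly_Mapping.single (Cgen, j) (of_int (i ^ 3 - i) / 12)))) = 0)"
proof -
  interpret H: lv_presentation uea_scale "\<lambda>x u. uea_of x * u" UNIV radical hw_map "highest_weight_module \<phi>"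
    by (rule lv_presentation_hw)
  define \<mu> where "\<mu> = \<phi> lv_d0 + of_int (- i)"
  define T where "T = {u. uea_of lv_d0 * u - uea_scale \<mu> u \<in> radical}"
  \<comment> \<open>Nonnegative exponents suffice for an infinite family, and make the coefficients
    of a relation those of a polynomial.\<close>
  define y where "y k = (Poly_Mapping.single (Dgen (- i), int k) 1 :: loop_vir)" for k
  have rad: "0 \<in> radical" "u \<in> radical \<Longrightarrow> v \<in> radical \<Longrightarrow> u + v \<in> radical"
    "u \<in> radical \<Longrightarrow> uea_scale c u \<in> radical" for u v c
    using closed_radical by (auto simp: closed_subspace_def)
  have T: "closed_subspace uea_scale T"
    unfolding closed_subspace_def
  proof (intro conjI ballI allI)
    fix u assume u: "u \<in> T"
    show "uea_scale c u \<in> T" for c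
      using rad(3)[of "uea_of lv_d0 * u - uea_scale \<mu> u" c] u
      by (simp add: T_def uea_scale_mult_right uea_scale.scale_right_diff_distrib mult.commute)
    fix v assume v: "v \<in> T"
    show "u + v \<in> T"
      using rad(2)[of "uea_of lv_d0 * u - uea_scale \<mu> u" "uea_of lv_d0 * v - uea_scale \<mu> v"] u v
      by (simp add: T_def distrib_left uea_scale.scale_right_distrib algebra_simps)
  qed (simp add: T_def rad)
  have "weight_space (highest_weight_module \<phi>) \<mu> = hw_map ` T"
  proof -
    have "act (highest_weight_module \<phi>) lv_d0 (hw_map u) = \<mu> \<odot>\<^bsub>highest_weight_module \<phi>\<^esub> hw_map u \<longleftrightarrow> u \<in> T" for u
      using H.m_eq by (simp add: T_def flip: H.m_act H.m_scale)
    then show ?thesis by (auto simp: weight_space_def H.carrier)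
  qed
  then have fd: "vectorspace.fin_dim complex_field ((highest_weight_module \<phi>)\<lparr>carrier := hw_map ` T\<rparr>)"
    using fin by (metis finite_dim_weight_spaces_def)
  have "uea_of (y k) \<in> T" for k
  proof -
    have "list_all2 (\<lambda>d x. x \<in> lv_part {d}) [- i] [y k]" by (simp add: y_def)
    from d0_word[OF this] show ?thesis
      using relations_subset_radical by (auto simp: T_def \<mu>_def)
  qed
  with H.fin_dim_dependence[OF T _ fd, of "\<lambda>k. uea_of (y k)"] obtain c n where
    c: "\<exists>k\<le>n. c k \<noteq> 0" "(\<Sum>k\<le>n. uea_scale (c k) (uea_of (y k))) \<in> radical" by auto
  define P where "P = (\<Sum>k\<le>n. monom (c k) k)"
  have coeff_P: "coeff P k = (if k \<le> n then c k else 0)" for k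
    by (simp add: P_def coeff_sum coeff_monom)
  have "P \<noteq> 0" using c(1) coeff_P by (metis coeff_0)
  have "degree P \<le> n" by (rule degree_le) (simp add: coeff_P)
  have "uea_of (pmul P (y 0)) = (\<Sum>k\<le>n. uea_scale (c k) (uea_of (y k)))"
    unfolding pmul_superset[OF \<open>degree P \<le> n\<close>]
    by (simp add: uea_of_sum uea_of_cscale coeff_P y_def del: cscale_single)
  then have P: "uea_of (pmul P (y 0)) \<in> radical" using c(2) by simp
  have "\<phi> (lv_proj {0} (pmul P (Poly_Mapping.single (Dgen 0, j) (of_int (- 2 * i))
    + Poly_Mapping.single (Cgen, j) (of_int (i ^ 3 - i) / 12)))) = 0" for j
  proof -
    define x where "x = (Poly_Mapping.single (Dgen i, j) 1 :: loop_vir)"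
    have x: "x \<in> lv_part {0..}" "x \<in> lv_part (- {0})" using i by (simp_all add: x_def)
    have "0 = uea_vev (uea_of x * uea_of (pmul P (y 0)))" using P by (simp add: radical_def)
    also have "\<dots> = vev [x, pmul P (y 0)]" using uea_vev_word[of "[x, pmul P (y 0)]"] by simp
    \<comment> \<open>As \<open>x\<close> has positive degree it kills the highest weight vector,
      and only its bracket with the lowering element contributes.\<close>
    also have "\<dots> = \<phi> (lv_proj {0} (lv_bracket x (pmul P (y 0))))"
      by (simp add: wt_nonzero_degree[OF x(2)] vev_Cons lv_proj_part[OF x(1)])
    also have "lv_bracket x (pmul P (y 0)) = pmul P (lv_bracket x (y 0))"
      by (rule lv_bracket_pmul_right)
    also have "lv_bracket x (y 0) = Poly_Mapping.single (Dgen 0, j) (of_int (- 2 * i))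
        + Poly_Mapping.single (Cgen, j) (of_int (i ^ 3 - i) / 12)"
      by (simp add: x_def y_def lv_bracket_Dgen)
    finally show ?thesis by simp
  qed
  then show ?thesis using \<open>P \<noteq> 0\<close> by blast
qed

text \<open>For i = 1 the central term vanishes, which isolates d_0; for i = 2 the combination -4
  d_0 + c/2 appears. The product of the two polynomials annihilates d_0 and the combination, hence
  also c.\<close>

lemma ex_annihilating_poly:
  assumes "finite_dim_weight_spaces (highest_weight_module \<phi>)"
  shows "\<exists>P. P \<noteq> 0 \<and> (\<forall>x. \<phi> (lv_proj {0} (pmul P x)) = 0)"
proof -
  let ?wt = "\<lambda>x. \<phi> (lv_proj {0} x)"
  let ?d = "\<lambda>j. Poly_Mapping.single (Dgen 0, j) 1 :: loop_vir" and ?c = "\<lambda>j. Poly_Mapping.single (Cgen, j) 1 :: loop_vir"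
  obtain P where P: "P \<noteq> 0" "\<And>j. ?wt (pmul P (Poly_Mapping.single (Dgen 0, j) (- 2))) = 0"
    using weight_space_dependence[OF assms, of 1] by auto
  obtain Q where Q: "Q \<noteq> 0"
    "\<And>j. ?wt (pmul Q (Poly_Mapping.single (Dgen 0, j) (- 4) + Poly_Mapping.single (Cgen, j) (1 / 2))) = 0"
    using weight_space_dependence[OF assms, of 2] by auto
  have d: "?wt (pmul (P * Q) (?d j)) = 0" for j
  proof (rule wt_pmul_pmul)
    fix i
    have "?wt (pmul P (cscale (- 2) (?d (j + i)))) = 0" using P(2)[of "j + i"] by simp
    then show "?wt (pmul P (tmul i (?d j))) = 0"
      by (simp only: pmul_cscale_right wt_cscale tmul_single) simp
  qed
  have c: "?wt (pmul (P * Q) (?c j)) = 0" for j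
  proof -
    have "?wt (pmul (Q * P) (Poly_Mapping.single (Dgen 0, j) (- 4) + Poly_Mapping.single (Cgen, j) (1 / 2))) = 0"
      by (rule wt_pmul_pmul) (simp add: tmul_add Q(2))
    moreover have "Poly_Mapping.single (Dgen 0, j) (- 4) + Poly_Mapping.single (Cgen, j) (1 / 2)
        = cscale (- 4) (?d j) + cscale (1 / 2) (?c j)"
      by simp
    ultimately have "- 4 * ?wt (pmul (P * Q) (?d j)) + 1 / 2 * ?wt (pmul (P * Q) (?c j)) = 0"
      by (simp only: pmul_add_right pmul_cscale_right wt_add wt_cscale mult.commute[of Q P])
    then show ?thesis using d[of j] by simp
  qed
  have "?wt (pmul (P * Q) x) = 0" for x
  proof (induction x rule: poly_mapping_linear_induct)
    case (single a)
    obtain g j where a: "a = (g, j)" by (cases a)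
    show ?case
    proof (cases g)
      case (Dgen k)
      show ?thesis
      proof (cases "k = 0")
        case True
        then show ?thesis using d a Dgen by simp
      next
        case False
        then show ?thesis by (simp add: a Dgen wt_nonzero_degree lv_part_pmul)
      qed
    next
      case Cgen
      then show ?thesis using c a by simp
    qed
  qed (simp_all add: pmul_add_right pmul_cscale_right wt_add wt_cscale)
  then show ?thesis using P(1) Q(1) by (intro exI[of _ "P * Q"]) simp
qed

text \<open>Evaluation points must be nonzero, so the power of t is cancelled. The factor t - 1 is
  added to ensure a root even if the remaining polynomial is constant.\<close>

lemma ex_annihilating_poly_nonzero_roots:
  assumes "finite_dim_weight_spaces (highest_weight_module \<phi>)"
  shows "\<exists>P. P \<noteq> 0 \<and> poly P 0 \<noteq> 0 \<and> poly P 1 = 0 \<and> (\<forall>x. \<phi> (lv_proj {0} (pmul P x)) = 0)"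
proof -
  obtain P where P: "P \<noteq> 0" "\<And>x. \<phi> (lv_proj {0} (pmul P x)) = 0"
    using ex_annihilating_poly[OF assms] by blast
  define k where "k = Polynomial.order 0 P"
  obtain Q where Q: "P = [:- 0, 1:] ^ k * Q" "\<not> [:- 0, 1:] dvd Q"
    using order_decomp[OF P(1), of 0] unfolding k_def by blast
  have "[:- 0, 1:] ^ k = (monom 1 k :: complex poly)"
    by (simp add: monom_altdef)
  then have "\<phi> (lv_proj {0} (pmul (monom 1 k * Q) x)) = 0" for x
    using P(2)[of x] by (simp only: Q(1))
  then have "\<phi> (lv_proj {0} (pmul Q x)) = 0" for x
    by (rule wt_pmul_tmul_cancel)
  then have "\<phi> (lv_proj {0} (pmul ([:- 1, 1:] * Q) x)) = 0" for x
    by (rule wt_pmul_dvd[OF _ dvd_triv_right])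
  moreover have "poly Q 0 \<noteq> 0" using Q(2) by (simp add: poly_eq_0_iff_dvd)
  moreover from this have "[:- 1, 1:] * Q \<noteq> 0" by (intro no_zero_divisors) auto
  moreover have "poly ([:- 1, 1:] * Q) 1 = 0" "poly ([:- 1, 1:] * Q) 0 = - poly Q 0"
    by (simp_all only: poly_mult) simp_all
  ultimately show ?thesis
    by (intro exI[of _ "[:- 1, 1:] * Q"]) (simp del: mult_pCons_left)
qed

end

section \<open>Tensor products\<close>

lemma prod_split_slot: "i < n \<Longrightarrow> (\<Prod>j<n. g j) = g i * (\<Prod>j\<in>{..<n} - {i}. g j)"
  for g :: "nat \<Rightarrow> complex"
  by (rule prod.remove) auto

lemma sum_keys_single: "(\<Sum>a\<in>Poly_Mapping.keys p. cscale (Poly_Mapping.lookup p a) (Poly_Mapping.single a 1)) = p"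
  by (rule poly_mapping_eqI) (auto simp: lookup_sum lookup_single when_def in_keys_iff)

lemma mem_pure_tensors: "vs \<in> pure_tensors Ms \<longleftrightarrow> length vs = length Ms \<and> (\<forall>i<length Ms. vs ! i \<in> carrier (Ms ! i))"
  by (auto simp: pure_tensors_def list_all2_conv_all_nth)

text \<open>Each factor is the quotient of the enveloping algebra by the radical of a linear
  functional \<open>f i\<close>, which therefore separates points together with its translates. The
  highest weight properties enter only later.\<close>

locale presented_factors =
  fixes Ms :: "'v lv_module list"
    and f :: "nat \<Rightarrow> uea \<Rightarrow> complex"
    and m :: "nat \<Rightarrow> uea \<Rightarrow> 'v"
  assumes f_add: "f i (u + v) = f i u + f i v"
    and f_scale: "f i (uea_scale c u) = c * f i u"
    and presentation: "i < length Ms \<Longrightarrow>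
      lv_presentation uea_scale (\<lambda>x u. uea_of x * u) UNIV {u. \<forall>w. f i (w * u) = 0} (m i) (Ms ! i)"
begin

abbreviation r :: nat where
  "r \<equiv> length Ms"

abbreviation rad :: "nat \<Rightarrow> uea set" where
  "rad i \<equiv> {u. \<forall>w. f i (w * u) = 0}"

abbreviation free :: "('v list \<Rightarrow>\<^sub>0 complex) set" where
  "free \<equiv> carrier (free_tensor_module Ms)"

abbreviation free_act :: "loop_vir \<Rightarrow> ('v list \<Rightarrow>\<^sub>0 complex) \<Rightarrow> ('v list \<Rightarrow>\<^sub>0 complex)" where
  "free_act \<equiv> act (free_tensor_module Ms)"

abbreviation rels :: "('v list \<Rightarrow>\<^sub>0 complex) set" where
  "rels \<equiv> tensor_relations Ms"

definition rep :: "nat \<Rightarrow> 'v \<Rightarrow> uea" where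
  "rep i v = (SOME u. m i u = v)"

lemma f_diff: "f i (u - v) = f i u - f i v"
  using f_add[of i "u - v" v] by simp

lemma f_0: "f i 0 = 0"
  using f_scale[of i 0 0] by simp

lemma f_sum: "f i (sum g A) = (\<Sum>a\<in>A. f i (g a))"
  by (induction A rule: infinite_finite_induct) (simp_all add: f_add f_0)

lemma carrier_Ms: "i < r \<Longrightarrow> carrier (Ms ! i) = range (m i)"
  using lv_presentation.carrier[OF presentation] by blast

lemma m_eq: "i < r \<Longrightarrow> m i u = m i v \<longleftrightarrow> u - v \<in> rad i"
  using lv_presentation.m_eq[OF presentation, of i u v] by blast

lemma m_add: "i < r \<Longrightarrow> m i u \<oplus>\<^bsub>Ms ! i\<^esub> m i v = m i (u + v)"
  using lv_presentation.m_add[OF presentation, of i u v] by simp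

lemma m_scale: "i < r \<Longrightarrow> c \<odot>\<^bsub>Ms ! i\<^esub> m i u = m i (uea_scale c u)"
  using lv_presentation.m_scale[OF presentation, of i u] by simp

lemma m_act: "i < r \<Longrightarrow> act (Ms ! i) x (m i u) = m i (uea_of x * u)"
  using lv_presentation.m_act[OF presentation, of i u] by simp

lemma m_rep: "i < r \<Longrightarrow> v \<in> carrier (Ms ! i) \<Longrightarrow> m i (rep i v) = v"
  unfolding rep_def by (rule someI_ex) (auto simp: carrier_Ms)

text \<open>Two representatives differ by an element of the radical, so the choice made in
  \<open>rep\<close> is invisible.\<close>

lemma f_rep: "i < r \<Longrightarrow> f i (w * rep i (m i u)) = f i (w * u)"
  using m_eq[of i "rep i (m i u)" u] m_rep[of i "m i u"]
  by (simp add: carrier_Ms right_diff_distrib f_diff)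

text \<open>The matrix coefficient of a pure tensor under the product of the functionals v -> f i (u
  v). The value 0 for lists of wrong length allows coordinate functions to be compared as functions
  on all lists.\<close>

definition pairing :: "uea list \<Rightarrow> 'v list \<Rightarrow> complex" where
  "pairing us vs = (if length us = r then \<Prod>i<r. f i (us ! i * rep i (vs ! i)) else 0)"

definition coords :: "('v list \<Rightarrow>\<^sub>0 complex) \<Rightarrow> uea list \<Rightarrow> complex" where
  "coords p us = linear_ext (*) (pairing us) p"

lemma coords_add: "coords (p + q) us = coords p us + coords q us"
  and coords_cscale: "coords (cscale c p) us = c * coords p us"
  and coords_single: "coords (Poly_Mapping.single vs c) us = c * pairing us vs"
  and coords_0: "coords 0 us = 0"
  by (simp_all add: coords_def linear_ext_add[OF vector_space_complex]
      linear_ext_cscale[OF vector_space_complex] linear_ext_single[OF vector_space_complex]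
      linear_ext_zero[OF vector_space_complex])

lemma coords_sum: "coords (sum g A) us = (\<Sum>a\<in>A. coords (g a) us)"
  by (induction A rule: infinite_finite_induct) (simp_all add: coords_add coords_0)

lemma coords_diff: "coords (p - q) us = coords p us - coords q us"
  using coords_add[of "p - q" q us] by simp

lemma coords_length: "length us \<noteq> r \<Longrightarrow> coords p us = 0"
  by (simp add: coords_def linear_ext_def pairing_def)

lemma pairing_update_right:
  assumes "length us = r" "length vs = r" "i < r"
  shows "pairing us (vs[i := v])
    = f i (us ! i * rep i v) * (\<Prod>j\<in>{..<r} - {i}. f j (us ! j * rep j (vs ! j)))"
  unfolding pairing_def by (simp add: assms prod_split_slot[OF assms(3)])

lemma pairing_update_left:
  assumes "length us = r" "i < r"
  shows "pairing (us[i := u]) vs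
    = f i (u * rep i (vs ! i)) * (\<Prod>j\<in>{..<r} - {i}. f j (us ! j * rep j (vs ! j)))"
  unfolding pairing_def by (simp add: assms prod_split_slot[OF assms(2)])

text \<open>The action in one slot, transposed: the operator moves to the other side of the pairing
  as a right factor.\<close>

lemma pairing_act:
  assumes "vs \<in> pure_tensors Ms" "i < r"
  shows "pairing us (vs[i := act (Ms ! i) x (vs ! i)]) = pairing (us[i := us ! i * uea_of x]) vs"
proof (cases "length us = r")
  case True
  have vs: "length vs = r" "vs ! i \<in> carrier (Ms ! i)" using assms by (auto simp: mem_pure_tensors)
  have "f i (us ! i * rep i (act (Ms ! i) x (vs ! i))) = f i (us ! i * uea_of x * rep i (vs ! i))"
    using f_rep[OF assms(2), of "us ! i" "uea_of x * rep i (vs ! i)"] m_act[OF assms(2), of x "rep i (vs ! i)"]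
    by (simp add: m_rep[OF assms(2) vs(2)] mult.assoc)
  then show ?thesis
    by (simp add: pairing_update_right pairing_update_left True vs assms(2))
qed (simp add: pairing_def)

lemma multilinear_coords: "multilinear uea_scale r (coords p)"
proof (rule multilinearI)
  fix us :: "uea list" and i u v c assume i: "i < r" and us: "length us = r"
  have "pairing (us[i := u + v]) = (\<lambda>vs. pairing (us[i := u]) vs + pairing (us[i := v]) vs)"
    by (rule ext) (simp add: pairing_update_left i us distrib_right f_add)
  then show "coords p (us[i := u + v]) = coords p (us[i := u]) + coords p (us[i := v])"
    by (simp add: coords_def linear_ext_def distrib_left sum.distrib)
  have "pairing (us[i := uea_scale c u]) = (\<lambda>vs. c * pairing (us[i := u]) vs)"
    by (rule ext) (simp add: pairing_update_left i us uea_scale_mult_left f_scale)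
  then show "coords p (us[i := uea_scale c u]) = c * coords p (us[i := u])"
    by (simp add: coords_def linear_ext_def sum_distrib_left mult.left_commute)
qed

section \<open>The free space of the tensor product and its action in coordinates\<close>

lemma mem_free: "p \<in> free \<longleftrightarrow> Poly_Mapping.keys p \<subseteq> pure_tensors Ms"
  by (simp add: free_tensor_module_def)

lemma closed_free: "closed_subspace cscale free"
proof -
  have "Poly_Mapping.keys (p + q) \<subseteq> pure_tensors Ms"
    if "Poly_Mapping.keys p \<subseteq> pure_tensors Ms" "Poly_Mapping.keys q \<subseteq> pure_tensors Ms" for p q :: "'v list \<Rightarrow>\<^sub>0 complex"
    using Poly_Mapping.keys_add[of p q] that by blast
  moreover have "Poly_Mapping.keys (cscale c p) \<subseteq> pure_tensors Ms"
    if "Poly_Mapping.keys p \<subseteq> pure_tensors Ms" for p :: "'v list \<Rightarrow>\<^sub>0 complex" and c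
    using keys_cscale[of c p] that by blast
  ultimately show ?thesis by (simp add: closed_subspace_def mem_free)
qed

lemma free_add: "p \<in> free \<Longrightarrow> q \<in> free \<Longrightarrow> p + q \<in> free"
  and free_cscale: "p \<in> free \<Longrightarrow> cscale c p \<in> free"
  and free_0: "0 \<in> free"
  using closed_free by (auto simp: closed_subspace_def)

lemma free_diff: "p \<in> free \<Longrightarrow> q \<in> free \<Longrightarrow> p - q \<in> free"
  using free_add[of p "cscale (- 1) q"] free_cscale[of q "- 1"] by simp

lemma free_single: "vs \<in> pure_tensors Ms \<Longrightarrow> Poly_Mapping.single vs c \<in> free"
  by (simp add: mem_free)

lemma free_sum: "(\<And>a. a \<in> A \<Longrightarrow> g a \<in> free) \<Longrightarrow> sum g A \<in> free"
  by (induction A rule: infinite_finite_induct) (auto intro: free_add free_0)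

lemma free_act_eq: "free_act x p = linear_ext cscale
    (\<lambda>vs. \<Sum>i<r. Poly_Mapping.single (vs[i := act (Ms ! i) x (vs ! i)]) 1) p"
  by (simp add: free_tensor_module_def linear_ext_def cscale.scale_sum_right)

lemma pure_tensors_update:
  "vs \<in> pure_tensors Ms \<Longrightarrow> i < r \<Longrightarrow> v \<in> carrier (Ms ! i) \<Longrightarrow> vs[i := v] \<in> pure_tensors Ms"
  by (auto simp: mem_pure_tensors nth_list_update)

lemma free_act_closed: "p \<in> free \<Longrightarrow> free_act x p \<in> free"
  unfolding free_act_eq linear_ext_def
proof (intro free_sum free_cscale free_single)
  fix vs i assume "p \<in> free" "vs \<in> Poly_Mapping.keys p" "i \<in> {..<r}"
  then have "vs \<in> pure_tensors Ms" "i < r" by (auto simp: mem_free)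
  moreover from this have "vs ! i \<in> range (m i)" by (auto simp: mem_pure_tensors carrier_Ms)
  ultimately show "vs[i := act (Ms ! i) x (vs ! i)] \<in> pure_tensors Ms"
    by (intro pure_tensors_update) (auto simp: m_act carrier_Ms)
qed

lemma coords_act:
  assumes "p \<in> free"
  shows "coords (free_act x p) us = slot_sum (coords p) (\<lambda>u. u * uea_of x) us"
proof (cases "length us = r")
  case True
  have "coords (free_act x p) us = (\<Sum>vs\<in>Poly_Mapping.keys p. Poly_Mapping.lookup p vs
      * (\<Sum>i<r. pairing us (vs[i := act (Ms ! i) x (vs ! i)])))"
    by (simp add: free_act_eq linear_ext_def coords_sum coords_cscale coords_single)
  also have "\<dots> = (\<Sum>vs\<in>Poly_Mapping.keys p. Poly_Mapping.lookup p vs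
      * (\<Sum>i<r. pairing (us[i := us ! i * uea_of x]) vs))"
    using assms by (intro sum.cong arg_cong2[where f = "(*)"] refl pairing_act) (auto simp: mem_free)
  also have "\<dots> = (\<Sum>i<r. coords p (us[i := us ! i * uea_of x]))"
    by (simp add: coords_def linear_ext_def sum_distrib_left sum.swap[of _ "Poly_Mapping.keys p"])
  finally show ?thesis using True by (simp add: slot_sum_eq)
qed (simp add: coords_length slot_sum_eq)

lemma lv_presentation_free:
  "lv_presentation cscale free_act free {0} (\<lambda>p. p) (free_tensor_module Ms)"
proof
  show "closed_subspace cscale free" by (rule closed_free)
  show "free_act x u \<in> {0}" if "u \<in> {0}" for u x using that by (simp add: free_act_eq cscale_ext_simps)
  show "free_act x u \<in> free" if "u \<in> free" for u x using that by (rule free_act_closed)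
  show "free_act x (u + v) = free_act x u + free_act x v" for x u v by (simp add: free_act_eq cscale_ext_simps)
qed (auto simp: closed_subspace_def free_tensor_module_def)

definition pure :: "uea list \<Rightarrow> 'v list \<Rightarrow>\<^sub>0 complex" where
  "pure us = Poly_Mapping.single (map (\<lambda>i. m i (us ! i)) [0..<r]) 1"

lemma pure_update_eq: "length us = r \<Longrightarrow> i < r \<Longrightarrow>
    pure (us[i := u]) = Poly_Mapping.single ((map (\<lambda>i. m i (us ! i)) [0..<r])[i := m i u]) 1"
  unfolding pure_def
  by (rule arg_cong[where f = "\<lambda>vs. Poly_Mapping.single vs 1"], rule nth_equalityI) (auto simp: nth_list_update)

lemma map_pure: "map (\<lambda>i. m i (us ! i)) [0..<r] \<in> pure_tensors Ms"
  by (simp add: mem_pure_tensors carrier_Ms)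

lemma pure_free: "pure us \<in> free"
  unfolding pure_def by (rule free_single[OF map_pure])

lemma coords_pure: "coords (pure us) ws = (if length ws = r then \<Prod>i<r. f i (ws ! i * us ! i) else 0)"
  by (simp add: pure_def coords_single pairing_def f_rep)

section \<open>The multilinearity relations as the kernel of the coordinates\<close>

lemma rels_add: "p \<in> rels \<Longrightarrow> q \<in> rels \<Longrightarrow> p + q \<in> rels"
proof (induction p rule: tensor_relations.induct)
  case zero
  then show ?case by simp
next
  case (additive p vs i v w a)
  then show ?case
    using tensor_relations.additive[of "p + q" Ms vs i v w a] by (simp add: algebra_simps)
next
  case (homogeneous p vs i v a c)
  then show ?case
    using tensor_relations.homogeneous[of "p + q" Ms vs i v a c] by (simp add: algebra_simps)
qed

lemma rels_cscale: "p \<in> rels \<Longrightarrow> cscale b p \<in> rels"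
proof (induction p rule: tensor_relations.induct)
  case zero
  show ?case by (simp add: tensor_relations.zero)
next
  case (additive p vs i v w a)
  then show ?case
    using tensor_relations.additive[of "cscale b p" Ms vs i v w "b * a"]
    by (simp only: cscale.scale_right_distrib cscale.scale_scale)
next
  case (homogeneous p vs i v a c)
  then show ?case
    using tensor_relations.homogeneous[of "cscale b p" Ms vs i v "b * a" c]
    by (simp only: cscale.scale_right_distrib cscale.scale_scale)
qed

lemma rels_sum: "(\<And>a. a \<in> A \<Longrightarrow> g a \<in> rels) \<Longrightarrow> sum g A \<in> rels"
  by (induction A rule: infinite_finite_induct) (auto intro: rels_add tensor_relations.zero)

lemma rels_pure_add:
  assumes "length us = r" "i < r"
  shows "pure (us[i := u + v]) - (pure (us[i := u]) + pure (us[i := v])) \<in> rels"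
  using tensor_relations.additive[OF tensor_relations.zero map_pure[of us] assms(2), of "m i u" "m i v" 1]
  by (simp add: pure_update_eq assms carrier_Ms m_add diff_diff_add)

lemma rels_pure_scale:
  assumes "length us = r" "i < r"
  shows "pure (us[i := uea_scale c u]) - cscale c (pure (us[i := u])) \<in> rels"
  using tensor_relations.homogeneous[OF tensor_relations.zero map_pure[of us] assms(2), of "m i u" 1 c]
  by (simp add: pure_update_eq assms carrier_Ms m_scale)

lemma rels_pure_lincomb:
  fixes n :: nat
  assumes "length us = r" "i < r"
  shows "pure (us[i := (\<Sum>j<n. uea_scale (a j) (e j))]) - (\<Sum>j<n. cscale (a j) (pure (us[i := e j]))) \<in> rels"
proof (induction n)
  case 0
  show ?case using rels_pure_scale[OF assms, of 0 0] by simp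
next
  case (Suc n)
  show ?case
    using rels_add[OF rels_pure_add[OF assms, of "\<Sum>j<n. uea_scale (a j) (e j)" "uea_scale (a n) (e n)"]
        rels_add[OF Suc rels_pure_scale[OF assms, of "a n" "e n"]]]
    by (simp add: algebra_simps)
qed

text \<open>The operator with terms \<open>e j\<close> times \<open>f i (g j * u)\<close> has finite
  rank and fixes \<open>u\<close> modulo the radical.\<close>

definition recovers :: "nat \<Rightarrow> nat \<Rightarrow> (nat \<Rightarrow> uea) \<Rightarrow> (nat \<Rightarrow> uea) \<Rightarrow> uea \<Rightarrow> bool" where
  "recovers i n e g u \<longleftrightarrow> u - (\<Sum>j<n. uea_scale (f i (g j * u)) (e j)) \<in> rad i"

text \<open>Gram-Schmidt for the pairing \<open>f i (w * u)\<close>, which is nondegenerate in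
  \<open>u\<close> modulo the radical. Each new vector that is not yet recovered adds one pair to
  the system.\<close>

lemma finite_dual_system:
  assumes "finite A"
  shows "\<exists>n e g. \<forall>u\<in>A. recovers i n e g u"
  using assms
proof (induction A rule: finite_induct)
  case (insert s A)
  then obtain n e g where "\<forall>u\<in>A. recovers i n e g u" by blast
  then have IH: "u - (\<Sum>j<n. uea_scale (f i (g j * u)) (e j)) \<in> rad i" if "u \<in> A" for u
    using that unfolding recovers_def by blast
  \<comment> \<open>The part of \<open>s\<close> not yet recovered; it becomes the new basis
    vector.\<close>
  define t where "t = s - (\<Sum>j<n. uea_scale (f i (g j * s)) (e j))"
  show ?case
  proof (cases "t \<in> rad i")
    case True
    then have "\<forall>u\<in>insert s A. recovers i n e g u" using IH unfolding t_def recovers_def by blast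
    then show ?thesis by blast
  next
    case False
    then obtain w' where w': "f i (w' * t) \<noteq> 0" by auto
    define w where "w = uea_scale (inverse (f i (w' * t))) w'"
    have w: "f i (w * t) = 1" using w' by (simp add: w_def uea_scale_mult_left f_scale)
    \<comment> \<open>The correction makes the dual functional vanish on \<open>A\<close> while
      keeping the value 1 on \<open>s\<close>.\<close>
    define h where "h = w - (\<Sum>j<n. uea_scale (f i (w * e j)) (g j))"
    have h: "f i (h * u) = f i (w * (u - (\<Sum>j<n. uea_scale (f i (g j * u)) (e j))))" for u
      by (simp add: h_def left_diff_distrib right_diff_distrib f_diff sum_distrib_left sum_distrib_right f_sum
          uea_scale_mult_left uea_scale_mult_right f_scale mult.commute)
    define e' where "e' j = (if j < n then e j else t)" for j
    define g' where "g' j = (if j < n then g j else h)" for j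
    have sum: "(\<Sum>j<Suc n. uea_scale (f i (g' j * u)) (e' j))
        = (\<Sum>j<n. uea_scale (f i (g j * u)) (e j)) + uea_scale (f i (h * u)) t" for u
    proof -
      have "(\<Sum>j<n. uea_scale (f i (g' j * u)) (e' j)) = (\<Sum>j<n. uea_scale (f i (g j * u)) (e j))"
        by (rule sum.cong) (simp_all add: e'_def g'_def)
      then show ?thesis by (simp add: e'_def g'_def)
    qed
    have "u - (\<Sum>j<Suc n. uea_scale (f i (g' j * u)) (e' j)) \<in> rad i" if "u \<in> insert s A" for u
    proof (cases "u \<in> A")
      case True
      have "f i (h * u) = 0" using IH[OF True] unfolding h by blast
      then show ?thesis using IH[OF True] unfolding sum by (simp only: uea_scale.scale_zero_left add_0_right)
    next
      case False
      then have u: "u = s" using that by simp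
      then have "f i (h * u) = 1" using w by (simp only: h t_def)
      then have "u - (\<Sum>j<Suc n. uea_scale (f i (g' j * u)) (e' j)) = 0"
        unfolding sum by (simp add: u t_def)
      then show ?thesis by (simp add: f_0)
    qed
    then have "\<forall>u\<in>insert s A. recovers i (Suc n) e' g' u" unfolding recovers_def by blast
    then show ?thesis by blast
  qed
qed simp

text \<open>Products of functionals separate tensors. The first \<open>k\<close> slots agree in all
  terms; expanding slot \<open>k\<close> in a finite dual system splits the sum into slices that
  agree in one more slot, until all terms are the same tensor.\<close>

lemma rels_if_contractions_vanish:
  assumes "finite I" "k \<le> r" "\<And>a. a \<in> I \<Longrightarrow> length (us a) = r"
    and "\<And>a b. a \<in> I \<Longrightarrow> b \<in> I \<Longrightarrow> take k (us a) = take k (us b)"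
    and "\<And>gs. length gs = r \<Longrightarrow> (\<Sum>a\<in>I. c a * (\<Prod>i\<in>{k..<r}. f i (gs ! i * us a ! i))) = 0"
  shows "(\<Sum>a\<in>I. cscale (c a) (pure (us a))) \<in> rels"
  using assms(2-)
proof (induction "r - k" arbitrary: k us c)
  case 0
  have k: "k = r" using 0(1,2) by linarith
  show ?case
  proof (cases "I = {}")
    case False
    then obtain b where b: "b \<in> I" by blast
    have eq: "us a = us b" if "a \<in> I" for a using 0(4)[OF that b] 0(3)[OF that] 0(3)[OF b] unfolding k by simp
    have "(\<Sum>a\<in>I. cscale (c a) (pure (us a))) = (\<Sum>a\<in>I. cscale (c a) (pure (us b)))"
      by (rule sum.cong[OF refl]) (rule arg_cong[OF eq])
    also have "\<dots> = cscale (\<Sum>a\<in>I. c a) (pure (us b))"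
      by (rule cscale.scale_sum_left[symmetric])
    finally have "(\<Sum>a\<in>I. cscale (c a) (pure (us a))) = cscale (\<Sum>a\<in>I. c a) (pure (us b))" .
    \<comment> \<open>The product over \<open>{r..<r}\<close> is empty, so any list of length
      \<open>r\<close> will do.\<close>
    moreover have "(\<Sum>a\<in>I. c a) = 0" using 0(5)[of "replicate r 0"] k by simp
    ultimately show ?thesis by (simp add: tensor_relations.zero)
  qed (simp add: tensor_relations.zero)
next
  case (Suc d)
  have k: "k < r" using Suc.hyps(2) by linarith
  obtain n e g where "\<forall>u\<in>(\<lambda>a. us a ! k) ` I. recovers k n e g u"
    using finite_dual_system[of "(\<lambda>a. us a ! k) ` I" k] assms(1) by blast
  then have dual: "us a ! k - (\<Sum>j<n. uea_scale (f k (g j * us a ! k)) (e j)) \<in> rad k" if "a \<in> I" for a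
    using that unfolding recovers_def by (meson imageI)
  have expand: "pure (us a) - (\<Sum>j<n. cscale (f k (g j * us a ! k)) (pure ((us a)[k := e j]))) \<in> rels"
    if a: "a \<in> I" for a
  proof -
    have len: "length (us a) = r" using Suc.prems a by blast
    have eq: "m k (us a ! k) = m k (\<Sum>j<n. uea_scale (f k (g j * us a ! k)) (e j))"
      using dual[OF a] by (subst m_eq[OF k])
    have "pure (us a) = pure ((us a)[k := us a ! k])" by simp
    also have "\<dots> = pure ((us a)[k := (\<Sum>j<n. uea_scale (f k (g j * us a ! k)) (e j))])"
      unfolding pure_update_eq[OF len k] by (simp only: eq)
    finally have "pure (us a) = pure ((us a)[k := (\<Sum>j<n. uea_scale (f k (g j * us a ! k)) (e j))])" .
    then show ?thesis
      using rels_pure_lincomb[OF len k, where a = "\<lambda>j. f k (g j * us a ! k)" and e = e] by (simp only:)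
  qed
  \<comment> \<open>For fixed \<open>j\<close> every term has \<open>e j\<close> in slot
    \<open>k\<close>, and its hypothesis is the given one with \<open>g j\<close> inserted in that
    slot.\<close>
  have slice: "(\<Sum>a\<in>I. cscale (c a * f k (g j * us a ! k)) (pure ((us a)[k := e j]))) \<in> rels" for j
  proof (rule Suc.hyps(1)[of "Suc k"])
    show "d = r - Suc k" "Suc k \<le> r" using Suc.hyps(2) k by simp_all
    show "length ((us a)[k := e j]) = r" if "a \<in> I" for a using Suc.prems that by simp
    show "take (Suc k) ((us a)[k := e j]) = take (Suc k) ((us b)[k := e j])" if "a \<in> I" "b \<in> I" for a b
    proof -
      have "k < length (us a)" "k < length (us b)" using Suc.prems(2)[OF that(1)] Suc.prems(2)[OF that(2)] k by simp_all
      then show ?thesis by (simp add: take_Suc_conv_app_nth) (rule Suc.prems(3)[OF that])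
    qed
    fix gs :: "uea list" assume gs: "length gs = r"
    have "(\<Prod>i\<in>{k..<r}. f i (gs[k := g j] ! i * us a ! i))
        = f k (g j * us a ! k) * (\<Prod>i\<in>{Suc k..<r}. f i (gs ! i * (us a)[k := e j] ! i))" for a
    proof -
      have "(\<Prod>i\<in>{Suc k..<r}. f i (gs[k := g j] ! i * us a ! i))
          = (\<Prod>i\<in>{Suc k..<r}. f i (gs ! i * (us a)[k := e j] ! i))"
        by (rule prod.cong) auto
      then show ?thesis using k gs by (simp add: prod.atLeast_Suc_lessThan)
    qed
    then have "(\<Sum>a\<in>I. c a * f k (g j * us a ! k) * (\<Prod>i\<in>{Suc k..<r}. f i (gs ! i * (us a)[k := e j] ! i)))
        = (\<Sum>a\<in>I. c a * (\<Prod>i\<in>{k..<r}. f i (gs[k := g j] ! i * us a ! i)))"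
      by (simp only: mult.assoc)
    also have "\<dots> = 0"
      using gs by (intro Suc.prems(4)) simp
    finally show "(\<Sum>a\<in>I. c a * f k (g j * us a ! k)
        * (\<Prod>i\<in>{Suc k..<r}. f i (gs ! i * (us a)[k := e j] ! i))) = 0" .
  qed
  have "(\<Sum>a\<in>I. cscale (c a) (pure (us a) - (\<Sum>j<n. cscale (f k (g j * us a ! k)) (pure ((us a)[k := e j])))))
      + (\<Sum>j<n. \<Sum>a\<in>I. cscale (c a * f k (g j * us a ! k)) (pure ((us a)[k := e j]))) \<in> rels"
    by (intro rels_add rels_sum rels_cscale expand slice)
  moreover have "(\<Sum>a\<in>I. cscale (c a) (pure (us a) - (\<Sum>j<n. cscale (f k (g j * us a ! k)) (pure ((us a)[k := e j])))))
      = (\<Sum>a\<in>I. cscale (c a) (pure (us a)))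
        - (\<Sum>a\<in>I. \<Sum>j<n. cscale (c a * f k (g j * us a ! k)) (pure ((us a)[k := e j])))"
    by (simp only: cscale.scale_right_diff_distrib sum_subtractf cscale.scale_sum_right cscale.scale_scale)
  moreover have "(\<Sum>j<n. \<Sum>a\<in>I. cscale (c a * f k (g j * us a ! k)) (pure ((us a)[k := e j])))
      = (\<Sum>a\<in>I. \<Sum>j<n. cscale (c a * f k (g j * us a ! k)) (pure ((us a)[k := e j])))"
    by (rule sum.swap)
  ultimately show ?case
    by (simp only: diff_add_cancel)
qed

text \<open>From here on tensors are handled through their coordinate functions alone.\<close>

lemma rels_eq: "rels = {p \<in> free. coords p = (\<lambda>us. 0)}"
proof (intro equalityI subsetI CollectI conjI)
  fix p assume "p \<in> rels"
  then show "p \<in> free"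
  proof (induction p rule: tensor_relations.induct)
    case zero
    show ?case by (rule free_0)
  next
    case (additive p vs i v w a)
    then have "v \<oplus>\<^bsub>Ms ! i\<^esub> w \<in> carrier (Ms ! i)" by (auto simp: carrier_Ms m_add)
    with additive show ?case
      by (intro free_add free_cscale free_diff free_single pure_tensors_update)
  next
    case (homogeneous p vs i v a c)
    then have "c \<odot>\<^bsub>Ms ! i\<^esub> v \<in> carrier (Ms ! i)" by (auto simp: carrier_Ms m_scale)
    with homogeneous show ?case
      by (intro free_add free_cscale free_diff free_single pure_tensors_update)
  qed
  show "coords p = (\<lambda>us. 0)"
    using \<open>p \<in> rels\<close>
  proof (induction p rule: tensor_relations.induct)
    case zero
    show ?case by (simp add: coords_0 fun_eq_iff)
  next
    case (additive p vs i v w a)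
    then obtain u u' where u: "v = m i u" "w = m i u'" by (auto simp: carrier_Ms)
    have "pairing us (vs[i := v \<oplus>\<^bsub>Ms ! i\<^esub> w]) = pairing us (vs[i := v]) + pairing us (vs[i := w])" for us
    proof (cases "length us = r")
      case True
      then show ?thesis
        using additive.hyps u
        by (simp add: mem_pure_tensors pairing_update_right m_add f_rep distrib_left f_add distrib_right)
    qed (simp add: pairing_def)
    then show ?case using additive.IH by (simp add: fun_eq_iff coords_add coords_cscale coords_diff coords_single)
  next
    case (homogeneous p vs i v a c)
    then obtain u where u: "v = m i u" by (auto simp: carrier_Ms)
    have "pairing us (vs[i := c \<odot>\<^bsub>Ms ! i\<^esub> v]) = c * pairing us (vs[i := v])" for us
    proof (cases "length us = r")
      case True
      then show ?thesis
        using homogeneous.hyps u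
        by (simp add: mem_pure_tensors pairing_update_right m_scale f_rep uea_scale_mult_right f_scale)
    qed (simp add: pairing_def)
    then show ?case using homogeneous.IH by (simp add: fun_eq_iff coords_add coords_cscale coords_diff coords_single)
  qed
next
  fix p assume "p \<in> {p \<in> free. coords p = (\<lambda>us. 0)}"
  then have p: "p \<in> free" "coords p us = 0" for us by auto
  let ?us = "\<lambda>vs. map (\<lambda>i. rep i (vs ! i)) [0..<r]"
  have pure: "pure (?us vs) = Poly_Mapping.single vs 1" if "vs \<in> Poly_Mapping.keys p" for vs
  proof -
    have "vs \<in> pure_tensors Ms" using that p by (auto simp: mem_free)
    then show ?thesis
      unfolding pure_def
      by (intro arg_cong[where f = "\<lambda>vs. Poly_Mapping.single vs 1"] nth_equalityI)
        (auto simp: mem_pure_tensors m_rep)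
  qed
  have "(\<Sum>vs\<in>Poly_Mapping.keys p. cscale (Poly_Mapping.lookup p vs) (pure (?us vs))) \<in> rels"
  proof (rule rels_if_contractions_vanish[where k = 0])
    fix gs :: "uea list" assume gs: "length gs = r"
    have "(\<Sum>vs\<in>Poly_Mapping.keys p. Poly_Mapping.lookup p vs * (\<Prod>i = 0..<r. f i (gs ! i * ?us vs ! i))) = coords p gs"
      by (simp add: coords_def linear_ext_def pairing_def gs atLeast0LessThan)
    then show "(\<Sum>vs\<in>Poly_Mapping.keys p. Poly_Mapping.lookup p vs * (\<Prod>i = 0..<r. f i (gs ! i * ?us vs ! i))) = 0"
      using p(2) by simp
  qed simp_all
  then show "p \<in> rels" by (simp add: pure sum_keys_single del: cscale_single cong: sum.cong)
qed

lemma lv_presentation_tensor: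
  "lv_presentation cscale free_act free rels (\<lambda>p. rels +>\<^bsub>free_tensor_module Ms\<^esub> p) (tensor_product Ms)"
proof -
  have "lv_presentation cscale free_act free rels (\<lambda>p. (\<lambda>p. p) ` rels +>\<^bsub>free_tensor_module Ms\<^esub> p)
      (lv_quotient (free_tensor_module Ms) ((\<lambda>p. p) ` rels))"
  proof (rule lv_presentation.quotient[OF lv_presentation_free])
    show "closed_subspace cscale rels"
      by (auto simp: closed_subspace_def tensor_relations.zero rels_add rels_cscale)
    show "free_act x p \<in> rels" if "p \<in> rels" for x p
    proof -
      have p: "p \<in> free" "coords p = (\<lambda>us. 0)" using that by (simp_all add: rels_eq)
      have "coords (free_act x p) us = 0" for us
        by (simp only: coords_act[OF p(1)] p(2) slot_sum_0)
      then have "coords (free_act x p) = (\<lambda>us. 0)" by (rule ext)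
      then show ?thesis using p(1) by (simp add: rels_eq free_act_closed)
    qed
  qed (auto simp: rels_eq coords_0 free_0)
  then show ?thesis by (simp add: tensor_product_def)
qed

end

section \<open>Tensor products of highest weight modules with disjoint supports\<close>

text \<open>The polynomial \<open>P i\<close> annihilates the factor \<open>i\<close>, and
  \<open>e k\<close> is 1 modulo \<open>P k\<close> and 0 modulo the other \<open>P i\<close>. The
  functional \<open>F\<close> belongs to the highest weight module whose weight is the sum of the
  weights of the factors.\<close>

locale highest_weight_factors = presented_factors Ms f m
  for Ms :: "'v lv_module list" and f :: "nat \<Rightarrow> uea \<Rightarrow> complex" and m :: "nat \<Rightarrow> uea \<Rightarrow> 'v" +
  fixes wts :: "nat \<Rightarrow> loop_vir \<Rightarrow> complex"
    and P e :: "nat \<Rightarrow> complex poly"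
    and F :: "uea \<Rightarrow> complex"
  assumes f_one: "i < r \<Longrightarrow> f i 1 = 1"
    and f_nonneg: "i < r \<Longrightarrow> x \<in> lv_part {0..} \<Longrightarrow> f i (u * uea_of x) = wts i x * f i u"
    and f_negative: "i < r \<Longrightarrow> x \<in> lv_part {..<0} \<Longrightarrow> f i (uea_of x * u) = 0"
    and f_pmul: "i < r \<Longrightarrow> f i (u * uea_of (pmul (P i) x) * v) = 0"
    and e_diagonal: "i < r \<Longrightarrow> P i dvd e i - 1"
    and e_off_diagonal: "i < r \<Longrightarrow> k < r \<Longrightarrow> i \<noteq> k \<Longrightarrow> P i dvd e k"
    and F_add: "F (u + v) = F u + F v"
    and F_scale: "F (uea_scale c u) = c * F u"
    and F_one: "F 1 = 1"
    and F_nonneg: "x \<in> lv_part {0..} \<Longrightarrow> F (u * uea_of x) = (\<Sum>i<r. wts i x) * F u"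
    and F_negative: "x \<in> lv_part {..<0} \<Longrightarrow> F (uea_of x * u) = 0"
begin

lemma f_pmul_dvd: "i < r \<Longrightarrow> P i dvd Q \<Longrightarrow> f i (u * uea_of (pmul Q x) * v) = 0"
  using f_pmul by (auto simp: dvd_def pmul_mult)

lemma f_pmul_e:
  assumes "i < r" "k < r"
  shows "f i (u * uea_of (pmul (e k) x) * v) = (if i = k then f i (u * uea_of x * v) else 0)"
proof (cases "i = k")
  case True
  have "pmul (e i) x = pmul (e i - 1) x + x"
    using pmul_add_left[of "e i - 1" 1 x] by simp
  then show ?thesis
    using f_pmul_dvd[OF assms(1) e_diagonal[OF assms(1)]] True
    by (simp add: uea_of_add distrib_left distrib_right f_add)
next
  case False
  then show ?thesis using f_pmul_dvd[OF assms(1) e_off_diagonal[OF assms False]] by simp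
qed

text \<open>A single term of the Leibniz sum survives, so operators on one factor are available
  inside the diagonal action.\<close>

lemma coords_act_e:
  assumes "p \<in> free" "length us = r" "k < r"
  shows "coords (free_act (pmul (e k) x) p) us = coords p (us[k := us ! k * uea_of x])"
proof -
  have "coords p (us[i := us ! i * uea_of (pmul (e k) x)])
      = (if i = k then coords p (us[k := us ! k * uea_of x]) else 0)" if "i < r" for i
  proof -
    have "pairing (us[i := us ! i * uea_of (pmul (e k) x)])
        = (\<lambda>vs. if i = k then pairing (us[k := us ! k * uea_of x]) vs else 0)"
      by (rule ext) (simp add: pairing_update_left assms that f_pmul_e)
    then show ?thesis by (simp add: coords_def linear_ext_def)
  qed
  then show ?thesis
    using assms by (simp add: coords_act slot_sum_eq sum.delta)
qed

abbreviation ones :: "uea list" where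
  "ones \<equiv> replicate r 1"

text \<open>The orbit of the pair of highest weight vectors under lowering operators, in terms of the
  coordinate functions on the two modules. It turns out to be stable under the whole algebra, which
  identifies the two cyclic submodules.\<close>

inductive joint :: "(uea \<Rightarrow> complex) \<Rightarrow> (uea list \<Rightarrow> complex) \<Rightarrow> bool" where
  base: "joint F (coords (pure ones))"
| add: "joint g h \<Longrightarrow> joint g' h' \<Longrightarrow> joint (\<lambda>u. g u + g' u) (\<lambda>us. h us + h' us)"
| scale: "joint g h \<Longrightarrow> joint (\<lambda>u. c * g u) (\<lambda>us. c * h us)"
| negative: "joint g h \<Longrightarrow> x \<in> lv_part {..<0} \<Longrightarrow>
    joint (\<lambda>u. g (u * uea_of x)) (slot_sum h (\<lambda>u. u * uea_of x))"

lemma joint_linear: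
  "joint g h \<Longrightarrow> g (u + v) = g u + g v \<and> g (uea_scale c u) = c * g u"
  by (induction arbitrary: u v rule: joint.induct)
    (simp_all add: F_add F_scale algebra_simps distrib_right uea_scale_mult_left)

lemma joint_coords: "joint g h \<Longrightarrow> \<exists>p\<in>free. h = coords p"
proof (induction rule: joint.induct)
  case base
  then show ?case using pure_free by blast
next
  case (add g h g' h')
  then obtain p q where "p \<in> free" "q \<in> free" "h = coords p" "h' = coords q" by blast
  then show ?case by (intro bexI[of _ "p + q"]) (auto simp: coords_add free_add)
next
  case (scale g h c)
  then obtain p where "p \<in> free" "h = coords p" by blast
  then show ?case by (intro bexI[of _ "cscale c p"]) (auto simp: coords_cscale free_cscale)
next
  case (negative g h x)
  then obtain p where "p \<in> free" "h = coords p" by blast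
  then show ?case by (intro bexI[of _ "free_act x p"]) (auto simp: coords_act free_act_closed)
qed

text \<open>True for \<open>F\<close> and the \<open>f i\<close>, and inherited along the orbit
  because the orbit is formed by right multiplications, which commute with left multiplication by
  \<open>x\<close>.\<close>

lemma joint_lowering_left:
  "joint g h \<Longrightarrow> x \<in> lv_part {..<0} \<Longrightarrow> g (uea_of x * u) = 0 \<and>
    (\<forall>us i. length us = r \<longrightarrow> i < r \<longrightarrow> h (us[i := uea_of x * us ! i]) = 0)"
proof (induction arbitrary: u rule: joint.induct)
  case base
  have "coords (pure ones) (us[i := uea_of x * us ! i]) = 0" if us: "length us = r" and i: "i < r" for us i
  proof -
    have "f i (us[i := uea_of x * us ! i] ! i * ones ! i) = 0"
      using us i f_negative[OF i base] by simp
    then show ?thesis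
      using us i by (auto simp: coords_pure intro!: bexI[of _ i])
  qed
  then show ?case using F_negative[OF base] by blast
next
  case (negative g h a)
  have "slot_sum h (\<lambda>u. u * uea_of a) (us[i := uea_of x * us ! i]) = 0"
    if us: "length us = r" and i: "i < r" for us i
  proof -
    have "h (us[i := uea_of x * us ! i, j := us[i := uea_of x * us ! i] ! j * uea_of a]) = 0" if j: "j < r" for j
    proof (cases "j = i")
      case True
      have "h ((us[i := us ! i * uea_of a])[i := uea_of x * us[i := us ! i * uea_of a] ! i]) = 0"
        using negative us i by (metis length_list_update)
      then show ?thesis using True us i by (simp add: mult.assoc)
    next
      case False
      have "h ((us[j := us ! j * uea_of a])[i := uea_of x * us[j := us ! j * uea_of a] ! i]) = 0"
        using negative us i by (metis length_list_update)
      then show ?thesis using False by (simp add: list_update_swap)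
    qed
    then show ?thesis using us by (simp add: slot_sum_eq)
  qed
  moreover have "g (uea_of x * u * uea_of a) = 0"
    using negative.IH[OF negative.prems, of "u * uea_of a"] by (simp add: mult.assoc)
  ultimately show ?case by blast
qed auto

text \<open>At 1, right multiplication by a lowering element equals left multiplication, which gives
  zero on both sides. Only the base case contributes.\<close>

lemma joint_vacuum: "joint g h \<Longrightarrow> g 1 = h ones"
proof (induction rule: joint.induct)
  case base
  then show ?case by (simp add: F_one coords_pure f_one)
next
  case (negative g h x)
  have "h (ones[i := ones ! i * uea_of x]) = 0" if i: "i < r" for i
  proof -
    have "h (ones[i := uea_of x * ones ! i]) = 0"
      using joint_lowering_left[OF negative.hyps, of 1] i by (metis length_replicate)
    then show ?thesis using i by simp
  qed
  moreover have "g (uea_of x) = 0"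
    using joint_lowering_left[OF negative.hyps, of 1] by simp
  ultimately show ?case by (simp add: slot_sum_eq)
qed simp_all

lemma joint_act_add:
  assumes "joint g h" "joint (\<lambda>u. g (u * uea_of y)) (slot_sum h (\<lambda>u. u * uea_of y))"
    "joint (\<lambda>u. g (u * uea_of z)) (slot_sum h (\<lambda>u. u * uea_of z))"
  shows "joint (\<lambda>u. g (u * uea_of (y + z))) (slot_sum h (\<lambda>u. u * uea_of (y + z)))"
proof -
  obtain p where p: "h = coords p" using joint_coords[OF assms(1)] by blast
  have "slot_sum h (\<lambda>u. u * uea_of (y + z)) us
      = slot_sum h (\<lambda>u. u * uea_of y) us + slot_sum h (\<lambda>u. u * uea_of z) us" for us
  proof (cases "length us = r")
    case True
    then have "multilinear uea_scale (length us) h" using multilinear_coords p by simp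
    then show ?thesis unfolding uea_of_add distrib_left by (rule slot_sum_add_map)
  next
    case False
    then show ?thesis by (simp add: slot_sum_eq p coords_length)
  qed
  then have "slot_sum h (\<lambda>u. u * uea_of (y + z))
      = (\<lambda>us. slot_sum h (\<lambda>u. u * uea_of y) us + slot_sum h (\<lambda>u. u * uea_of z) us)"
    by (rule ext)
  moreover have "(\<lambda>u. g (u * uea_of (y + z))) = (\<lambda>u. g (u * uea_of y) + g (u * uea_of z))"
    using joint_linear[OF assms(1)] by (simp add: uea_of_add distrib_left)
  ultimately show ?thesis using joint.add[OF assms(2,3)] by simp
qed

text \<open>A nonnegative element is commuted past the lowering operators down to the pair of
  highest weight vectors, where it multiplies both by the same scalar because the weights of the
  factors add up.\<close>

lemma joint_act_nonneg:
  "joint g h \<Longrightarrow> x \<in> lv_part {0..} \<Longrightarrow>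
    joint (\<lambda>u. g (u * uea_of x)) (slot_sum h (\<lambda>u. u * uea_of x))"
proof (induction arbitrary: x rule: joint.induct)
  case base
  let ?w = "\<Sum>i<r. wts i x"
  have "slot_sum (coords (pure ones)) (\<lambda>u. u * uea_of x) us = ?w * coords (pure ones) us" for us
  proof (cases "length us = r")
    case True
    have "coords (pure ones) (us[i := us ! i * uea_of x]) = wts i x * coords (pure ones) us" if i: "i < r" for i
      using True i by (simp add: coords_pure prod_split_slot[OF i] f_nonneg[OF i base])
    then show ?thesis using True by (simp add: slot_sum_eq sum_distrib_right)
  next
    case False
    then show ?thesis by (simp add: slot_sum_eq coords_length)
  qed
  then have "slot_sum (coords (pure ones)) (\<lambda>u. u * uea_of x) = (\<lambda>us. ?w * coords (pure ones) us)"
    by (rule ext)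
  moreover have "(\<lambda>u. F (u * uea_of x)) = (\<lambda>u. ?w * F u)"
    using F_nonneg[OF base] by (rule ext)
  ultimately show ?case using joint.scale[OF joint.base, of ?w] by simp
next
  case (add g h g' h')
  then show ?case using joint.add[OF add.IH(1)[OF add.prems] add.IH(2)[OF add.prems]]
    by (simp add: slot_sum_add[abs_def])
next
  case (scale g h c)
  then show ?case using joint.scale[OF scale.IH[OF scale.prems], of c]
    by (simp add: slot_sum_mult[abs_def])
next
  case (negative g h a)
  let ?A = "\<lambda>u. u * uea_of a" and ?X = "\<lambda>u. u * uea_of x" and ?y = "lv_bracket x a"
  let ?Y = "\<lambda>u. u * uea_of ?y"
  obtain p where p: "h = coords p" using joint_coords[OF negative.hyps(1)] by blast
  \<comment> \<open>The bracket can have components of both signs: the negative one is covered by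
    the rule for lowering operators, the other by induction.\<close>
  have "joint (\<lambda>u. g (u * uea_of (lv_proj {..<0} ?y + lv_proj {0..} ?y)))
      (slot_sum h (\<lambda>u. u * uea_of (lv_proj {..<0} ?y + lv_proj {0..} ?y)))"
    by (rule joint_act_add[OF negative.hyps(1) joint.negative[OF negative.hyps(1) lv_proj_in_part]
          negative.IH[OF lv_proj_in_part]])
  then have bracket: "joint (\<lambda>u. g (?Y u)) (slot_sum h ?Y)" by (simp flip: lv_proj_split)
  have comm: "u * uea_of x * uea_of a = u * uea_of a * uea_of x + u * uea_of ?y" for u
    using uea_of_commutator[of x a] by (simp add: mult.assoc flip: distrib_left)
  have "slot_sum (slot_sum h ?A) ?X us = slot_sum (slot_sum h ?X) ?A us + slot_sum h ?Y us" for us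
  proof (cases "length us = r")
    case True
    then have "multilinear uea_scale (length us) h" using multilinear_coords p by simp
    then have "slot_sum h (\<lambda>u. ?A (?X u)) us = slot_sum h (\<lambda>u. ?X (?A u)) us + slot_sum h ?Y us"
      unfolding comm by (rule slot_sum_add_map)
    then show ?thesis using slot_sum_commutator[of h ?A ?X us] by (simp add: add_ac)
  next
    case False
    then show ?thesis by (simp add: slot_sum_eq p coords_length)
  qed
  then have "slot_sum (slot_sum h ?A) ?X = (\<lambda>us. slot_sum (slot_sum h ?X) ?A us + slot_sum h ?Y us)"
    by (rule ext)
  moreover have "(\<lambda>u. g (?A (?X u))) = (\<lambda>u. g (?X (?A u)) + g (?Y u))"
    using joint_linear[OF negative.hyps(1)] by (simp add: comm)
  moreover have "joint (\<lambda>u. g (?X (?A u)) + g (?Y u)) (\<lambda>us. slot_sum (slot_sum h ?X) ?A us + slot_sum h ?Y us)"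
    using joint.add[OF joint.negative[OF negative.IH[OF negative.prems] negative.hyps(2)] bracket] .
  ultimately show ?case by simp
qed

lemma joint_act:
  assumes "joint g h"
  shows "joint (\<lambda>u. g (u * uea_of x)) (slot_sum h (\<lambda>u. u * uea_of x))"
proof -
  have "joint (\<lambda>u. g (u * uea_of (lv_proj {..<0} x + lv_proj {0..} x)))
      (slot_sum h (\<lambda>u. u * uea_of (lv_proj {..<0} x + lv_proj {0..} x)))"
    by (rule joint_act_add[OF assms joint.negative[OF assms lv_proj_in_part]
          joint_act_nonneg[OF assms lv_proj_in_part]])
  then show ?thesis by (simp flip: lv_proj_split)
qed

section \<open>The correspondence between the highest weight module and the tensor product\<close>

abbreviation acts :: "loop_vir list \<Rightarrow> ('v list \<Rightarrow>\<^sub>0 complex) \<Rightarrow> ('v list \<Rightarrow>\<^sub>0 complex)" where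
  "acts \<equiv> foldr free_act"

lemma acts_free: "p \<in> free \<Longrightarrow> acts xs p \<in> free"
  by (induction xs) (simp_all add: free_act_closed)

lemma acts_add: "acts xs (p + q) = acts xs p + acts xs q"
  by (induction xs) (simp_all add: free_act_eq cscale_ext_simps)

lemma acts_cscale: "acts xs (cscale c p) = cscale c (acts xs p)"
  by (induction xs) (simp_all add: free_act_eq cscale_ext_simps)

lemma coords_acts_cong:
  assumes "p \<in> free" "q \<in> free" "coords p = coords q"
  shows "coords (acts xs p) = coords (acts xs q)"
  by (induction xs) (use assms in \<open>auto simp: coords_act acts_free\<close>)

text \<open>Words of Lie algebra elements are used instead of the enveloping algebra, since the free
  space is not a module over it.\<close>

definition corresponds :: "uea \<Rightarrow> ('v list \<Rightarrow>\<^sub>0 complex) \<Rightarrow> bool" where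
  "corresponds u p \<longleftrightarrow> (\<forall>xs. F (uea_word xs * u) = coords (acts xs p) ones)"

lemma corresponds_add: "corresponds u p \<Longrightarrow> corresponds v q \<Longrightarrow> corresponds (u + v) (p + q)"
  by (simp add: corresponds_def distrib_left F_add acts_add coords_add)

lemma corresponds_scale: "corresponds u p \<Longrightarrow> corresponds (uea_scale c u) (cscale c p)"
  by (simp add: corresponds_def uea_scale_mult_right F_scale acts_cscale coords_cscale)

lemma corresponds_act: "corresponds u p \<Longrightarrow> corresponds (uea_of x * u) (free_act x p)"
  unfolding corresponds_def
proof
  fix xs assume "\<forall>xs. F (uea_word xs * u) = coords (acts xs p) ones"
  from this[rule_format, of "xs @ [x]"]
  show "F (uea_word xs * (uea_of x * u)) = coords (acts xs (free_act x p)) ones"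
    by (simp add: mult.assoc)
qed

lemma corresponds_cong:
  assumes "corresponds u p" "p \<in> free" "q \<in> free" "coords p = coords q"
  shows "corresponds u q"
  using assms(1) unfolding corresponds_def coords_acts_cong[OF assms(2-4)] .

lemma corresponds_one: "corresponds 1 (pure ones)"
  unfolding corresponds_def
proof
  fix xs
  have "joint (\<lambda>u. F (u * uea_word xs)) (coords (acts xs (pure ones)))"
  proof (induction xs)
    case Nil
    then show ?case by (simp add: joint.base)
  next
    case (Cons x xs)
    have "coords (acts (x # xs) (pure ones)) = slot_sum (coords (acts xs (pure ones))) (\<lambda>u. u * uea_of x)"
      by (rule ext) (simp add: coords_act acts_free pure_free)
    then show ?case using joint_act[OF Cons, of x] by (simp add: mult.assoc)
  qed
  from joint_vacuum[OF this] show "F (uea_word xs * 1) = coords (acts xs (pure ones)) ones" by simp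
qed

lemma corresponds_total_left: "\<exists>p\<in>free. corresponds u p"
proof (induction u rule: uea_left_induct)
  case (add u v)
  then show ?case using corresponds_add free_add by blast
next
  case (scale c u)
  then show ?case using corresponds_scale free_cscale by blast
next
  case one
  then show ?case using corresponds_one pure_free by blast
next
  case (letter x u)
  then show ?case using corresponds_act free_act_closed by blast
qed

text \<open>Generation by the highest weight tensor: starting from \<open>ones\<close>, the slots
  are filled one at a time, and slot \<open>k\<close> is built up letter by letter with elements
  \<open>pmul (e k) x\<close>, which leave the other slots alone.\<close>

lemma corresponds_pure:
  "k \<le> r \<Longrightarrow> length us = r \<Longrightarrow> (\<forall>i\<in>{k..<r}. us ! i = 1) \<Longrightarrow> \<exists>u. corresponds u (pure us)"
proof (induction k arbitrary: us)
  case 0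
  then have "us = ones" by (intro nth_equalityI) auto
  then show ?case using corresponds_one by blast
next
  case (Suc k)
  have k: "k < r" using Suc.prems by simp
  have "\<exists>w. corresponds w (pure (us[k := u]))" for u
  proof (induction u rule: uea_left_induct)
    case (add u v)
    then obtain w w' where "corresponds (w + w') (pure (us[k := u]) + pure (us[k := v]))"
      using corresponds_add by blast
    moreover have "coords (pure (us[k := u]) + pure (us[k := v])) = coords (pure (us[k := u + v]))"
      using rels_pure_add[OF Suc.prems(2) k, of u v]
      by (auto simp: rels_eq fun_eq_iff coords_diff coords_add)
    ultimately show ?case using corresponds_cong pure_free free_add by blast
  next
    case (scale c u)
    then obtain w where "corresponds (uea_scale c w) (cscale c (pure (us[k := u])))"
      using corresponds_scale by blast
    moreover have "coords (cscale c (pure (us[k := u]))) = coords (pure (us[k := uea_scale c u]))"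
      using rels_pure_scale[OF Suc.prems(2) k, of c u]
      by (auto simp: rels_eq fun_eq_iff coords_diff coords_cscale)
    ultimately show ?case using corresponds_cong pure_free free_cscale by blast
  next
    case one
    have "us[k := 1] ! i = 1" if "i \<in> {k..<r}" for i
      using Suc.prems that by (cases "i = k") auto
    then show ?case using Suc.IH[of "us[k := 1]"] Suc.prems by simp
  next
    case (letter x u)
    then obtain w where "corresponds (uea_of (pmul (e k) x) * w) (free_act (pmul (e k) x) (pure (us[k := u])))"
      using corresponds_act by blast
    moreover have "coords (free_act (pmul (e k) x) (pure (us[k := u]))) = coords (pure (us[k := uea_of x * u]))"
    proof (rule ext)
      fix ws
      show "coords (free_act (pmul (e k) x) (pure (us[k := u]))) ws = coords (pure (us[k := uea_of x * u])) ws"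
      proof (cases "length ws = r")
        case True
        then show ?thesis
          using Suc.prems(2) k
          by (simp add: coords_act_e pure_free coords_pure prod_split_slot[OF k] mult.assoc)
      qed (simp add: coords_length)
    qed
    ultimately show ?case using corresponds_cong pure_free free_act_closed by blast
  qed
  from this[of "us ! k"] show ?case by simp
qed

lemma corresponds_total_right:
  assumes "p \<in> free"
  shows "\<exists>u. corresponds u p"
proof -
  have single: "\<exists>u. corresponds u (Poly_Mapping.single vs 1)" if "vs \<in> pure_tensors Ms" for vs
  proof -
    let ?us = "map (\<lambda>i. rep i (vs ! i)) [0..<r]"
    have "pure ?us = Poly_Mapping.single vs 1"
      unfolding pure_def using that
      by (intro arg_cong[where f = "\<lambda>vs. Poly_Mapping.single vs 1"] nth_equalityI)
        (auto simp: mem_pure_tensors m_rep)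
    then show ?thesis using corresponds_pure[of r ?us] by simp
  qed
  have "\<exists>u. corresponds u (\<Sum>vs\<in>A. cscale (Poly_Mapping.lookup p vs) (Poly_Mapping.single vs 1))"
    if "finite A" "A \<subseteq> pure_tensors Ms" for A
    using that
  proof (induction A rule: finite_induct)
    case empty
    have "corresponds (uea_scale 0 1) (cscale 0 (pure ones))" by (rule corresponds_scale[OF corresponds_one])
    then show ?case by auto
  next
    case (insert vs A)
    then obtain u v where "corresponds u (Poly_Mapping.single vs 1)"
      "corresponds v (\<Sum>vs\<in>A. cscale (Poly_Mapping.lookup p vs) (Poly_Mapping.single vs 1))"
      using single by blast
    then have "corresponds (uea_scale (Poly_Mapping.lookup p vs) u + v)
        (\<Sum>vs\<in>insert vs A. cscale (Poly_Mapping.lookup p vs) (Poly_Mapping.single vs 1))"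
      unfolding sum.insert[OF insert.hyps] by (intro corresponds_add corresponds_scale)
    then show ?case by blast
  qed
  from this[of "Poly_Mapping.keys p"] show ?thesis
    unfolding sum_keys_single using assms by (simp add: mem_free)
qed

text \<open>Dual to \<open>corresponds_pure\<close>: the letters of the coordinate in slot
  \<open>k\<close> are transferred to the tensor as actions of \<open>pmul (e k) x\<close>, until
  only the coordinate at \<open>ones\<close> is left.\<close>

lemma coords_eq_0_if_acts_vanish:
  assumes "p \<in> free" "\<And>xs. coords (acts xs p) ones = 0"
  shows "coords p us = 0"
proof (cases "length us = r")
  case True
  have "coords p us = 0"
    if "k \<le> r" "p \<in> free" "\<And>xs. coords (acts xs p) ones = 0" "length us = r" "\<forall>i\<in>{k..<r}. us ! i = 1"
    for k p us
    using that
  proof (induction k arbitrary: us p)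
    case 0
    then have "us = ones" by (intro nth_equalityI) auto
    then show ?case using 0(3)[of "[]"] by simp
  next
    case (Suc k)
    have k: "k < r" using Suc.prems by simp
    \<comment> \<open>The tensor has to vary in this induction, because each transferred letter
      replaces it by its image.\<close>
    have "coords q (us[k := u]) = 0" if "q \<in> free" "\<And>xs. coords (acts xs q) ones = 0" for u q
      using that
    proof (induction u arbitrary: q rule: uea_right_induct)
      case (add u v)
      then show ?case by (simp add: multilinear_add[OF multilinear_coords k Suc.prems(4)])
    next
      case (scale c u)
      then show ?case by (simp add: multilinear_scale[OF multilinear_coords k Suc.prems(4)])
    next
      case one
      have "us[k := 1] ! i = 1" if "i \<in> {k..<r}" for i
        using Suc.prems that by (cases "i = k") auto
      then show ?case using Suc.IH[of q "us[k := 1]"] one Suc.prems by simp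
    next
      case (letter u x)
      have "coords (free_act (pmul (e k) x) q) (us[k := u]) = 0"
      proof (rule letter.IH)
        show "free_act (pmul (e k) x) q \<in> free" using letter.prems(1) by (rule free_act_closed)
        show "coords (acts xs (free_act (pmul (e k) x) q)) ones = 0" for xs
          using letter.prems(2)[of "xs @ [pmul (e k) x]"] by simp
      qed
      then show ?case using letter.prems(1) Suc.prems(4) k by (simp add: coords_act_e)
    qed
    from this[OF Suc.prems(2,3), of "us ! k"] show ?case by simp
  qed
  from this[of r p us] show ?thesis using assms True by simp
qed (simp add: coords_length)

text \<open>Both sides express that no translate has a component at the highest weight
  vector.\<close>

lemma corresponds_kernel:
  assumes "p \<in> free" "corresponds u p"
  shows "(\<forall>w. F (w * u) = 0) \<longleftrightarrow> p \<in> rels"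
proof
  assume "\<forall>w. F (w * u) = 0"
  then have "coords (acts xs p) ones = 0" for xs using assms(2) unfolding corresponds_def by metis
  then show "p \<in> rels" using coords_eq_0_if_acts_vanish[OF assms(1)] assms(1) by (auto simp: rels_eq)
next
  assume "p \<in> rels"
  then have "coords p = coords 0" by (auto simp: rels_eq coords_0)
  then have "coords (acts xs p) = coords (acts xs 0)" for xs
    using coords_acts_cong[OF assms(1) free_0] by blast
  moreover have "acts xs 0 = 0" for xs using acts_cscale[of xs 0 0] by simp
  ultimately have word: "F (uea_word xs * u) = 0" for xs
    using assms(2) by (simp add: corresponds_def coords_0)
  show "\<forall>w. F (w * u) = 0"
  proof
    show "F (w * u) = 0" for w
      by (induction w rule: uea_word_induct)
        (simp_all add: word distrib_right F_add uea_scale_mult_left F_scale)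
  qed
qed

lemma lv_isomorphic_tensor_product:
  assumes "lv_presentation uea_scale (\<lambda>x u. uea_of x * u) UNIV {u. \<forall>w. F (w * u) = 0} m' M"
  shows "lv_isomorphic M (tensor_product Ms)"
  using assms lv_presentation_tensor
proof (rule lv_isomorphicI[where R = corresponds])
  show "\<exists>p\<in>free. corresponds u p" for u by (rule corresponds_total_left)
  show "\<exists>u\<in>UNIV. corresponds u p" if "p \<in> free" for p using corresponds_total_right[OF that] by simp
qed (simp_all add: corresponds_add corresponds_scale corresponds_act corresponds_kernel)

end

section \<open>Decomposition of the highest weight\<close>

lemma comaximal_mult:
  fixes p q q' :: "'a::comm_ring_1"
  assumes "\<exists>a b. a * p + b * q = 1" "\<exists>a b. a * p + b * q' = 1"
  shows "\<exists>a b. a * p + b * (q * q') = 1"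
proof -
  obtain a b c d where "a * p + b * q = 1" "c * p + d * q' = 1" using assms by blast
  then have "(a * p + b * q) * (c * p + d * q') = 1" by simp
  then have "(a * c * p + a * d * q' + b * q * c) * p + (b * d) * (q * q') = 1"
    by (simp add: algebra_simps)
  then show ?thesis by blast
qed

lemma comaximal_prod:
  fixes p :: "'a::comm_ring_1"
  assumes "\<And>i. i \<in> I \<Longrightarrow> \<exists>a b. a * p + b * q i = 1"
  shows "\<exists>a b. a * p + b * prod q I = 1"
  using assms
proof (induction I rule: infinite_finite_induct)
  case (insert i I)
  then show ?case using comaximal_mult[of p "q i" "prod q I"] by simp
qed (auto intro: exI[of _ 0] exI[of _ 1])

lemma comaximal_power:
  fixes p :: "'a::comm_ring_1"
  assumes "\<exists>a b. a * p + b * q = 1"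
  shows "\<exists>a b. a * p + b * q ^ n = 1"
  using comaximal_prod[of "{..<n}" p "\<lambda>_. q"] assms by simp

lemma comaximal_commute:
  "(\<exists>a b. a * p + b * q = 1) \<longleftrightarrow> (\<exists>a b. a * q + b * p = (1::'a::comm_ring_1))"
  by (metis add.commute)

lemma comaximal_linear_powers:
  fixes y z :: complex
  assumes "y \<noteq> z"
  shows "\<exists>a b. a * [:- y, 1:] ^ k + b * [:- z, 1:] ^ n = 1"
proof -
  \<comment> \<open>The difference of t - y and t - z is the constant z - y, invertible by
    assumption.\<close>
  define c where "c = 1 / (z - y)"
  have "c * z - c * y = 1" using assms by (simp add: c_def diff_divide_distrib[symmetric])
  then have "[:c:] * [:- y, 1:] + [:- c:] * [:- z, 1:] = 1"
    by (simp add: one_pCons mult.commute)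
  then have "\<exists>a b. a * [:- y, 1:] + b * [:- z, 1:] = 1" by blast
  then show ?thesis
    by (intro comaximal_power) (subst comaximal_commute, intro comaximal_power, subst comaximal_commute)
qed

text \<open>Multiply \<open>x\<close> by the Bezout identity of one factor and the product of the
  others: each term then contains all factors.\<close>

lemma prod_dvd_if_comaximal:
  fixes x :: "'a::comm_ring_1"
  assumes "finite I" "\<And>i. i \<in> I \<Longrightarrow> p i dvd x"
    and "\<And>i k. i \<in> I \<Longrightarrow> k \<in> I \<Longrightarrow> i \<noteq> k \<Longrightarrow> \<exists>a b. a * p i + b * p k = 1"
  shows "prod p I dvd x"
  using assms
proof (induction I rule: finite_induct)
  case (insert i I)
  have "\<exists>a b. a * p i + b * prod p I = 1"
    using insert.hyps insert.prems(2) by (intro comaximal_prod) auto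
  then obtain a b where ab: "a * p i + b * prod p I = 1" by blast
  obtain c where c: "x = p i * c" using insert.prems(1)[of i] by (auto simp: dvd_def)
  have "prod p I dvd x" using insert by auto
  then obtain d where d: "x = prod p I * d" by (auto simp: dvd_def)
  have "x = x * (a * p i + b * prod p I)" by (simp add: ab)
  also have "\<dots> = a * p i * x + b * prod p I * x" by (simp add: algebra_simps)
  also have "\<dots> = a * p i * (prod p I * d) + b * prod p I * (p i * c)"
    using c d by simp
  also have "\<dots> = p i * prod p I * (a * d + b * c)" by (simp add: algebra_simps)
  finally show ?case using insert.hyps by (simp add: dvd_def) blast
qed simp

lemma chinese_remainder_idempotents:
  fixes p :: "nat \<Rightarrow> 'a::comm_ring_1"
  assumes "\<And>i k. i < n \<Longrightarrow> k < n \<Longrightarrow> i \<noteq> k \<Longrightarrow> \<exists>a b. a * p i + b * p k = 1"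
  shows "\<exists>e. (\<forall>i<n. p i dvd e i - 1) \<and> (\<forall>i<n. \<forall>k<n. i \<noteq> k \<longrightarrow> p i dvd e k) \<and>
    (\<forall>i<n. prod p {..<n} dvd e i * p i) \<and> prod p {..<n} dvd (\<Sum>i<n. e i) - 1"
proof -
  have "\<exists>a b. a * p i + b * prod p ({..<n} - {i}) = 1" if "i < n" for i
    using assms that by (intro comaximal_prod) auto
  then obtain a b where ab: "\<And>i. i < n \<Longrightarrow> a i * p i + b i * prod p ({..<n} - {i}) = 1" by metis
  \<comment> \<open>The part of the Bezout identity that contains all the other \<open>p k\<close>:
    it is 1 modulo \<open>p i\<close> and 0 modulo the rest.\<close>
  define e where "e i = b i * prod p ({..<n} - {i})" for i
  have diag: "p i dvd e i - 1" if "i < n" for i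
  proof -
    have "e i - 1 = p i * - a i" using ab[OF that] by (simp add: e_def algebra_simps eq_diff_eq)
    then show ?thesis by (rule dvdI)
  qed
  moreover have off: "p i dvd e k" if "i < n" "k < n" "i \<noteq> k" for i k
    unfolding e_def using that by (intro dvd_mult dvd_prodI) auto
  moreover have "prod p {..<n} dvd e i * p i" if "i < n" for i
  proof -
    have "prod p {..<n} = p i * prod p ({..<n} - {i})" using that by (intro prod.remove) auto
    then have "e i * p i = prod p {..<n} * b i" by (simp add: e_def algebra_simps)
    then show ?thesis by (rule dvdI)
  qed
  moreover have "prod p {..<n} dvd (\<Sum>i<n. e i) - 1"
  \<comment> \<open>Modulo \<open>p i\<close> only \<open>e i\<close> survives in the sum, and it is
    1.\<close>
  proof (rule prod_dvd_if_comaximal)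
    fix i assume i: "i \<in> {..<n}"
    have "(\<Sum>k<n. e k) - 1 = (e i - 1) + (\<Sum>k\<in>{..<n} - {i}. e k)"
      using i by (subst sum.remove[of _ i]) auto
    also have "p i dvd \<dots>" using i diag off by (intro dvd_add dvd_sum) auto
    finally show "p i dvd (\<Sum>k<n. e k) - 1" .
  qed (use assms in auto)
  ultimately show ?thesis by blast
qed

section \<open>Splitting the weight and assembling the isomorphism\<close>

context highest_weight_functional
begin

lemma comaximal_decomposition:
  assumes "finite_dim_weight_spaces (highest_weight_module \<phi>)"
  obtains n :: nat and z k e where "n > 0" "\<And>i. i < n \<Longrightarrow> z i \<noteq> 0"
    "\<And>i. i < n \<Longrightarrow> [:- z i, 1:] ^ k i dvd e i - 1"
    "\<And>i j. i < n \<Longrightarrow> j < n \<Longrightarrow> i \<noteq> j \<Longrightarrow> [:- z i, 1:] ^ k i dvd e j"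
    "\<And>i x. i < n \<Longrightarrow> \<phi> (lv_proj {0} (pmul (e i * [:- z i, 1:] ^ k i) x)) = 0"
    "\<And>x. \<phi> (lv_proj {0} (pmul ((\<Sum>i<n. e i) - 1) x)) = 0"
proof -
  obtain P where P: "P \<noteq> 0" "poly P 0 \<noteq> 0" "poly P 1 = 0"
      and kill: "\<And>x. \<phi> (lv_proj {0} (pmul P x)) = 0"
    using ex_annihilating_poly_nonzero_roots[OF assms] by blast
  obtain zs where zs: "set zs = {z. poly P z = 0}" "distinct zs"
    using finite_distinct_list[OF poly_roots_finite[OF P(1)]] by blast
  let ?n = "length zs" and ?p = "\<lambda>i. [:- (zs ! i), 1:] ^ Polynomial.order (zs ! i) P"
  have "(\<Prod>z | poly P z = 0. [:- z, 1:] ^ Polynomial.order z P) = prod ?p {..<?n}"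
    using prod.reindex_bij_betw[OF bij_betw_nth[OF zs(2) refl refl], of "\<lambda>z. [:- z, 1:] ^ Polynomial.order z P"] zs(1)
    by simp
  then have "Polynomial.smult (lead_coeff P) (prod ?p {..<?n}) = P"
    using complex_poly_decompose[of P] by (simp only:)
  moreover have "lead_coeff P \<noteq> 0" using P(1) by simp
  ultimately obtain c where c: "Polynomial.smult c (prod ?p {..<?n}) = P" "c \<noteq> 0" by blast
  \<comment> \<open>The factorization into linear powers leaves a constant factor, which is nonzero
    and can be cancelled.\<close>
  have kill': "\<phi> (lv_proj {0} (pmul (prod ?p {..<?n}) x)) = 0" for x
  proof -
    have "\<phi> (lv_proj {0} (pmul (Polynomial.smult c (prod ?p {..<?n})) x)) = 0"
      unfolding c(1) by (rule kill)
    then show ?thesis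
      using c(2) by (simp only: pmul_smult wt_cscale mult_eq_0_iff) simp
  qed
  have "\<exists>a b. a * ?p i + b * ?p j = 1" if "i < ?n" "j < ?n" "i \<noteq> j" for i j
    using zs(2) that by (intro comaximal_linear_powers) (simp add: nth_eq_iff_index_eq)
  from chinese_remainder_idempotents[of ?n ?p, OF this] obtain e where
    e: "\<forall>i<?n. ?p i dvd e i - 1" "\<forall>i<?n. \<forall>j<?n. i \<noteq> j \<longrightarrow> ?p i dvd e j"
      "\<forall>i<?n. prod ?p {..<?n} dvd e i * ?p i" "prod ?p {..<?n} dvd (\<Sum>i<?n. e i) - 1"
    by blast
  \<comment> \<open>The root 1 was put into \<open>P\<close> for this purpose: there is at least one
    factor.\<close>
  have "1 \<in> set zs" using P(3) zs(1) by simp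
  then have "?n > 0" by (cases zs) auto
  moreover have "zs ! i \<noteq> 0" if "i < ?n" for i
  proof
    assume "zs ! i = 0"
    then have "0 \<in> set zs" using that by (metis nth_mem)
    then show False unfolding zs(1) using P(2) by simp
  qed
  moreover have "?p i dvd e i - 1" if "i < ?n" for i using e(1) that by blast
  moreover have "?p i dvd e j" if "i < ?n" "j < ?n" "i \<noteq> j" for i j using e(2) that by blast
  moreover have "\<phi> (lv_proj {0} (pmul (e i * ?p i) x)) = 0" if "i < ?n" for i x
    by (rule wt_pmul_dvd[OF kill']) (use e(3) that in blast)
  moreover have "\<phi> (lv_proj {0} (pmul ((\<Sum>i<?n. e i) - 1) x)) = 0" for x
    by (rule wt_pmul_dvd[OF kill' e(4)])
  ultimately show thesis
    by (rule that[of ?n "(!) zs" "\<lambda>i. Polynomial.order (zs ! i) P" e])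
qed

lemma lv_presentation_hw_vev:
  "lv_presentation uea_scale (\<lambda>x u. uea_of x * u) UNIV {u. \<forall>w. uea_vev (w * u) = 0} hw_map (highest_weight_module \<phi>)"
  using lv_presentation_hw by (simp add: radical_def)

theorem highest_weight_module_tensor_decomposition:
  assumes "finite_dim_weight_spaces (highest_weight_module \<phi>)"
  shows "\<exists>Ns. Ns \<noteq> [] \<and> (\<forall>N\<in>set Ns. generalized_evaluation_module N) \<and>
    lv_isomorphic (highest_weight_module \<phi>) (tensor_product Ns)"
proof (rule comaximal_decomposition[OF assms])
  fix n :: nat and z k e
  assume n: "n > 0" and z: "\<And>i. i < n \<Longrightarrow> z i \<noteq> 0"
    and diag: "\<And>i. i < n \<Longrightarrow> [:- z i, 1:] ^ k i dvd e i - 1"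
    and off: "\<And>i j. i < n \<Longrightarrow> j < n \<Longrightarrow> i \<noteq> j \<Longrightarrow> [:- z i, 1:] ^ k i dvd e j"
    and kill: "\<And>i x. i < n \<Longrightarrow> \<phi> (lv_proj {0} (pmul (e i * [:- z i, 1:] ^ k i) x)) = 0"
    and sum_e: "\<And>x. \<phi> (lv_proj {0} (pmul ((\<Sum>i<n. e i) - 1) x)) = 0"
  define \<psi> where "\<psi> i x = \<phi> (lv_proj {0} (pmul (e i) x))" for i x
  have functional: "zero_part_functional (\<psi> i)" for i
    by (simp add: \<psi>_def zero_part_functional_def pmul_add_right pmul_cscale_right wt_add wt_cscale)
  have hwf: "highest_weight_functional (\<psi> i)" for i
    using functional by unfold_locales
  have hw: "highest_weight (\<lambda>x. \<psi> i (lv_proj {0} x))" for i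
    by (rule zero_part_functional_highest_weight[OF functional])
  have \<psi>_proj: "\<psi> i (lv_proj {0} x) = \<psi> i x" for i x
    by (simp add: \<psi>_def lv_proj_pmul lv_proj_part[OF lv_proj_in_part])
  \<comment> \<open>By \<open>sum_e\<close>, \<phi> does not distinguish multiplication by the sum
    of the \<open>e i\<close> from the identity, so the weights of the factors add up to
    \<phi>.\<close>
  have \<psi>_sum: "(\<Sum>i<n. \<psi> i (lv_proj {0} x)) = \<phi> (lv_proj {0} x)" for x
  proof -
    have "pmul (\<Sum>i<n. e i) x = pmul ((\<Sum>i<n. e i) - 1) x + x"
      using pmul_add_left[of "(\<Sum>i<n. e i) - 1" 1 x] by simp
    then have "\<phi> (lv_proj {0} (pmul (\<Sum>i<n. e i) x)) = \<phi> (lv_proj {0} x)"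
      by (simp add: wt_add sum_e)
    then show ?thesis by (simp only: \<psi>_proj) (simp add: \<psi>_def pmul_sum_left wt_sum)
  qed
  have \<psi>_kill: "\<psi> i (pmul ([:- z i, 1:] ^ k i) x) = 0" if "i < n" for i x
    using kill[OF that] by (simp add: \<psi>_def pmul_mult)
  define Ns where "Ns = map (\<lambda>i. highest_weight_module (\<psi> i)) [0..<n]"
  have eval: "generalized_evaluation_module (highest_weight_module (\<psi> i))" if "i < n" for i
    unfolding generalized_evaluation_module_def
  proof (intro exI[of _ "\<psi> i"] conjI functional refl exI[of _ "z i"] exI[of _ "k i"] allI z[OF that])
    show "\<psi> i (lv_tensor_poly (Dgen 0) l ([:- z i, 1:] ^ k i)) = 0"
      "\<psi> i (lv_tensor_poly Cgen l ([:- z i, 1:] ^ k i)) = 0" for l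
      by (simp_all only: lv_tensor_poly_eq_pmul \<psi>_kill[OF that])
  qed
  have factors: "highest_weight_factors Ns (\<lambda>i. highest_weight.uea_vev (\<lambda>x. \<psi> i (lv_proj {0} x)))
      (\<lambda>i. highest_weight_functional.hw_map (\<psi> i)) (\<lambda>i x. \<psi> i (lv_proj {0} x))
      (\<lambda>i. [:- z i, 1:] ^ k i) e uea_vev"
  proof (intro highest_weight_factors.intro presented_factors.intro highest_weight_factors_axioms.intro)
    show "uea_vev (u * uea_of x) = (\<Sum>i<length Ns. \<psi> i (lv_proj {0} x)) * uea_vev u"
      if "x \<in> lv_part {0..}" for u x
      by (simp only: Ns_def length_map length_upt diff_zero \<psi>_sum uea_vev_nonneg[OF that])
    show "lv_presentation uea_scale (\<lambda>x u. uea_of x * u) UNIV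
        {u. \<forall>w. highest_weight.uea_vev (\<lambda>x. \<psi> i (lv_proj {0} x)) (w * u) = 0}
        (highest_weight_functional.hw_map (\<psi> i)) (Ns ! i)" if "i < length Ns" for i
      using highest_weight_functional.lv_presentation_hw_vev[OF hwf, of i] that by (simp add: Ns_def)
    show "highest_weight.uea_vev (\<lambda>x. \<psi> i (lv_proj {0} x)) (u * uea_of (pmul ([:- z i, 1:] ^ k i) x) * v) = 0"
      if "i < length Ns" for i u v x
      using \<psi>_kill[of i] that by (intro highest_weight.uea_vev_pmul[OF hw]) (simp add: \<psi>_proj Ns_def)
  qed (use diag off in \<open>simp_all add: Ns_def uea_vev_add uea_vev_scale uea_vev_negative
      highest_weight.uea_vev_add[OF hw] highest_weight.uea_vev_scale[OF hw] highest_weight.uea_vev_1[OF hw]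
      highest_weight.uea_vev_nonneg[OF hw] highest_weight.uea_vev_negative[OF hw]\<close>)
  have "lv_isomorphic (highest_weight_module \<phi>) (tensor_product Ns)"
    by (rule highest_weight_factors.lv_isomorphic_tensor_product[OF factors lv_presentation_hw_vev])
  moreover have "Ns \<noteq> []" using n by (simp add: Ns_def)
  moreover have "\<forall>N\<in>set Ns. generalized_evaluation_module N" using eval by (auto simp: Ns_def)
  ultimately show ?thesis by blast
qed

end

theorem theorem6p4:
  fixes M :: "uea set set lv_module"
  assumes "irreducible_highest_weight_module M"
    and "finite_dim_weight_spaces M"
  shows "\<exists>Ns. Ns \<noteq> [] \<and> (\<forall>N\<in>set Ns. generalized_evaluation_module N) \<and>
           lv_isomorphic M (tensor_product Ns)"
proof -
  obtain \<phi> where \<phi>: "zero_part_functional \<phi>" "M = highest_weight_module \<phi>"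
    using assms(1) by (auto simp: irreducible_highest_weight_module_def)
  interpret highest_weight_functional \<phi> by unfold_locales (rule \<phi>(1))
  show ?thesis
    using highest_weight_module_tensor_decomposition assms(2) unfolding \<phi>(2) by blast
qed

end
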